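(* Let \[ f(t,x):=\mathbb{E}\Big[\exp\Big(\int_t^T\sum_{i=1}^3u_i(s)p_i(X_s)ds+v(T)q(X_T)\Big)\,\Big|\,X_t=x\Big]. \] Then $f$ is $C^\infty$ in $x$, $C^1$ in $t$, and solves \[ f_t(t,x)+f_x(t,x)(a+bx)+\tfrac12c^2f_{xx}(t,x)+f(t,x)\sum_{i=1}^3u_i(t)p_i(x)=0,\qquad f(T,x)=\exp(v(T)q(x)). \]
   Context: Let $W$ be a Brownian motion on a filtered probability space with usual conditions; $a,b\in\mathbb{R}$, $c\ne0$, $T>0$; $dX_t=(a+bX_t)dt+c\,dW_t$. A power series $p=\sum p_kx^k$ is negligible to double factorial if $\limsup_k(|p_k|(k-1)!!)^{1/k}=0$, $(-1)!!=0!!=1$. Standing assumptions: $u_1,u_2,u_3,v:[0,T]\to\mathbb{C}$ continuous with $\Re(u_1)\le0$, $\Re(u_2)=\Re(u_3)=\Re(v)=0$; $p_1=p^2$ for a real-coefficient power series $p$ negligible to double factorial; $p_2,p_3,q$ real-coefficient power series negligible to double factorial. "$C^\infty$ in $x$": all $x$-derivatives exist and are jointly continuous in $(t,x)$; "$C^1$ in $t$": $\partial_t$ exists and is jointly continuous. *)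

theory Defs
  imports "HOL-Probability.Probability"
begin

definition brownian_motion :: "'a measure \<Rightarrow> (real \<Rightarrow> 'a \<Rightarrow> real) \<Rightarrow> bool" where
  "brownian_motion M W \<longleftrightarrow>
     prob_space M \<and>
     (\<forall>t. W t \<in> borel_measurable M) \<and>
     (\<forall>\<omega>\<in>space M. W 0 \<omega> = 0 \<and> continuous_on {0..} (\<lambda>t. W t \<omega>)) \<and>
     (\<forall>s t. 0 \<le> s \<and> s < t \<longrightarrow>
        distributed M lborel (\<lambda>\<omega>. W t \<omega> - W s \<omega>)
          (\<lambda>y. ennreal (normal_density 0 (sqrt (t - s)) y))) \<and>
     (\<forall>ts :: real list. sorted_wrt (<) ts \<and> (\<forall>t\<in>set ts. 0 \<le> t) \<longrightarrow>
        prob_space.indep_vars M (\<lambda>_. borel)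
          (\<lambda>i \<omega>. W (ts ! Suc i) \<omega> - W (ts ! i) \<omega>) {..<length ts - 1})"

fun dfact :: "nat \<Rightarrow> nat" where
  "dfact 0 = 1"
| "dfact (Suc 0) = 1"
| "dfact (Suc (Suc n)) = Suc (Suc n) * dfact n"

definition dfact_pred :: "nat \<Rightarrow> nat" where
  "dfact_pred k = (if k = 0 then 1 else dfact (k - 1))"

definition negligible_dfact :: "(nat \<Rightarrow> real) \<Rightarrow> bool" where
  "negligible_dfact p \<longleftrightarrow>
     limsup (\<lambda>k. ereal (root k (\<bar>p k\<bar> * real (dfact_pred k)))) = 0"

definition powser :: "(nat \<Rightarrow> real) \<Rightarrow> real \<Rightarrow> real" where
  "powser p x = (\<Sum>k. p k * x ^ k)"

definition cauchy_prod :: "(nat \<Rightarrow> real) \<Rightarrow> (nat \<Rightarrow> real) \<Rightarrow> nat \<Rightarrow> real" where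
  "cauchy_prod p q k = (\<Sum>j\<le>k. p j * q (k - j))"

end

theory Submission
  imports Defs
begin

text \<open>
  Write \<open>W\<close> for the driving path and \<open>m\<close> for its maximal modulus on \<open>[0, T]\<close>. The solution started at
  \<open>(t, x)\<close> is affine in \<open>x\<close> and bounded by a multiple of \<open>1 + \<bar>x\<bar> + m\<close>. Power series negligible to double
  factorial, and all their derivatives, grow more slowly than every Gaussian \<open>exp (e * z\<^sup>2)\<close>, and
  \<open>exp (m\<^sup>2 / (8 * T))\<close> is integrable by Doob's inequality. As the exponent has nonpositive real part, all
  \<open>x\<close>-derivatives of the path functional \<open>F\<close> are dominated, so they may be taken under the expectation.

  For the time derivative let \<open>s < t\<close>. By the flow property the functional at time \<open>s\<close> is the functional at time
  \<open>t\<close>, started from the displaced point \<open>x + d\<close>, times the exponential of an integral over \<open>[s, t]\<close>. In the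
  second-order Taylor expansion in \<open>d\<close> the Brownian increment is independent of the derivatives of \<open>F\<close> at time
  \<open>t\<close>: its first power averages to \<open>0\<close> and its square to \<open>t - s\<close>. The remaining terms of order \<open>t - s\<close> are
  dominated, and the remainder has expectation of order \<open>(t - s) powr (3 / 2)\<close>.
\<close>

text \<open>The noise is additive, so the solution is an explicit continuous functional of the
  driving path: no stochastic integral occurs, and growth estimates hold path by path with constants
  independent of the path. Besides the moments of single increments, probability enters through the
  integrability of the Gaussian of \<open>m\<close> and through the independence of an increment
  from the path before it and from the increments after it. The past serves the martingale argument
  in Doob's inequality, the future serves the Taylor expansion.

  The obstacle is growth: the exponent is bounded only by small Gaussians, so its exponential must
  be controlled by sign. As \<open>p1\<close> is the square of a real series, the exponential has
  modulus at most 1, and each derivative multiplies it by a polynomial in factors of arbitrarily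
  small Gaussian rate. One fixed integrable rate therefore serves all orders.

  The variable \<open>m\<close> sees the whole path and is not independent of the increment over
  \<open>[s, t]\<close>. In the Taylor remainder the two are separated by a weighted AM-GM
  inequality and a sixth moment.\<close>

section \<open>Integrals of continuous functions\<close>

text \<open>Uniform continuity bounds the error on each cell. The point is that the sums involve
  finitely many values of \<open>f\<close>, so measurability in a parameter passes to the
  integral.\<close>

lemma riemann_sums_tendsto_integral:
  fixes f :: "real \<Rightarrow> 'b::euclidean_space"
  assumes f: "continuous_on {0..1} f"
  shows "(\<lambda>n. (1 / real (Suc n)) *\<^sub>R (\<Sum>k<Suc n. f (real k / real (Suc n)))) \<longlonglongrightarrow> integral {0..1} f"
proof (rule LIMSEQ_I)
  fix e :: real assume "e > 0"
  \<comment> \<open>Halved because the cellwise estimate is not strict.\<close>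
  define e' where "e' = e / 2"
  have e': "e' > 0" "e' < e" using \<open>e > 0\<close> by (auto simp: e'_def)
  have "uniformly_continuous_on {0..1} f"
    using f compact_uniformly_continuous by blast
  then obtain d where d: "d > 0"
    "\<And>x y. x \<in> {0..1} \<Longrightarrow> y \<in> {0..1} \<Longrightarrow> dist x y < d \<Longrightarrow> dist (f x) (f y) < e'"
    using e' unfolding uniformly_continuous_on_def by metis
  obtain N where N: "inverse (real (Suc N)) < d" using reals_Archimedean d by blast
  have "norm ((1 / real (Suc n)) *\<^sub>R (\<Sum>k<Suc n. f (real k / real (Suc n))) - integral {0..1} f) < e"
    if n: "n \<ge> N" for n
  proof -
    define m where "m = real (Suc n)"
    have m: "m > 0" "1 / m < d"
    proof -
      show "m > 0" by (simp add: m_def)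
      have "1 / m \<le> inverse (real (Suc N))" using n by (simp add: m_def field_simps)
      then show "1 / m < d" using N by simp
    qed
    have fi: "f integrable_on {x..y}" if "0 \<le> x" "y \<le> 1" for x y
      by (rule integrable_continuous_interval, rule continuous_on_subset[OF f]) (use that in auto)
    \<comment> \<open>The errors are accumulated cell by cell, each cell contributing at most
      \<open>e' / m\<close>.\<close>
    have *: "norm ((\<Sum>j<k. (1/m) *\<^sub>R f (real j / m)) - integral {0..real k / m} f) \<le> real k / m * e'"
      if "k \<le> Suc n" for k
      using that
    proof (induction k)
      case 0 show ?case by simp
    next
      case (Suc k)
      have k1: "real (Suc k) / m \<le> 1" "real k / m \<le> real (Suc k) / m"
        using Suc.prems m by (auto simp: m_def field_simps)
      have split: "integral {0..real (Suc k) / m} f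
          = integral {0..real k / m} f + integral {real k / m..real (Suc k) / m} f"
        using Henstock_Kurzweil_Integration.integral_combine[of 0 "real k / m" "real (Suc k)/m" f] fi k1 m by auto
      have "norm (integral {real k / m..real (Suc k) / m} (\<lambda>x. f x - f (real k / m)))
          \<le> e' * (real (Suc k) / m - real k / m)"
      proof (rule integral_bound)
        show "continuous_on {real k / m..real (Suc k) / m} (\<lambda>x. f x - f (real k / m))"
          by (intro continuous_intros continuous_on_subset[OF f]) (use k1 m in auto)
        fix x assume x: "x \<in> {real k / m..real (Suc k) / m}"
        have "dist x (real k / m) < d"
        proof -
          have "x - real k / m \<le> 1 / m" using x by (simp add: add_divide_distrib)
          then show ?thesis using x m by (simp add: dist_real_def)
        qed
        moreover have "0 \<le> real k / m" using m by simp
        ultimately show "norm (f x - f (real k / m)) \<le> e'"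
          using d(2)[of x "real k / m"] x k1 by (simp add: dist_norm)
      qed (use k1 in auto)
      moreover have "integral {real k / m..real (Suc k) / m} (\<lambda>x. f x - f (real k / m))
         = integral {real k / m..real (Suc k) / m} f - (1/m) *\<^sub>R f (real k / m)"
        using k1 m fi[of "real k / m" "real (Suc k) / m"]
        by (subst Henstock_Kurzweil_Integration.integral_diff) (auto simp: field_simps diff_divide_distrib[symmetric])
      ultimately have b: "norm ((1/m) *\<^sub>R f (real k / m) - integral {real k / m..real (Suc k) / m} f) \<le> e' / m"
        by (simp add: norm_minus_commute diff_divide_distrib[symmetric])
      have "norm ((\<Sum>j<Suc k. (1/m) *\<^sub>R f (real j / m)) - integral {0..real (Suc k) / m} f)
         \<le> norm ((\<Sum>j<k. (1/m) *\<^sub>R f (real j / m)) - integral {0..real k / m} f)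
           + norm ((1/m) *\<^sub>R f (real k / m) - integral {real k / m..real (Suc k) / m} f)"
        unfolding split by (rule order_trans[OF _ norm_triangle_ineq]) (simp add: algebra_simps)
      also have "\<dots> \<le> real k / m * e' + e' / m" using Suc b by simp
      also have "\<dots> = real (Suc k) / m * e'" by (simp add: add_divide_distrib distrib_right)
      finally show ?case .
    qed
    show ?thesis using *[of "Suc n"] e' m unfolding m_def[symmetric]
      by (simp add: scaleR_sum_right m_def[symmetric] del: sum.lessThan_Suc of_nat_Suc)
  qed
  then show "\<exists>no. \<forall>n\<ge>no. norm ((1 / real (Suc n)) *\<^sub>R (\<Sum>k<Suc n. f (real k / real (Suc n))) - integral {0..1} f) < e"
    by blast
qed

text \<open>Trades moving endpoints for a moving integrand on a fixed interval, where Riemann sums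
  and continuity in parameters are available.\<close>

lemma integral_rescale_unit:
  fixes f :: "real \<Rightarrow> 'b::euclidean_space"
  assumes "continuous_on {s..t} f" "s \<le> t"
  shows "integral {s..t} f = (t - s) *\<^sub>R integral {0..1} (\<lambda>r. f (s + (t - s) * r))"
proof (cases "s = t")
  case False
  then have st: "t - s > 0" using assms by simp
  have "(f has_integral integral {s..t} f) (cbox s t)"
    using integrable_integral[OF integrable_continuous_interval[OF assms(1)]] by simp
  from has_integral_affinity'[OF this st, of s]
  have "((\<lambda>r. f (s + (t - s) * r)) has_integral (integral {s..t} f /\<^sub>R (t - s))) {0..1}"
    using st by (simp add: add.commute)
  then show ?thesis using st by (simp add: integral_unique)
qed simp

text \<open>A pointwise limit of Riemann sums; measurability is asked only at each fixed time, not
  jointly in time and \<omega>.\<close>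

lemma borel_measurable_integral_continuous:
  fixes f :: "'a \<Rightarrow> real \<Rightarrow> 'b::euclidean_space"
  assumes meas: "\<And>r. r \<in> {s..t} \<Longrightarrow> (\<lambda>\<omega>. f \<omega> r) \<in> borel_measurable N"
    and cont: "\<And>\<omega>. \<omega> \<in> space N \<Longrightarrow> continuous_on {s..t} (f \<omega>)"
  shows "(\<lambda>\<omega>. integral {s..t} (f \<omega>)) \<in> borel_measurable N"
proof (cases "s \<le> t")
  case True
  have in_st: "s + (t - s) * r \<in> {s..t}" if "r \<in> {0..1}" for r
  proof -
    have "(t - s) * r \<le> (t - s) * 1" using that True by (intro mult_left_mono) auto
    moreover have "(t - s) * r \<ge> 0" using that True by simp
    ultimately show ?thesis by simp
  qed
  have "(\<lambda>\<omega>. integral {0..1} (\<lambda>r. f \<omega> (s + (t - s) * r))) \<in> borel_measurable N"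
  proof (rule borel_measurable_LIMSEQ_metric)
    show "(\<lambda>\<omega>. (1 / real (Suc n)) *\<^sub>R (\<Sum>k<Suc n. f \<omega> (s + (t - s) * (real k / real (Suc n))))) \<in> borel_measurable N" for n
      by (intro borel_measurable_scaleR borel_measurable_const borel_measurable_sum meas in_st)
         (auto simp: field_simps)
    fix \<omega> assume "\<omega> \<in> space N"
    show "(\<lambda>n. (1 / real (Suc n)) *\<^sub>R (\<Sum>k<Suc n. f \<omega> (s + (t - s) * (real k / real (Suc n)))))
        \<longlonglongrightarrow> integral {0..1} (\<lambda>r. f \<omega> (s + (t - s) * r))"
      by (rule riemann_sums_tendsto_integral, rule continuous_on_compose2[OF cont[OF \<open>\<omega> \<in> space N\<close>]])
         (use in_st in \<open>auto intro!: continuous_intros\<close>)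
  qed
  then have "(\<lambda>\<omega>. (t - s) *\<^sub>R integral {0..1} (\<lambda>r. f \<omega> (s + (t - s) * r))) \<in> borel_measurable N"
    by (intro borel_measurable_scaleR) auto
  then show ?thesis
    using integral_rescale_unit[OF cont True] by (subst measurable_cong) auto
next
  case False then show ?thesis by simp
qed

text \<open>After rescaling, the average is a function \<open>\<Psi>\<close> of the two endpoints
  that stays continuous on the diagonal, where the quotient itself is undefined and
  \<open>\<Psi>\<close> takes the value \<open>g t0 t0\<close>.\<close>

lemma average_tendsto:
  fixes g :: "real \<Rightarrow> real \<Rightarrow> 'b::euclidean_space"
  assumes g: "continuous_on ({0..T} \<times> {0..T}) (\<lambda>(s, r). g s r)"
    and st: "\<And>k. 0 \<le> s k" "\<And>k. s k < t k" "\<And>k. t k \<le> T"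
    and lim: "s \<longlonglongrightarrow> t0" "t \<longlonglongrightarrow> t0"
  shows "(\<lambda>k. (1 / (t k - s k)) *\<^sub>R integral {s k..t k} (g (s k))) \<longlonglongrightarrow> g t0 t0"
proof -
  have t0: "t0 \<in> {0..T}"
    using LIMSEQ_le_const[OF lim(1), of 0] LIMSEQ_le_const2[OF lim(2), of T] st by auto
  have in01: "(1 - r) * x + r * y \<in> {0..T}" if "r \<in> {0..1}" "x \<in> {0..T}" "y \<in> {0..T}" for r x y :: real
    using convexD_alt[OF convex_real_interval(5)[of 0 T] that(2,3), of r] that by auto
  define \<Psi> where "\<Psi> z = integral {0..1} (\<lambda>r. g (fst z) ((1 - r) * fst z + r * snd z))" for z
  have "continuous_on ({0..T} \<times> {0..T}) (\<lambda>z. integral (cbox 0 1) (\<lambda>r. g (fst z) ((1 - r) * fst z + r * snd z)))"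
  proof (rule integral_continuous_on_param)
    have "continuous_on (({0..T} \<times> {0..T}) \<times> cbox 0 1)
       (\<lambda>z. (\<lambda>(s, r). g s r) (fst (fst z), (1 - snd z) * fst (fst z) + snd z * snd (fst z)))"
      by (rule continuous_on_compose2[OF g]) (use in01 in \<open>auto intro!: continuous_intros\<close>)
    then show "continuous_on (({0..T} \<times> {0..T}) \<times> cbox 0 1)
       (\<lambda>(z, r). g (fst z) ((1 - r) * fst z + r * snd z))" by (simp add: case_prod_unfold)
  qed
  then have \<Psi>: "continuous_on ({0..T} \<times> {0..T}) \<Psi>" by (simp add: \<Psi>_def[abs_def])
  have mem: "(s k, t k) \<in> {0..T} \<times> {0..T}" for k using st[of k] by auto
  have "(\<lambda>k. \<Psi> (s k, t k)) \<longlonglongrightarrow> \<Psi> (t0, t0)"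
    by (rule continuous_on_tendsto_compose[OF \<Psi> tendsto_Pair[OF lim]]) (use t0 mem in auto)
  moreover have "\<Psi> (s k, t k) = (1 / (t k - s k)) *\<^sub>R integral {s k..t k} (g (s k))" for k
  proof -
    have "continuous_on {s k..t k} (\<lambda>r. (\<lambda>(s, r). g s r) (s k, r))"
      by (rule continuous_on_compose2[OF g]) (use st[of k] in \<open>auto intro!: continuous_intros\<close>)
    then have "continuous_on {s k..t k} (g (s k))" by simp
    from integral_rescale_unit[OF this] st[of k]
    have "(1 / (t k - s k)) *\<^sub>R integral {s k..t k} (g (s k)) = integral {0..1} (\<lambda>r. g (s k) (s k + (t k - s k) * r))"
      by simp
    then show ?thesis by (simp add: \<Psi>_def algebra_simps)
  qed
  moreover have "\<Psi> (t0, t0) = g t0 t0" by (simp add: \<Psi>_def algebra_simps)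
  ultimately show ?thesis by simp
qed

text \<open>Taylor's formula with integral remainder along \<open>r \<mapsto> x + r * d\<close> on
  the unit interval, so that the third derivative need be bounded only on the segment. The weight
  \<open>(1 - r)^2 / 2\<close> is estimated crudely by 1.\<close>

lemma taylor_third_order_bound:
  fixes g :: "nat \<Rightarrow> real \<Rightarrow> 'b::euclidean_space"
  assumes deriv: "\<And>n x. (g n has_vector_derivative g (Suc n) x) (at x)"
    and bound: "\<And>r. 0 \<le> r \<Longrightarrow> r \<le> 1 \<Longrightarrow> norm (g 3 (x + r * d)) \<le> B"
  shows "norm (g 0 (x + d) - g 0 x - d *\<^sub>R g 1 x - (d\<^sup>2 / 2) *\<^sub>R g 2 x) \<le> B * \<bar>d\<bar> ^ 3"
proof -
  define Df where "Df n r = d ^ n *\<^sub>R g n (x + r * d)" for n r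
  have Df: "(Df n has_vector_derivative Df (Suc n) r) (at r within S)" for n r S
  proof -
    have "((\<lambda>r. x + r * d) has_vector_derivative d) (at r within S)"
      by (auto intro!: derivative_eq_intros simp: has_real_derivative_iff_has_vector_derivative[symmetric])
    from vector_diff_chain_within[OF this has_vector_derivative_at_within[OF deriv]]
    have "((g n \<circ> (\<lambda>r. x + r * d)) has_vector_derivative d *\<^sub>R g (Suc n) (x + r * d)) (at r within S)" .
    then have "((\<lambda>r. d ^ n *\<^sub>R g n (x + r * d)) has_vector_derivative d ^ n *\<^sub>R d *\<^sub>R g (Suc n) (x + r * d)) (at r within S)"
      unfolding o_def by (rule bounded_linear.has_vector_derivative[OF bounded_linear_scaleR_right])
    then show ?thesis by (simp add: Df_def[abs_def] mult.commute)
  qed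
  let ?i = "\<lambda>r. ((1 - r) ^ (3 - 1) / fact (3 - 1)) *\<^sub>R Df 3 r"
  have T: "Df 0 1 = (\<Sum>i<3. ((1 - 0) ^ i / fact i) *\<^sub>R Df i 0) + integral {0..1} ?i"
    by (rule Taylor_integral[where Df = Df and a = 0 and b = 1 and p = 3]) (use Df in auto)
  have ii: "?i integrable_on {0..1}"
    by (rule Taylor_integrable[where Df = Df and a = 0 and b = 1 and p = 3]) (use Df in auto)
  have "norm (integral {0..1} ?i) \<le> integral {0..1} (\<lambda>_::real. B * \<bar>d\<bar> ^ 3)"
  proof (rule integral_norm_bound_integral[OF ii])
    fix r :: real assume r: "r \<in> {0..1}"
    have B: "norm (g 3 (x + r * d)) \<le> B" using bound r by auto
    have "norm (?i r) = ((1 - r)\<^sup>2 / 2) * (\<bar>d\<bar> ^ 3 * norm (g 3 (x + r * d)))"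
      by (simp add: Df_def abs_mult power_abs)
    also have "\<dots> \<le> 1 * (\<bar>d\<bar> ^ 3 * B)"
    proof (intro mult_mono)
      have "(1 - r)\<^sup>2 \<le> 1" using r by (intro power_le_one) auto
      then show "(1 - r)\<^sup>2 / 2 \<le> 1" by simp
    qed (use B norm_ge_zero[of "g 3 (x + r * d)"] order_trans in auto)
    finally show "norm (?i r) \<le> B * \<bar>d\<bar> ^ 3" by (simp add: mult.commute)
  qed auto
  moreover have "integral {0..1} ?i = g 0 (x + d) - g 0 x - d *\<^sub>R g 1 x - (d\<^sup>2 / 2) *\<^sub>R g 2 x"
    using T by (simp add: Df_def numeral_3_eq_3 numeral_2_eq_2 algebra_simps)
  ultimately show ?thesis by simp
qed

text \<open>For a driving path \<open>w\<close>, every solution of \<open>dx = (a + b x) dr + c dw\<close> has the same increments of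
  \<open>exp (- b r) * x r\<close>, namely those of \<open>ou_primitive a b c w\<close>.\<close>

definition ou_primitive :: "real \<Rightarrow> real \<Rightarrow> real \<Rightarrow> (real \<Rightarrow> real) \<Rightarrow> real \<Rightarrow> real" where
  "ou_primitive a b c w r = exp (- b * r) * c * w r + integral {0..r} (\<lambda>u. exp (- b * u) * (a + b * c * w u))"

text \<open>Subtracting \<open>c * w\<close> leaves a differentiable function \<open>g\<close> with
  \<open>g' = b * g + (a + b * c * w)\<close>, although \<open>w\<close> need not be differentiable;
  the integrating factor \<open>exp (- b * r)\<close> then solves the equation. In particular
  solutions are unique.\<close>

lemma ou_solution_explicit:
  fixes x w :: "real \<Rightarrow> real"
  assumes x: "continuous_on {t..T} x" and w: "continuous_on {0..T} w" and t: "0 \<le> t"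
    and sol: "\<And>s. s \<in> {t..T} \<Longrightarrow> x s = y + integral {t..s} (\<lambda>r. a + b * x r) + c * (w s - w t)"
    and s: "s \<in> {t..T}"
  shows "x s = exp (b * (s - t)) * y + exp (b * s) * (ou_primitive a b c w s - ou_primitive a b c w t)"
proof -
  define g where "g r = x r - c * w r" for r
  have xt: "x t = y" using sol[of t] s by simp
  have wt: "continuous_on {t..T} w" by (rule continuous_on_subset[OF w]) (use t in auto)
  have gd: "(g has_real_derivative (a + b * x r)) (at r within {t..s})" if r: "r \<in> {t..s}" for r
  proof -
    have "((\<lambda>r. integral {t..r} (\<lambda>r. a + b * x r)) has_real_derivative (a + b * x r)) (at r within {t..s})"
      by (rule integral_has_real_derivative)
         (use r s in \<open>auto intro!: continuous_intros continuous_on_subset[OF x]\<close>)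
    then have "((\<lambda>r. y + integral {t..r} (\<lambda>r. a + b * x r) - c * w t) has_real_derivative (a + b * x r)) (at r within {t..s})"
      by (auto intro!: derivative_eq_intros)
    then show ?thesis unfolding has_real_derivative_iff_has_vector_derivative
    proof (rule has_vector_derivative_transform[rotated 2])
      fix z assume "z \<in> {t..s}"
      then show "g z = y + integral {t..z} (\<lambda>r. a + b * x r) - c * w t"
        using sol[of z] s by (simp add: g_def algebra_simps)
    qed (use r in auto)
  qed
  have "((\<lambda>r. exp (- b * r) * (a + b * c * w r)) has_integral exp (- b * s) * g s - exp (- b * t) * g t) {t..s}"
  proof (rule fundamental_theorem_of_calculus)
    fix r assume r: "r \<in> {t..s}"
    have "((\<lambda>r. exp (- b * r) * g r) has_real_derivative
       (exp (- b * r) * (- b) * g r + (a + b * x r) * exp (- b * r))) (at r within {t..s})"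
      by (auto intro!: derivative_eq_intros gd[OF r])
    moreover have "exp (- b * r) * (- b) * g r + (a + b * x r) * exp (- b * r) = exp (- b * r) * (a + b * c * w r)"
      by (simp add: g_def algebra_simps)
    ultimately show "((\<lambda>r. exp (- b * r) * g r) has_vector_derivative exp (- b * r) * (a + b * c * w r)) (at r within {t..s})"
      by (simp add: has_real_derivative_iff_has_vector_derivative)
  qed (use s in auto)
  then have I: "integral {t..s} (\<lambda>r. exp (- b * r) * (a + b * c * w r)) = exp (- b * s) * g s - exp (- b * t) * g t"
    by (rule integral_unique)
  have "integral {0..s} (\<lambda>r. exp (- b * r) * (a + b * c * w r))
     = integral {0..t} (\<lambda>r. exp (- b * r) * (a + b * c * w r)) + integral {t..s} (\<lambda>r. exp (- b * r) * (a + b * c * w r))"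
    by (rule Henstock_Kurzweil_Integration.integral_combine[symmetric])
       (use s t in \<open>auto intro!: integrable_continuous_interval continuous_intros continuous_on_subset[OF w]\<close>)
  with I have "ou_primitive a b c w s - ou_primitive a b c w t = exp (- b * s) * x s - exp (- b * t) * y"
    by (simp add: ou_primitive_def g_def xt algebra_simps)
  then have "exp (b * s) * (ou_primitive a b c w s - ou_primitive a b c w t)
     = (exp (b * s) * exp (- b * s)) * x s - exp (b * s) * exp (- b * t) * y"
    by (simp only: right_diff_distrib mult.assoc)
  moreover have "exp (b * s) * exp (- b * s) = 1" by (simp add: exp_minus)
  moreover have "exp (b * s) * exp (- b * t) = exp (b * (s - t))" by (simp add: exp_add[symmetric] algebra_simps)
  ultimately show ?thesis by simp
qed

lemma continuous_on_ou_primitive: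
  assumes "continuous_on {0..T} w"
  shows "continuous_on {0..T} (ou_primitive a b c w)"
  unfolding ou_primitive_def[abs_def]
  by (intro continuous_intros assms indefinite_integral_continuous_1 integrable_continuous_interval)

text \<open>Replacing \<open>w u\<close> by \<open>w u - w s\<close> under the integral is paid for
  by the exact integral of \<open>b * exp (- b * u)\<close>. In this form only increments of
  \<open>w\<close> after time \<open>s\<close> occur, which is what measurability with respect to
  the future requires.\<close>

lemma ou_primitive_diff:
  assumes w: "continuous_on {0..T} w" and st: "0 \<le> s" "s \<le> t" "t \<le> T"
  shows "ou_primitive a b c w t - ou_primitive a b c w s
    = exp (- b * t) * c * (w t - w s) + integral {s..t} (\<lambda>u. exp (- b * u) * (a + b * c * (w u - w s)))"
proof -
  have split: "integral {0..t} (\<lambda>r. exp (- b * r) * (a + b * c * w r))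
     = integral {0..s} (\<lambda>r. exp (- b * r) * (a + b * c * w r)) + integral {s..t} (\<lambda>r. exp (- b * r) * (a + b * c * w r))"
    by (rule Henstock_Kurzweil_Integration.integral_combine[symmetric])
       (use st in \<open>auto intro!: integrable_continuous_interval continuous_intros continuous_on_subset[OF w]\<close>)
  have "((\<lambda>u. c * w s * (b * exp (- b * u))) has_integral
       c * w s * - exp (- b * t) - c * w s * - exp (- b * s)) {s..t}"
    by (rule fundamental_theorem_of_calculus)
       (use st in \<open>auto intro!: derivative_eq_intros simp: has_real_derivative_iff_has_vector_derivative[symmetric]\<close>)
  then have e: "integral {s..t} (\<lambda>u. c * w s * (b * exp (- b * u))) = c * w s * (exp (- b * s) - exp (- b * t))"
    by (subst integral_unique, assumption) (simp add: right_diff_distrib)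
  have "integral {s..t} (\<lambda>u. exp (- b * u) * (a + b * c * (w u - w s)))
    = integral {s..t} (\<lambda>u. exp (- b * u) * (a + b * c * w u) - c * w s * (b * exp (- b * u)))"
    by (rule integral_cong) (simp add: algebra_simps)
  also have "\<dots> = integral {s..t} (\<lambda>u. exp (- b * u) * (a + b * c * w u)) - integral {s..t} (\<lambda>u. c * w s * (b * exp (- b * u)))"
    by (rule Henstock_Kurzweil_Integration.integral_diff)
       (use st in \<open>auto intro!: integrable_continuous_interval continuous_intros continuous_on_subset[OF w]\<close>)
  finally show ?thesis unfolding ou_primitive_def split e by (simp add: algebra_simps)
qed

section \<open>Power series negligible to double factorial\<close>

text \<open>Up to geometric factors \<open>(k - 1)!!\<close> is the square root of \<open>k!\<close>.\<close>

definition tame :: "(nat \<Rightarrow> real) \<Rightarrow> bool" where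
  "tame p \<longleftrightarrow> (\<forall>d>0. \<exists>C\<ge>0. \<forall>k. (p k)\<^sup>2 * fact k \<le> C * d ^ k)"

lemma dfact_mono: "dfact n \<le> dfact (Suc n)"
proof (induction n rule: dfact.induct)
  case (3 n)
  then have "Suc (Suc n) * dfact n \<le> Suc (Suc (Suc n)) * dfact (Suc n)" by (intro mult_le_mono) auto
  then show ?case by (simp only: dfact.simps)
qed auto

lemma fact_eq_dfact: "fact (Suc k) = dfact (Suc k) * dfact k"
  by (induction k) (auto simp: algebra_simps)

text \<open>Here \<open>k! = k!! * (k - 1)!!\<close>, and for \<open>k \<ge> 2\<close> one has
  \<open>k!! = k * (k - 2)!! \<le> k * (k - 1)!!\<close>.\<close>

lemma fact_le_dfact_pred: "fact k \<le> Suc k * (dfact_pred k)\<^sup>2"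
proof (cases k)
  case 0 then show ?thesis by (simp add: dfact_pred_def)
next
  case (Suc n)
  have "dfact (Suc n) \<le> Suc (Suc n) * dfact n"
  proof (cases n)
    case (Suc m)
    have "dfact (Suc n) = Suc n * dfact m" using Suc by simp
    also have "\<dots> \<le> Suc n * dfact n" using dfact_mono[of m] Suc by (intro mult_le_mono) auto
    finally show ?thesis by simp
  qed simp
  then have "dfact (Suc n) * dfact n \<le> Suc (Suc n) * dfact n * dfact n" by (rule mult_le_mono1)
  then show ?thesis using Suc fact_eq_dfact[of n] by (simp add: dfact_pred_def power2_eq_square ac_simps)
qed

lemma Suc_le_power_two: "real (Suc k) \<le> 2 ^ k"
  by (induction k) auto

lemma tame_if_negligible_dfact:
  assumes "negligible_dfact p"
  shows "tame p"
  unfolding tame_def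
proof (intro allI impI)
  fix d :: real assume d: "d > 0"
  \<comment> \<open>Squared below; the spare factor 2 absorbs
    \<open>Suc k \<le> 2 ^ k\<close>.\<close>
  define e where "e = sqrt (d / 2)"
  have e: "e > 0" "e\<^sup>2 = d / 2" using d by (auto simp: e_def)
  have "limsup (\<lambda>k. ereal (root k (\<bar>p k\<bar> * real (dfact_pred k)))) < ereal e"
    using assms e unfolding negligible_dfact_def by simp
  then have "eventually (\<lambda>k. ereal (root k (\<bar>p k\<bar> * real (dfact_pred k))) < ereal e) sequentially"
    by (rule Limsup_lessD)
  \<comment> \<open>The index 0 is excluded because \<open>root 0\<close> is constantly 0 and cannot
    be undone by a power.\<close>
  then have ev: "eventually (\<lambda>k. \<bar>p k\<bar> * real (dfact_pred k) \<le> e ^ k) sequentially"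
    using eventually_gt_at_top[of 0]
  proof eventually_elim
    case (elim k)
    let ?z = "\<bar>p k\<bar> * real (dfact_pred k)"
    have "?z = root k ?z ^ k" using elim by (subst real_root_pow_pos2) auto
    also have "\<dots> \<le> e ^ k" using elim by (intro power_mono) (auto intro: real_root_ge_zero)
    finally show ?case .
  qed
  then obtain N where N: "\<And>k. k \<ge> N \<Longrightarrow> \<bar>p k\<bar> * real (dfact_pred k) \<le> e ^ k"
    unfolding eventually_sequentially by blast
  \<comment> \<open>The sum covers the finitely many indices below \<open>N\<close>, the 1 covers
    the tail.\<close>
  define C where "C = 1 + (\<Sum>k<N. (p k)\<^sup>2 * fact k / d ^ k)"
  have nonneg: "(\<Sum>k<N. (p k)\<^sup>2 * fact k / d ^ k) \<ge> 0" using d by (intro sum_nonneg) auto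
  have "(p k)\<^sup>2 * fact k \<le> C * d ^ k" for k
  proof (cases "k < N")
    case True
    have "(p k)\<^sup>2 * fact k / d ^ k \<le> (\<Sum>k<N. (p k)\<^sup>2 * fact k / d ^ k)"
      using True d by (intro member_le_sum) auto
    also have "\<dots> \<le> C" by (simp add: C_def)
    finally show ?thesis using d by (simp add: field_simps)
  next
    case False
    have "real (fact k) \<le> real (Suc k * (dfact_pred k)\<^sup>2)" using fact_le_dfact_pred of_nat_le_iff by blast
    then have "fact k \<le> real (Suc k) * (real (dfact_pred k))\<^sup>2"
      by (simp only: of_nat_fact of_nat_mult of_nat_power)
    also have "\<dots> \<le> 2 ^ k * (real (dfact_pred k))\<^sup>2"
      using Suc_le_power_two by (intro mult_right_mono) auto
    finally have "(p k)\<^sup>2 * fact k \<le> (p k)\<^sup>2 * (2 ^ k * (real (dfact_pred k))\<^sup>2)"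
      by (rule mult_left_mono) auto
    also have "\<dots> = 2 ^ k * (\<bar>p k\<bar> * real (dfact_pred k))\<^sup>2" by (simp add: power_mult_distrib)
    also have "\<dots> \<le> 2 ^ k * (e ^ k)\<^sup>2"
      using N[of k] False by (intro mult_left_mono power_mono) auto
    also have "(e ^ k)\<^sup>2 = (d / 2) ^ k" by (metis e(2) power_commutes power_mult mult.commute)
    also have "2 ^ k * (d / 2) ^ k = d ^ k" by (simp add: power_divide)
    also have "\<dots> \<le> C * d ^ k" using nonneg d mult_right_mono[of 1 C "d ^ k"] by (auto simp: C_def)
    finally show ?thesis .
  qed
  then show "\<exists>C\<ge>0. \<forall>k. (p k)\<^sup>2 * fact k \<le> C * d ^ k" using nonneg by (intro exI[of _ C]) (auto simp: C_def)
qed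

text \<open>Since \<open>(k + 1)^2 * k! = (k + 1) * (k + 1)!\<close>, differentiation costs a factor
  \<open>k + 1\<close>, absorbed by \<open>2 ^ (k + 1)\<close> when tameness is applied at
  \<open>d / 2\<close>.\<close>

lemma tame_diffs:
  assumes "tame p" shows "tame (diffs p)"
  unfolding tame_def
proof (intro allI impI)
  fix d :: real assume d: "d > 0"
  then obtain C where C: "C \<ge> 0" "\<And>k. (p k)\<^sup>2 * fact k \<le> C * (d / 2) ^ k"
    using assms unfolding tame_def by (metis half_gt_zero)
  have "(diffs p k)\<^sup>2 * fact k \<le> (C * d) * d ^ k" for k
  proof -
    have "(diffs p k)\<^sup>2 * fact k = real (Suc k) * ((p (Suc k))\<^sup>2 * fact (Suc k))"
      by (simp add: diffs_def power2_eq_square algebra_simps)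
    also have "\<dots> \<le> 2 ^ Suc k * (C * (d / 2) ^ Suc k)"
      using C(2)[of "Suc k"] order_trans[OF Suc_le_power_two[of k] power_increasing[of k "Suc k" 2]]
      by (intro mult_mono[of "real (Suc k)"]) auto
    also have "\<dots> = C * d * d ^ k" by (simp add: power_divide)
    finally show ?thesis .
  qed
  then show "\<exists>C\<ge>0. \<forall>k. (diffs p k)\<^sup>2 * fact k \<le> C * d ^ k" using C d by (intro exI[of _ "C * d"]) auto
qed

text \<open>Cauchy-Schwarz costs a factor \<open>k + 1 \<le> 2 ^ k\<close>; splitting
  \<open>k!\<close> into \<open>j! * (k - j)!\<close> costs binomial coefficients, which sum to
  \<open>2 ^ k\<close>. Together this is \<open>4 ^ k\<close>, hence the rate
  \<open>d / 4\<close>.\<close>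

lemma tame_cauchy_prod:
  assumes p: "tame p" and q: "tame q" shows "tame (cauchy_prod p q)"
  unfolding tame_def
proof (intro allI impI)
  fix d :: real assume d: "d > 0"
  then have "d / 4 > 0" by simp
  then obtain C D where C: "C \<ge> 0" "\<And>k. (p k)\<^sup>2 * fact k \<le> C * (d / 4) ^ k"
    and D: "D \<ge> 0" "\<And>k. (q k)\<^sup>2 * fact k \<le> D * (d / 4) ^ k"
    using p q unfolding tame_def by metis
  have "(cauchy_prod p q k)\<^sup>2 * fact k \<le> (C * D) * d ^ k" for k
  proof -
    have "(cauchy_prod p q k)\<^sup>2 \<le> real (Suc k) * (\<Sum>j\<le>k. (p j * q (k - j))\<^sup>2)"
      using Cauchy_Schwarz_ineq_sum[of "\<lambda>_. 1" "\<lambda>j. p j * q (k - j)" "{..k}"] by (simp add: cauchy_prod_def)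
    then have "(cauchy_prod p q k)\<^sup>2 * fact k \<le> real (Suc k) * (\<Sum>j\<le>k. (p j * q (k - j))\<^sup>2) * fact k"
      by (rule mult_right_mono) simp
    also have "\<dots> = real (Suc k) * (\<Sum>j\<le>k. real (k choose j) * (((p j)\<^sup>2 * fact j) * ((q (k - j))\<^sup>2 * fact (k - j))))"
    proof -
      have "(p j * q (k - j))\<^sup>2 * fact k
          = real (k choose j) * (((p j)\<^sup>2 * fact j) * ((q (k - j))\<^sup>2 * fact (k - j)))" if "j \<le> k" for j
        using that by (simp add: binomial_fact power_mult_distrib)
      then show ?thesis by (simp add: mult.assoc sum_distrib_right)
    qed
    also have "\<dots> \<le> real (Suc k) * (\<Sum>j\<le>k. real (k choose j) * ((C * (d / 4) ^ j) * (D * (d / 4) ^ (k - j))))"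
      by (intro mult_left_mono sum_mono mult_mono C D) (use C D d in auto)
    also have "\<dots> = real (Suc k) * (\<Sum>j\<le>k. real (k choose j) * (C * D * (d / 4) ^ k))"
    proof -
      have "(C * (d / 4) ^ j) * (D * (d / 4) ^ (k - j)) = C * D * (d / 4) ^ k" if "j \<le> k" for j
        using power_add[of "d / 4" j "k - j"] that by (simp add: ac_simps)
      then have "(\<Sum>j\<le>k. real (k choose j) * ((C * (d / 4) ^ j) * (D * (d / 4) ^ (k - j))))
          = (\<Sum>j\<le>k. real (k choose j) * (C * D * (d / 4) ^ k))"
        by (intro sum.cong) (auto simp only: atMost_iff)
      then show ?thesis by (simp only:)
    qed
    also have "\<dots> = real (Suc k) * (2 ^ k * (C * D * (d / 4) ^ k))"
      using choose_row_sum[of k] by (simp add: sum_distrib_right[symmetric] flip: of_nat_sum)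
    also have "\<dots> \<le> 2 ^ k * (2 ^ k * (C * D * (d / 4) ^ k))"
      using C D d Suc_le_power_two by (intro mult_right_mono) auto
    also have "\<dots> = C * D * d ^ k"
      using power_mult_distrib[of "2::real" 2 k] by (simp add: power_divide)
    finally show ?thesis .
  qed
  then show "\<exists>C\<ge>0. \<forall>k. (cauchy_prod p q k)\<^sup>2 * fact k \<le> C * d ^ k"
    using C D by (intro exI[of _ "C * D"]) auto
qed

text \<open>Each term splits in two: the coefficients, tame at rate \<open>e / 2\<close>, leave a
  geometric series of ratio 1/2, and the powers of \<open>x\<close> leave the exponential series of
  \<open>e * x\<^sup>2\<close>.\<close>

lemma tame_summable_bound:
  assumes p: "tame p" and e: "e > 0"
  shows "\<exists>C\<ge>0. \<forall>x. summable (\<lambda>k. \<bar>p k * x ^ k\<bar>) \<and> (\<Sum>k. \<bar>p k * x ^ k\<bar>) \<le> C * exp (e * x\<^sup>2)"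
proof -
  obtain C where C: "C \<ge> 0" "\<And>k. (p k)\<^sup>2 * fact k \<le> C * (e / 2) ^ k"
    using p e unfolding tame_def by (metis half_gt_zero)
  have term_le: "\<bar>p k * x ^ k\<bar> \<le> C * (1/2) ^ k + (e * x\<^sup>2) ^ k / fact k" for k and x :: real
  proof -
    \<comment> \<open>AM-GM with the weight \<open>fact k / e ^ k\<close>\<close>
    define s where "s = sqrt (fact k / e ^ k)"
    have s: "s > 0" "s\<^sup>2 = fact k / e ^ k" using e by (auto simp: s_def)
    have "2 * ((\<bar>p k\<bar> * s) * (\<bar>x\<bar> ^ k / s)) \<le> (\<bar>p k\<bar> * s)\<^sup>2 + (\<bar>x\<bar> ^ k / s)\<^sup>2"
      using sum_squares_bound[of "\<bar>p k\<bar> * s" "\<bar>x\<bar> ^ k / s"] by (simp only: mult.assoc)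
    moreover have "(\<bar>p k\<bar> * s) * (\<bar>x\<bar> ^ k / s) = \<bar>p k * x ^ k\<bar>"
      using s by (simp add: abs_mult power_abs)
    moreover have "(\<bar>p k\<bar> * s)\<^sup>2 \<le> C * (1/2) ^ k"
    proof -
      have "(\<bar>p k\<bar> * s)\<^sup>2 = ((p k)\<^sup>2 * fact k) / e ^ k" by (simp add: power_mult_distrib s)
      also have "\<dots> \<le> (C * (e / 2) ^ k) / e ^ k" using e C by (intro divide_right_mono) auto
      also have "\<dots> = C * (1/2) ^ k" using e by (simp add: power_divide)
      finally show ?thesis .
    qed
    moreover have "(\<bar>x\<bar> ^ k / s)\<^sup>2 = (e * x\<^sup>2) ^ k / fact k"
      by (simp add: power_divide s power_mult_distrib power_mult[symmetric] power_even_abs mult.commute)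
    moreover have "0 \<le> C * (1/2) ^ k" "0 \<le> (e * x\<^sup>2) ^ k / fact k" using C e by auto
    ultimately show ?thesis by linarith
  qed
  have sums: "(\<lambda>k. C * (1/2) ^ k + (e * x\<^sup>2) ^ k / fact k) sums (2 * C + exp (e * x\<^sup>2))" for x :: real
  proof -
    have "(\<lambda>k. C * (1/2) ^ k) sums (C * (1 / (1 - 1/2)))" by (intro sums_mult geometric_sums) auto
    moreover have "(\<lambda>k. (e * x\<^sup>2) ^ k / fact k) sums exp (e * x\<^sup>2)"
      using exp_converges[of "e * x\<^sup>2"] by (simp add: field_simps)
    ultimately have "(\<lambda>k. C * (1/2) ^ k + (e * x\<^sup>2) ^ k / fact k) sums (C * (1 / (1 - 1/2)) + exp (e * x\<^sup>2))"
      by (rule sums_add)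
    then show ?thesis by (simp add: mult.commute)
  qed
  have "summable (\<lambda>k. \<bar>p k * x ^ k\<bar>) \<and> (\<Sum>k. \<bar>p k * x ^ k\<bar>) \<le> (2 * C + 1) * exp (e * x\<^sup>2)" for x
  proof
    show sm: "summable (\<lambda>k. \<bar>p k * x ^ k\<bar>)"
      by (rule summable_comparison_test'[OF sums_summable[OF sums[of x]], of 0]) (use term_le in auto)
    have "(\<Sum>k. \<bar>p k * x ^ k\<bar>) \<le> (\<Sum>k. C * (1/2) ^ k + (e * x\<^sup>2) ^ k / fact k)"
      by (intro suminf_le term_le sm sums_summable[OF sums])
    also have "\<dots> = 2 * C + exp (e * x\<^sup>2)" by (rule sums_unique[OF sums, symmetric])
    also have "\<dots> \<le> (2 * C + 1) * exp (e * x\<^sup>2)"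
      using C e mult_left_mono[of 1 "exp (e * x\<^sup>2)" "2 * C"] by (simp add: algebra_simps)
    finally show "(\<Sum>k. \<bar>p k * x ^ k\<bar>) \<le> (2 * C + 1) * exp (e * x\<^sup>2)" .
  qed
  then show ?thesis using C by (intro exI[of _ "2 * C + 1"]) auto
qed

lemma tame_powser_growth:
  assumes "tame p" "e > 0"
  shows "\<exists>C\<ge>0. \<forall>x. \<bar>powser p x\<bar> \<le> C * exp (e * x\<^sup>2)"
proof -
  obtain C where C: "C \<ge> 0" "\<And>x. summable (\<lambda>k. \<bar>p k * x ^ k\<bar>)" "\<And>x. (\<Sum>k. \<bar>p k * x ^ k\<bar>) \<le> C * exp (e * x\<^sup>2)"
    using tame_summable_bound[OF assms] by blast
  have "\<bar>powser p x\<bar> \<le> C * exp (e * x\<^sup>2)" for x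
    using summable_rabs[OF C(2)[of x]] C(3)[of x] unfolding powser_def by linarith
  then show ?thesis using C by blast
qed

lemma powser_has_derivative:
  assumes "tame p"
  shows "(powser p has_real_derivative powser (diffs p) x) (at x)"
proof -
  have "summable (\<lambda>k. p k * y ^ k)" for y
    using tame_summable_bound[OF assms, of 1] summable_rabs_cancel by fastforce
  from termdiffs_strong_converges_everywhere[OF this, of x]
  show ?thesis by (simp add: powser_def[abs_def])
qed

text \<open>With equal factors this exhibits \<open>p1\<close> as a square of real values, which
  gives the sign of the exponent.\<close>

lemma powser_cauchy_prod:
  assumes "tame p" "tame q"
  shows "powser (cauchy_prod p q) x = powser p x * powser q x"
proof -
  have "summable (\<lambda>k. norm (p k * x ^ k))" "summable (\<lambda>k. norm (q k * x ^ k))"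
    using tame_summable_bound[OF assms(1), of 1] tame_summable_bound[OF assms(2), of 1] by auto
  from Cauchy_product[OF this]
  have "powser p x * powser q x = (\<Sum>k. \<Sum>i\<le>k. p i * x ^ i * (q (k - i) * x ^ (k - i)))"
    by (simp add: powser_def)
  also have "\<dots> = (\<Sum>k. cauchy_prod p q k * x ^ k)"
  proof (intro suminf_cong)
    fix k
    show "(\<Sum>i\<le>k. p i * x ^ i * (q (k - i) * x ^ (k - i))) = cauchy_prod p q k * x ^ k"
      unfolding cauchy_prod_def sum_distrib_right
    proof (rule sum.cong)
      fix i assume "i \<in> {..k}"
      then have "x ^ i * x ^ (k - i) = x ^ k" by (simp flip: power_add)
      then show "p i * x ^ i * (q (k - i) * x ^ (k - i)) = p i * q (k - i) * x ^ k"
        by (simp add: algebra_simps)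
    qed simp
  qed
  finally show ?thesis by (simp add: powser_def)
qed

lemma tame_diffs_power: "tame p \<Longrightarrow> tame ((diffs ^^ n) p)"
  by (induction n) (auto intro: tame_diffs)

section \<open>Brownian increments\<close>

locale brownian =
  fixes M :: "'a measure" and W :: "real \<Rightarrow> 'a \<Rightarrow> real"
  assumes bm: "brownian_motion M W"

sublocale brownian \<subseteq> prob_space M
  using bm unfolding brownian_motion_def by simp

context brownian
begin

lemma W_measurable [measurable]: "W t \<in> borel_measurable M"
  using bm unfolding brownian_motion_def by simp

lemma W_zero: "\<omega> \<in> space M \<Longrightarrow> W 0 \<omega> = 0"
  using bm unfolding brownian_motion_def by simp

lemma W_continuous: "\<omega> \<in> space M \<Longrightarrow> continuous_on {0..T} (\<lambda>t. W t \<omega>)"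
  using bm continuous_on_subset[of "{0..}" _ "{0..T}"] unfolding brownian_motion_def by force

section \<open>Independence of an increment from the rest of the path\<close>

text \<open>After time \<open>t\<close> the increment from \<open>t\<close> is recorded instead of
  the value, because \<open>W r\<close> contains the increment over \<open>[s, t]\<close>.\<close>

definition outside :: "real \<Rightarrow> real \<Rightarrow> real \<Rightarrow> 'a \<Rightarrow> real" where
  "outside s t r \<omega> = (if r \<le> s then W r \<omega> else W r \<omega> - W t \<omega>)"

text \<open>Finite-dimensional cylinders: a generator closed under intersection, on which
  independence follows from finitely many grid increments.\<close>

definition outside_events :: "real \<Rightarrow> real \<Rightarrow> 'a set set" where
  "outside_events s t = {{\<omega>\<in>space M. \<forall>r\<in>J. outside s t r \<omega> \<in> A r} | J A.
     finite J \<and> J \<subseteq> {0..s} \<union> {t..} \<and> (\<forall>r. A r \<in> sets borel)}"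

text \<open>Past and future are put into one \<sigma>-algebra so that a single independence
  statement serves both the martingale transform and the Taylor coefficients.\<close>

definition outside_algebra :: "real \<Rightarrow> real \<Rightarrow> 'a measure" where
  "outside_algebra s t = sigma (space M) (outside_events s t)"

lemma outside_measurable_M [measurable]: "outside s t r \<in> borel_measurable M"
  unfolding outside_def by measurable

lemma outside_events_subset: "outside_events s t \<subseteq> events"
  unfolding outside_events_def
proof safe
  fix J :: "real set" and A :: "real \<Rightarrow> real set"
  assume J: "finite J" and A: "\<forall>r. A r \<in> sets borel"
  show "{\<omega> \<in> space M. \<forall>r\<in>J. outside s t r \<omega> \<in> A r} \<in> events"
  proof (rule sets.sets_Collect_finite_All[OF _ J])
    fix r
    have [measurable]: "A r \<in> sets borel" using A by simp
    show "{\<omega> \<in> space M. outside s t r \<omega> \<in> A r} \<in> events" by measurable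
  qed
qed

lemma space_outside_algebra [simp]: "space (outside_algebra s t) = space M"
  unfolding outside_algebra_def by (simp add: space_measure_of_conv)

lemma sets_outside_algebra: "sets (outside_algebra s t) = sigma_sets (space M) (outside_events s t)"
  unfolding outside_algebra_def
  by (rule sets_measure_of) (auto simp: outside_events_def)

lemma outside_algebra_measurable:
  assumes "r \<in> {0..s} \<union> {t..}"
  shows "outside s t r \<in> borel_measurable (outside_algebra s t)"
proof (rule measurableI)
  fix B :: "real set" assume "B \<in> sets borel"
  then have "{\<omega>\<in>space M. \<forall>r'\<in>{r}. outside s t r' \<omega> \<in> (\<lambda>_. B) r'} \<in> outside_events s t"
    unfolding outside_events_def using assms
    by (intro CollectI exI[of _ "{r}"] exI[of _ "\<lambda>_. B"]) simp
  moreover have "{\<omega>\<in>space M. \<forall>r'\<in>{r}. outside s t r' \<omega> \<in> (\<lambda>_. B) r'} = outside s t r -` B \<inter> space (outside_algebra s t)"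
    by auto
  ultimately show "outside s t r -` B \<inter> space (outside_algebra s t) \<in> sets (outside_algebra s t)"
    unfolding sets_outside_algebra by auto
qed auto

lemma outside_algebra_subalgebra:
  assumes "f \<in> borel_measurable (outside_algebra s t)" shows "f \<in> borel_measurable M"
proof (rule measurable_from_subalg[OF _ assms])
  have "sets (outside_algebra s t) \<subseteq> events"
    unfolding sets_outside_algebra by (rule sets.sigma_sets_subset[OF outside_events_subset])
  then show "subalgebra M (outside_algebra s t)" unfolding subalgebra_def by simp
qed

lemma past_measurable:
  assumes "0 \<le> r" "r \<le> s" shows "W r \<in> borel_measurable (outside_algebra s t)"
proof -
  have "outside s t r = W r" using assms by (simp add: fun_eq_iff outside_def)
  then show ?thesis using outside_algebra_measurable[of r s t] assms by auto
qed

lemma future_measurable: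
  assumes "s < t" "t \<le> r" shows "(\<lambda>\<omega>. W r \<omega> - W t \<omega>) \<in> borel_measurable (outside_algebra s t)"
proof -
  have "outside s t r = (\<lambda>\<omega>. W r \<omega> - W t \<omega>)" using assms by (simp add: fun_eq_iff outside_def)
  then show ?thesis using outside_algebra_measurable[of r s t] assms by auto
qed

lemma Int_stable_outside_events: "Int_stable (outside_events s t)"
proof (rule Int_stableI)
  fix E E' assume *: "E \<in> outside_events s t" "E' \<in> outside_events s t"
  obtain J A where J: "finite J" "J \<subseteq> {0..s} \<union> {t..}" "\<forall>r. A r \<in> sets borel"
    and E: "E = {\<omega>\<in>space M. \<forall>r\<in>J. outside s t r \<omega> \<in> A r}"
    using *(1) unfolding outside_events_def mem_Collect_eq by (elim exE conjE) (rule that)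
  obtain J' A' where J': "finite J'" "J' \<subseteq> {0..s} \<union> {t..}" "\<forall>r. A' r \<in> sets borel"
    and E': "E' = {\<omega>\<in>space M. \<forall>r\<in>J'. outside s t r \<omega> \<in> A' r}"
    using *(2) unfolding outside_events_def mem_Collect_eq by (elim exE conjE) (rule that)
  \<comment> \<open>An index present in only one of the two cylinders is left unconstrained by the
    other.\<close>
  define B where "B r = (if r \<in> J then A r else UNIV) \<inter> (if r \<in> J' then A' r else UNIV)" for r
  have "E \<inter> E' = {\<omega>\<in>space M. \<forall>r\<in>J \<union> J'. outside s t r \<omega> \<in> B r}"
  proof -
    have "(\<forall>r\<in>J \<union> J'. outside s t r \<omega> \<in> B r) \<longleftrightarrow>
        (\<forall>r\<in>J. outside s t r \<omega> \<in> A r) \<and> (\<forall>r\<in>J'. outside s t r \<omega> \<in> A' r)" for \<omega>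
      by (auto simp: B_def)
    then show ?thesis unfolding E E' by blast
  qed
  moreover have "\<forall>r. B r \<in> sets borel" using J(3) J'(3) by (simp add: B_def)
  moreover have "finite (J \<union> J')" "J \<union> J' \<subseteq> {0..s} \<union> {t..}" using J J' by auto
  ultimately show "E \<inter> E' \<in> outside_events s t"
    unfolding outside_events_def by (intro CollectI exI conjI)
qed

text \<open>The times of the cylinder together with \<open>0\<close>, \<open>s\<close> and
  \<open>t\<close> form a grid in which \<open>s\<close> and \<open>t\<close> are neighbours. The
  increment over \<open>[s, t]\<close> is then one grid increment, and every recorded value is a sum
  of others.\<close>

lemma increment_indep_outside_event:
  assumes st: "0 \<le> s" "s < t" and E: "E \<in> outside_events s t" and B: "B \<in> sets borel"
  shows "prob (((\<lambda>\<omega>. W t \<omega> - W s \<omega>) -` B \<inter> space M) \<inter> E) = prob ((\<lambda>\<omega>. W t \<omega> - W s \<omega>) -` B \<inter> space M) * prob E"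
proof -
  obtain J A where J: "finite J" "J \<subseteq> {0..s} \<union> {t..}" and A[measurable]: "\<And>r. A r \<in> sets borel"
    and E: "E = {\<omega>\<in>space M. \<forall>r\<in>J. outside s t r \<omega> \<in> A r}"
    using E unfolding outside_events_def mem_Collect_eq by (elim exE conjE) (rule that, auto)
  define S where "S = {0, s, t} \<union> J"
  define ts where "ts = sorted_list_of_set S"
  have S: "finite S" "set ts = S" "sorted_wrt (<) ts" 
  proof -
    show "finite S" using J by (simp add: S_def)
    then show "set ts = S" "sorted_wrt (<) ts" unfolding ts_def by auto
  qed
  have nonneg: "\<forall>x\<in>set ts. 0 \<le> x" using S J st by (auto simp: S_def)
  have less: "ts ! i < ts ! j" if "i < j" "j < length ts" for i j
    using sorted_wrt_nth_less[OF S(3)] that by auto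
  have "\<exists>i<length ts. ts ! i = r" if "r \<in> S" for r using that unfolding S(2)[symmetric] in_set_conv_nth .
  then obtain idx where idx: "\<And>r. r \<in> S \<Longrightarrow> idx r < length ts" "\<And>r. r \<in> S \<Longrightarrow> ts ! idx r = r" by metis
  have idx_le: "idx r \<le> idx r'" if "r \<in> S" "r' \<in> S" "r \<le> r'" for r r'
  proof (rule ccontr)
    assume "\<not> idx r \<le> idx r'"
    then have "r' < r" using less[of "idx r'" "idx r"] idx that by auto
    then show False using that by simp
  qed
  have mem: "0 \<in> S" "s \<in> S" "t \<in> S" by (auto simp: S_def)
  define m where "m = idx s"
  have m: "m < length ts" "ts ! m = s" using idx mem by (auto simp: m_def)
  \<comment> \<open>No grid time lies strictly between \<open>s\<close> and \<open>t\<close>, since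
    \<open>J\<close> avoids that interval.\<close>
  have t_idx: "idx t = Suc m"
  proof -
    have "m \<noteq> idx t" using m st idx(2)[OF mem(3)] by auto
    then have "m < idx t" using idx_le[OF mem(2,3)] st by (simp add: m_def)
    moreover have "\<not> Suc m < idx t"
    proof
      assume *: "Suc m < idx t"
      have l: "idx t < length ts" using idx mem by auto
      have "s < ts ! Suc m" "ts ! Suc m < t"
        using less[of m "Suc m"] less[of "Suc m" "idx t"] * l m idx mem by auto
      moreover have "ts ! Suc m \<in> S" using * l S(2) nth_mem by fastforce
      ultimately show False using st J by (auto simp: S_def)
    qed
    ultimately show ?thesis by simp
  qed
  have zero_idx: "ts ! 0 = 0"
  proof -
    have "0 < length ts" using m by auto
    then have "ts ! 0 \<ge> 0" using nonneg by auto
    moreover have "ts ! 0 \<le> ts ! idx 0" using less[of 0 "idx 0"] idx[OF mem(1)] by (cases "idx 0 = 0") auto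
    ultimately show ?thesis using idx mem by auto
  qed
  let ?I = "{..<length ts - 1}"
  define D where "D i \<omega> = W (ts ! Suc i) \<omega> - W (ts ! i) \<omega>" for i \<omega>
  have ind: "indep_vars (\<lambda>_. borel) D ?I"
    using bm S(3) nonneg unfolding brownian_motion_def D_def[abs_def] by blast
  define K where "K = ?I - {m}"
  have Suc_m: "Suc m < length ts" using t_idx idx(1)[OF mem(3)] by simp
  have indv: "indep_var (PiM {m} (\<lambda>_. borel)) (\<lambda>\<omega>. restrict (\<lambda>i. D i \<omega>) {m}) (PiM K (\<lambda>_. borel)) (\<lambda>\<omega>. restrict (\<lambda>i. D i \<omega>) K)"
    by (rule indep_var_restrict[OF ind]) (use Suc_m in \<open>auto simp: K_def\<close>)
  \<comment> \<open>The cells over which the value at \<open>r\<close> telescopes: from time 0 for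
    the past, from time \<open>t\<close> for the future. Neither range contains the cell
    \<open>m\<close>.\<close>
  define L where "L r = (if r \<le> s then {0..<idx r} else {Suc m..<idx r})" for r
  have L: "L r \<subseteq> K" if "r \<in> J" for r
  proof -
    have r: "r \<in> S" using that by (auto simp: S_def)
    have "idx r < length ts" using idx r by auto
    moreover have "r \<le> s \<Longrightarrow> idx r \<le> m" using idx_le[OF r mem(2)] by (simp add: m_def)
    ultimately show ?thesis by (auto simp: L_def K_def)
  qed
  have V: "outside s t r \<omega> = (\<Sum>i\<in>L r. D i \<omega>)" if "r \<in> J" "\<omega> \<in> space M" for r \<omega>
  proof -
    have r: "r \<in> S" using that by (auto simp: S_def)
    show ?thesis
    proof (cases "r \<le> s")
      case True
      have "(\<Sum>i\<in>L r. D i \<omega>) = W (ts ! idx r) \<omega> - W (ts ! 0) \<omega>"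
        using True unfolding L_def D_def by (simp add: sum_Suc_diff'[of 0 _ "\<lambda>i. W (ts ! i) \<omega>"])
      then show ?thesis using True idx r W_zero[OF that(2)] zero_idx by (simp add: outside_def)
    next
      case False
      then have "t \<le> r" using that J by auto
      then have "Suc m \<le> idx r" using idx_le[OF mem(3) r] t_idx by simp
      then have "(\<Sum>i\<in>L r. D i \<omega>) = W (ts ! idx r) \<omega> - W (ts ! Suc m) \<omega>"
        using False unfolding L_def D_def by (simp add: sum_Suc_diff'[of _ _ "\<lambda>i. W (ts ! i) \<omega>"])
      then show ?thesis using False idx(2)[OF r] idx(2)[OF mem(3)] t_idx by (simp add: outside_def)
    qed
  qed
  define Xa where "Xa = {g \<in> space (PiM {m} (\<lambda>_. borel)). g m \<in> B}"
  define Xb where "Xb = {g \<in> space (PiM K (\<lambda>_. borel)). \<forall>r\<in>J. (\<Sum>i\<in>L r. g i) \<in> A r}"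
  have [measurable]: "B \<in> sets borel" by fact
  have Xa: "Xa \<in> sets (PiM {m} (\<lambda>_. borel))" unfolding Xa_def by measurable
  have Xb: "Xb \<in> sets (PiM K (\<lambda>_. borel))" unfolding Xb_def
  proof (rule sets.sets_Collect_finite_All[OF _ J(1)])
    fix r assume "r \<in> J"
    then have [measurable]: "(\<lambda>g. \<Sum>i\<in>L r. g i) \<in> borel_measurable (PiM K (\<lambda>_. borel :: real measure))"
      using L by (intro borel_measurable_sum measurable_component_singleton) auto
    show "{g \<in> space (PiM K (\<lambda>_. borel)). (\<Sum>i\<in>L r. g i) \<in> A r} \<in> sets (PiM K (\<lambda>_. borel))" by measurable
  qed
  have D_m: "D m \<omega> = W t \<omega> - W s \<omega>" for \<omega> using m t_idx idx(2)[OF mem(3)] by (simp add: D_def)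
  have a: "(\<lambda>\<omega>. restrict (\<lambda>i. D i \<omega>) {m}) -` Xa \<inter> space M = (\<lambda>\<omega>. W t \<omega> - W s \<omega>) -` B \<inter> space M"
    by (auto simp: Xa_def D_m space_PiM)
  have "(\<Sum>i\<in>L r. restrict (\<lambda>i. D i \<omega>) K i) = (\<Sum>i\<in>L r. D i \<omega>)" if "r \<in> J" for r \<omega>
    using L[OF that] by (intro sum.cong) auto
  then have b: "(\<lambda>\<omega>. restrict (\<lambda>i. D i \<omega>) K) -` Xb \<inter> space M = E"
    using V by (auto simp: Xb_def E space_PiM)
  have "(\<lambda>\<omega>. (restrict (\<lambda>i. D i \<omega>) {m}, restrict (\<lambda>i. D i \<omega>) K)) -` (Xa \<times> Xb) \<inter> space M
     = ((\<lambda>\<omega>. restrict (\<lambda>i. D i \<omega>) {m}) -` Xa \<inter> space M) \<inter> ((\<lambda>\<omega>. restrict (\<lambda>i. D i \<omega>) K) -` Xb \<inter> space M)"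
    by auto
  with indep_varD[OF indv Xa Xb] show ?thesis unfolding a b by simp
qed

lemma increment_indep_outside_algebra:
  assumes st: "0 \<le> s" "s < t"
  shows "indep_set (sigma_sets (space M) {(\<lambda>\<omega>. W t \<omega> - W s \<omega>) -` B \<inter> space M | B. B \<in> sets borel})
           (sets (outside_algebra s t))"
  unfolding sets_outside_algebra
proof (rule indep_set_sigma_sets)
  show "Int_stable {(\<lambda>\<omega>. W t \<omega> - W s \<omega>) -` B \<inter> space M |B. B \<in> sets borel}"
  proof (safe intro!: Int_stableI)
    fix A B :: "real set" assume "A \<in> sets borel" "B \<in> sets borel"
    then show "\<exists>C. (\<lambda>\<omega>. W t \<omega> - W s \<omega>) -` A \<inter> space M \<inter> ((\<lambda>\<omega>. W t \<omega> - W s \<omega>) -` B \<inter> space M)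
       = (\<lambda>\<omega>. W t \<omega> - W s \<omega>) -` C \<inter> space M \<and> C \<in> sets borel"
      by (intro exI[of _ "A \<inter> B"]) auto
  qed
  show "Int_stable (outside_events s t)" by (rule Int_stable_outside_events)
  show "indep_set {(\<lambda>\<omega>. W t \<omega> - W s \<omega>) -` B \<inter> space M |B. B \<in> sets borel} (outside_events s t)"
  proof (rule indep_setI)
    show "{(\<lambda>\<omega>. W t \<omega> - W s \<omega>) -` B \<inter> space M |B. B \<in> sets borel} \<subseteq> events"
      by (auto intro!: measurable_sets)
  qed (use increment_indep_outside_event[OF st] outside_events_subset in auto)
qed

text \<open>The working form of independence. The function \<open>\<phi>\<close> is the identity in
  Doob's inequality and the first or second power in the Taylor expansion.\<close>

lemma
  fixes Y :: "'a \<Rightarrow> 'b::{real_normed_field,banach,second_countable_topology}" and \<phi> :: "real \<Rightarrow> 'b"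
  assumes st: "0 \<le> s" "s < t" and Y: "Y \<in> borel_measurable (outside_algebra s t)" "integrable M Y"
    and \<phi>: "\<phi> \<in> borel_measurable borel" "integrable M (\<lambda>\<omega>. \<phi> (W t \<omega> - W s \<omega>))"
  shows integrable_mult_increment: "integrable M (\<lambda>\<omega>. Y \<omega> * \<phi> (W t \<omega> - W s \<omega>))"
    and expectation_mult_increment:
      "(\<integral>\<omega>. Y \<omega> * \<phi> (W t \<omega> - W s \<omega>) \<partial>M) = (\<integral>\<omega>. Y \<omega> \<partial>M) * (\<integral>\<omega>. \<phi> (W t \<omega> - W s \<omega>) \<partial>M)"
proof -
  have sub: "sigma_sets (space M) {Y -` A \<inter> space M |A. A \<in> sets borel} \<subseteq> sets (outside_algebra s t)"
  proof -
    have "{Y -` A \<inter> space M |A. A \<in> sets borel} \<subseteq> sets (outside_algebra s t)"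
      using measurable_sets[OF Y(1)] by auto
    from sets.sigma_sets_subset[OF this] show ?thesis by simp
  qed
  have sub': "sigma_sets (space M) {(\<lambda>\<omega>. \<phi> (W t \<omega> - W s \<omega>)) -` A \<inter> space M |A. A \<in> sets borel}
     \<subseteq> sigma_sets (space M) {(\<lambda>\<omega>. W t \<omega> - W s \<omega>) -` B \<inter> space M |B. B \<in> sets borel}"
  proof (rule sigma_sets_mono', safe)
    fix A :: "'b set" assume "A \<in> sets borel"
    then have "\<phi> -` A \<in> sets borel" using measurable_sets[OF \<phi>(1)] by simp
    then show "\<exists>B. (\<lambda>\<omega>. \<phi> (W t \<omega> - W s \<omega>)) -` A \<inter> space M = (\<lambda>\<omega>. W t \<omega> - W s \<omega>) -` B \<inter> space M \<and> B \<in> sets borel"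
      by (intro exI[of _ "\<phi> -` A"]) auto
  qed
  have "indep_var borel Y borel (\<lambda>\<omega>. \<phi> (W t \<omega> - W s \<omega>))"
    unfolding indep_var_eq
  proof (intro conjI)
    show "indep_set (sigma_sets (space M) {Y -` A \<inter> space M |A. A \<in> sets borel})
     (sigma_sets (space M) {(\<lambda>\<omega>. \<phi> (W t \<omega> - W s \<omega>)) -` A \<inter> space M |A. A \<in> sets borel})"
    proof (rule indep_setI)
      note ind = increment_indep_outside_algebra[OF st]
      fix E E' assume E: "E \<in> sigma_sets (space M) {Y -` A \<inter> space M |A. A \<in> sets borel}"
        "E' \<in> sigma_sets (space M) {(\<lambda>\<omega>. \<phi> (W t \<omega> - W s \<omega>)) -` A \<inter> space M |A. A \<in> sets borel}"
      show "prob (E \<inter> E') = prob E * prob E'"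
        using indep_setD[OF ind subsetD[OF sub' E(2)] subsetD[OF sub E(1)]]
        by (simp add: Int_commute mult.commute)
    qed (rule order_trans[OF sub indep_setD_ev2[OF increment_indep_outside_algebra[OF st]]],
         rule order_trans[OF sub' indep_setD_ev1[OF increment_indep_outside_algebra[OF st]]])
  qed (rule borel_measurable_integrable, fact)+
  from indep_var_lebesgue_integral[OF this Y(2) \<phi>(2)] indep_var_integrable[OF this Y(2) \<phi>(2)]
  show "integrable M (\<lambda>\<omega>. Y \<omega> * \<phi> (W t \<omega> - W s \<omega>))"
    "(\<integral>\<omega>. Y \<omega> * \<phi> (W t \<omega> - W s \<omega>) \<partial>M) = (\<integral>\<omega>. Y \<omega> \<partial>M) * (\<integral>\<omega>. \<phi> (W t \<omega> - W s \<omega>) \<partial>M)"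
    by auto
qed

end

section \<open>Gaussian moments of increments\<close>

context brownian
begin

lemma increment_distributed:
  assumes "0 \<le> s" "s < t"
  shows "distributed M lborel (\<lambda>\<omega>. W t \<omega> - W s \<omega>) (\<lambda>y. ennreal (normal_density 0 (sqrt (t - s)) y))"
  using bm assms unfolding brownian_motion_def by blast

text \<open>The coefficient of the even moment is \<open>(2 * k - 1)!!\<close>; the cases used are
  the variance \<open>k = 1\<close> and the sixth moment \<open>k = 3\<close>, with coefficient
  15.\<close>

lemma
  assumes st: "0 \<le> s" "s < t"
  shows integrable_increment_power: "integrable M (\<lambda>\<omega>. (W t \<omega> - W s \<omega>) ^ k)"
    and expectation_increment: "(\<integral>\<omega>. (W t \<omega> - W s \<omega>) \<partial>M) = 0"
    and expectation_increment_even: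
      "(\<integral>\<omega>. (W t \<omega> - W s \<omega>) ^ (2 * k) \<partial>M) = fact (2 * k) / (2 ^ k * fact k) * (t - s) ^ k"
proof -
  have sg: "sqrt (t - s) > 0" using st by simp
  note D = increment_distributed[OF st]
  show "integrable M (\<lambda>\<omega>. (W t \<omega> - W s \<omega>) ^ k)"
    using distributed_integrable[OF D, of "\<lambda>x. x ^ k"] integrable_normal_moment[OF sg, of 0 k] by simp
  show "(\<integral>\<omega>. (W t \<omega> - W s \<omega>) \<partial>M) = 0"
    using distributed_integral[OF D, of "\<lambda>x. x"] integral_normal_moment_odd[OF sg, of 0 0] by simp
  have "(2 / (sqrt (t - s))\<^sup>2) ^ k = 2 ^ k / (t - s) ^ k" using st by (simp add: power_divide)
  then show "(\<integral>\<omega>. (W t \<omega> - W s \<omega>) ^ (2 * k) \<partial>M) = fact (2 * k) / (2 ^ k * fact k) * (t - s) ^ k"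
    using distributed_integral[OF D, of "\<lambda>x. x ^ (2 * k)"] integral_normal_moment_even[OF sg, of 0 k] by simp
qed

text \<open>Multiplying the density of variance \<open>t\<close> by
  \<open>exp (x\<^sup>2 / (4 * t))\<close> gives \<open>sqrt 2\<close> times the density of variance
  \<open>2 * t\<close>. Time 0 has no density and is treated apart.\<close>

lemma integrable_exp_square:
  assumes t: "0 \<le> t" "t \<le> T" and T: "T > 0" and e: "0 \<le> e" "e \<le> 1 / (4 * T)"
  shows "integrable M (\<lambda>\<omega>. exp (e * (W t \<omega>)\<^sup>2))"
proof (cases "t = 0")
  case True
  have "integrable M (\<lambda>\<omega>. 1 :: real)" by simp
  then show ?thesis
    by (rule Bochner_Integration.integrable_cong[THEN iffD1, OF refl, rotated]) (simp add: True W_zero)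
next
  case False
  then have t0: "t > 0" using t by simp
  note D = increment_distributed[OF order_refl t0]
  have "normal_density 0 (sqrt t) x * exp (1 / (4 * t) * x\<^sup>2) = sqrt 2 * normal_density 0 (sqrt (2 * t)) x" for x
  proof -
    have "exp (- x\<^sup>2 / (2 * t)) * exp (1 / (4 * t) * x\<^sup>2) = exp (- x\<^sup>2 / (2 * (2 * t)))"
      using t0 by (simp add: exp_add[symmetric] field_simps)
    moreover have "sqrt (2 * pi * (2 * t)) = sqrt 2 * sqrt (2 * pi * t)" by (simp add: real_sqrt_mult[symmetric])
    ultimately show ?thesis using t0 by (simp add: normal_density_def)
  qed
  then have "integrable lborel (\<lambda>x. normal_density 0 (sqrt t) x * exp (1 / (4 * t) * x\<^sup>2))"
    using t0 by simp
  then have *: "integrable M (\<lambda>\<omega>. exp (1 / (4 * t) * (W t \<omega> - W 0 \<omega>)\<^sup>2))"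
    using distributed_integrable[OF D, of "\<lambda>x. exp (1 / (4 * t) * x\<^sup>2)"] by simp
  have "1 / (4 * T) \<le> 1 / (4 * t)" using t t0 by (simp add: frac_le)
  then have et: "e \<le> 1 / (4 * t)" using e by simp
  show ?thesis
  proof (rule Bochner_Integration.integrable_bound[OF *])
    show "AE \<omega> in M. norm (exp (e * (W t \<omega>)\<^sup>2)) \<le> norm (exp (1 / (4 * t) * (W t \<omega> - W 0 \<omega>)\<^sup>2))"
    proof (rule AE_I2)
      fix \<omega> assume "\<omega> \<in> space M"
      then show "norm (exp (e * (W t \<omega>)\<^sup>2)) \<le> norm (exp (1 / (4 * t) * (W t \<omega> - W 0 \<omega>)\<^sup>2))"
        using mult_right_mono[OF et, of "(W t \<omega>)\<^sup>2"] by (simp add: W_zero)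
    qed
  qed measurable
qed

end

text \<open>Taking expectations gives Doob's \<open>L\<^sup>2\<close> inequality, since the sum is a martingale transform and has
  nonnegative mean if \<open>y\<close> is a submartingale.\<close>

lemma pathwise_doob:
  fixes y :: "nat \<Rightarrow> real"
  assumes "\<And>k. y k \<ge> 0"
  shows "(Max (y ` {..n}))\<^sup>2 \<le> 4 * (y n)\<^sup>2 - 4 * (\<Sum>k<n. Max (y ` {..k}) * (y (Suc k) - y k))"
proof -
  define m where "m n = Max (y ` {..n})" for n
  have m_Suc: "m (Suc n) = max (m n) (y (Suc n))" for n
    by (simp add: m_def atMost_Suc Max_insert max.commute)
  \<comment> \<open>A discrete integration by parts: \<open>m\<close> changes only when
    \<open>y\<close> reaches a new maximum, and there the defect is half the square of the jump of
    \<open>m\<close>.\<close>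
  have *: "(m n)\<^sup>2 / 2 + (\<Sum>k<n. m k * (y (Suc k) - y k)) \<le> m n * y n" for n
  proof (induction n)
    case 0
    have "m 0 = y 0" by (simp add: m_def)
    then show ?case by (simp add: power2_eq_square)
  next
    case (Suc n)
    show ?case
    proof (cases "y (Suc n) \<le> m n")
      case True
      then have "m (Suc n) = m n" by (simp add: m_Suc)
      then show ?thesis using Suc by (simp add: algebra_simps)
    next
      case False
      then have "m (Suc n) = y (Suc n)" by (simp add: m_Suc)
      moreover have "0 \<le> (y (Suc n) - m n)\<^sup>2" by simp
      ultimately show ?thesis using Suc by (simp add: power2_eq_square algebra_simps)
    qed
  qed
  \<comment> \<open>AM-GM weighted so that half of \<open>(m n)\<^sup>2\<close> survives on the
    left; this produces the constant 4.\<close>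
  have "2 * (m n * y n) \<le> (m n)\<^sup>2 / 2 + 2 * (y n)\<^sup>2"
    using zero_le_power2[of "m n - 2 * y n"] by (simp add: power2_eq_square algebra_simps)
  then show ?thesis using *[of n] unfolding m_def[symmetric] by linarith
qed

text \<open>Convexity of \<open>exp (e * x\<^sup>2)\<close>, obtained from
  \<open>1 + z \<le> exp z\<close>. It takes the place of conditional Jensen: the submartingale
  increment is bounded below by a factor known at the earlier time, multiplied by a Brownian
  increment.\<close>

lemma exp_square_tangent:
  fixes e u v :: real assumes "e \<ge> 0"
  shows "exp (e * u\<^sup>2) * (2 * e * u) * (v - u) \<le> exp (e * v\<^sup>2) - exp (e * u\<^sup>2)"
proof -
  have "2 * u * (v - u) \<le> v\<^sup>2 - u\<^sup>2"
    using zero_le_power2[of "v - u"] by (simp add: power2_eq_square algebra_simps)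
  then have "e * (2 * u * (v - u)) \<le> e * (v\<^sup>2 - u\<^sup>2)" using assms by (rule mult_left_mono)
  also have "\<dots> \<le> exp (e * (v\<^sup>2 - u\<^sup>2)) - 1" using exp_ge_add_one_self[of "e * (v\<^sup>2 - u\<^sup>2)"] by linarith
  finally have "exp (e * u\<^sup>2) * (e * (2 * u * (v - u))) \<le> exp (e * u\<^sup>2) * (exp (e * (v\<^sup>2 - u\<^sup>2)) - 1)"
    by (rule mult_left_mono) simp
  also have "\<dots> = exp (e * v\<^sup>2) - exp (e * u\<^sup>2)"
    by (simp add: right_diff_distrib exp_add[symmetric])
  finally show ?thesis by (simp add: algebra_simps)
qed

context brownian
begin

text \<open>Doob's inequality for \<open>exp (e * W\<^sup>2)\<close> on a grid, with a bound
  independent of \<open>n\<close>. The choice of \<open>e\<close> makes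
  \<open>exp (l * e * W\<^sup>2)\<close> integrable for \<open>l\<close> up to 4; the second moment
  uses \<open>l = 2\<close> and the transform uses \<open>l = 3\<close>.\<close>

lemma grid_maximum_moment:
  assumes T: "T > 0" and n: "n > 0"
  defines "e \<equiv> 1 / (16 * T)"
  defines "y \<equiv> \<lambda>k \<omega>. exp (e * (W (real k * T / real n) \<omega>)\<^sup>2)"
  shows "integrable M (\<lambda>\<omega>. (Max ((\<lambda>k. y k \<omega>) ` {..n}))\<^sup>2)"
    and "(\<integral>\<omega>. (Max ((\<lambda>k. y k \<omega>) ` {..n}))\<^sup>2 \<partial>M) \<le> 4 * (\<integral>\<omega>. exp (2 * e * (W T \<omega>)\<^sup>2) \<partial>M)"
proof -
  define \<tau> where "\<tau> k = real k * T / real n" for k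
  have \<tau>: "0 \<le> \<tau> k" "\<tau> k < \<tau> (Suc k)" "k \<le> n \<Longrightarrow> \<tau> k \<le> T" for k
    using T n by (auto simp: \<tau>_def field_simps)
  have y: "y k \<omega> = exp (e * (W (\<tau> k) \<omega>)\<^sup>2)" for k \<omega> by (simp add: y_def \<tau>_def)
  have e: "e > 0" using T by (simp add: e_def)
  have exp_int: "integrable M (\<lambda>\<omega>. exp (l * e * (W (\<tau> k) \<omega>)\<^sup>2))" if "k \<le> n" "0 \<le> l" "l \<le> 4" for k l
    by (rule integrable_exp_square[OF \<tau>(1) \<tau>(3)[OF that(1)] T]) (use that T in \<open>auto simp: e_def field_simps\<close>)
  define m where "m k \<omega> = Max ((\<lambda>j. y j \<omega>) ` {..k})" for k \<omega>
  have y_meas: "y j \<in> borel_measurable (outside_algebra (\<tau> k) (\<tau> (Suc k)))" if "j \<le> k" for j k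
  proof -
    have "\<tau> j \<le> \<tau> k" using that T n by (auto simp: \<tau>_def field_simps)
    then have [measurable]: "W (\<tau> j) \<in> borel_measurable (outside_algebra (\<tau> k) (\<tau> (Suc k)))"
      using past_measurable \<tau> by blast
    show ?thesis unfolding y[abs_def] by measurable
  qed
  have m_meas: "m k \<in> borel_measurable (outside_algebra (\<tau> k) (\<tau> (Suc k)))" for k
    unfolding m_def[abs_def] by (intro borel_measurable_Max y_meas) auto
  have m_meas_M [measurable]: "m k \<in> borel_measurable M" for k
    by (rule outside_algebra_subalgebra[OF m_meas])
  have y2: "(y k \<omega>)\<^sup>2 = exp (2 * e * (W (\<tau> k) \<omega>)\<^sup>2)" for k \<omega>
    by (simp add: y exp_double[symmetric] mult.assoc)
  have y2_int: "integrable M (\<lambda>\<omega>. (y k \<omega>)\<^sup>2)" if "k \<le> n" for k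
    unfolding y2 by (rule exp_int) (use that in auto)
  have m_mem: "\<exists>j\<le>k. m k \<omega> = y j \<omega>" for k \<omega>
  proof -
    have "m k \<omega> \<in> (\<lambda>j. y j \<omega>) ` {..k}" unfolding m_def by (rule Max_in) auto
    then show ?thesis by auto
  qed
  have m_int: "integrable M (\<lambda>\<omega>. (m k \<omega>)\<^sup>2)" if "k \<le> n" for k
  proof (rule Bochner_Integration.integrable_bound)
    show "integrable M (\<lambda>\<omega>. \<Sum>j\<le>k. (y j \<omega>)\<^sup>2)"
      using that by (intro Bochner_Integration.integrable_sum y2_int) auto
    have "(m k \<omega>)\<^sup>2 \<le> (\<Sum>j\<le>k. (y j \<omega>)\<^sup>2)" for \<omega>
    proof -
      obtain j where "j \<le> k" "m k \<omega> = y j \<omega>" using m_mem by blast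
      then show ?thesis using member_le_sum[of j "{..k}" "\<lambda>j. (y j \<omega>)\<^sup>2"] by simp
    qed
    then show "AE \<omega> in M. norm ((m k \<omega>)\<^sup>2) \<le> norm (\<Sum>j\<le>k. (y j \<omega>)\<^sup>2)"
      by (intro AE_I2) (simp add: abs_of_nonneg sum_nonneg)
  qed measurable
  \<comment> \<open>The running maximum times the slope of \<open>exp (e * x\<^sup>2)\<close> at
    \<open>W (\<tau> k)\<close>: the integrand of the martingale transform, determined by the path
    up to \<open>\<tau> k\<close>.\<close>
  define G where "G k \<omega> = m k \<omega> * (y k \<omega> * (2 * e * W (\<tau> k) \<omega>))" for k \<omega>
  have G_meas: "G k \<in> borel_measurable (outside_algebra (\<tau> k) (\<tau> (Suc k)))" for k
    unfolding G_def[abs_def]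
    by (intro borel_measurable_times m_meas y_meas borel_measurable_const past_measurable \<tau>) auto
  have G_int: "integrable M (G k)" if "k < n" for k
  proof (rule Bochner_Integration.integrable_bound)
    show "integrable M (\<lambda>\<omega>. (m k \<omega>)\<^sup>2 + 4 * e * exp (3 * e * (W (\<tau> k) \<omega>)\<^sup>2))"
      using that by (intro Bochner_Integration.integrable_add m_int integrable_mult_right exp_int) auto
    show "AE \<omega> in M. norm (G k \<omega>) \<le> norm ((m k \<omega>)\<^sup>2 + 4 * e * exp (3 * e * (W (\<tau> k) \<omega>)\<^sup>2))"
    proof (rule AE_I2)
      fix \<omega>
      let ?w = "W (\<tau> k) \<omega>"
      have "2 * \<bar>m k \<omega> * (y k \<omega> * (2 * e * ?w))\<bar> \<le> (m k \<omega>)\<^sup>2 + (y k \<omega> * (2 * e * ?w))\<^sup>2"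
        using sum_squares_bound[of "\<bar>m k \<omega>\<bar>" "\<bar>y k \<omega> * (2 * e * ?w)\<bar>"]
        by (simp only: abs_mult[of "m k \<omega>"] power2_abs mult.assoc)
      moreover have "(y k \<omega> * (2 * e * ?w))\<^sup>2 = 4 * e * ((e * ?w\<^sup>2) * exp (2 * e * ?w\<^sup>2))"
        by (simp only: power_mult_distrib y2) (simp add: power2_eq_square)
      \<comment> \<open>The polynomial factor is absorbed by one more unit of the rate, from
        \<open>2 * e\<close> to \<open>3 * e\<close>.\<close>
      moreover have "(e * ?w\<^sup>2) * exp (2 * e * ?w\<^sup>2) \<le> exp (e * ?w\<^sup>2) * exp (2 * e * ?w\<^sup>2)"
        using order_trans[OF _ exp_ge_add_one_self[of "e * ?w\<^sup>2"]] by (intro mult_right_mono) auto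
      then have "4 * e * ((e * ?w\<^sup>2) * exp (2 * e * ?w\<^sup>2)) \<le> 4 * e * exp (3 * e * ?w\<^sup>2)"
        using e by (intro mult_left_mono) (auto simp: exp_add[symmetric] mult.assoc)
      ultimately have "\<bar>G k \<omega>\<bar> \<le> (m k \<omega>)\<^sup>2 + 4 * e * exp (3 * e * ?w\<^sup>2)"
        unfolding G_def by linarith
      then show "norm (G k \<omega>) \<le> norm ((m k \<omega>)\<^sup>2 + 4 * e * exp (3 * e * ?w\<^sup>2))" by simp
    qed
  qed (rule outside_algebra_subalgebra[OF G_meas])
  define w where "w k \<omega> = W (\<tau> (Suc k)) \<omega> - W (\<tau> k) \<omega>" for k \<omega>
  have Gw: "integrable M (\<lambda>\<omega>. G k \<omega> * w k \<omega>)" "(\<integral>\<omega>. G k \<omega> * w k \<omega> \<partial>M) = 0" if "k < n" for k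
    using integrable_mult_increment[OF \<tau>(1,2) G_meas G_int[OF that], of "\<lambda>x. x"]
      expectation_mult_increment[OF \<tau>(1,2) G_meas G_int[OF that], of "\<lambda>x. x"]
      integrable_increment_power[OF \<tau>(1,2), of k 1] expectation_increment[OF \<tau>(1,2), of k]
    by (auto simp: w_def)
  have bound: "(m n \<omega>)\<^sup>2 \<le> 4 * (y n \<omega>)\<^sup>2 - 4 * (\<Sum>k<n. G k \<omega> * w k \<omega>)" for \<omega>
  proof -
    have "G k \<omega> * w k \<omega> \<le> m k \<omega> * (y (Suc k) \<omega> - y k \<omega>)" for k
    proof -
      have "m k \<omega> \<ge> 0" using m_mem[of k \<omega>] by (auto simp: y)
      from mult_left_mono[OF exp_square_tangent[of e "W (\<tau> k) \<omega>" "W (\<tau> (Suc k)) \<omega>"] this] e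
      show ?thesis by (simp add: G_def w_def y mult.assoc)
    qed
    then have "(\<Sum>k<n. G k \<omega> * w k \<omega>) \<le> (\<Sum>k<n. m k \<omega> * (y (Suc k) \<omega> - y k \<omega>))" by (intro sum_mono)
    moreover have "(m n \<omega>)\<^sup>2 \<le> 4 * (y n \<omega>)\<^sup>2 - 4 * (\<Sum>k<n. m k \<omega> * (y (Suc k) \<omega> - y k \<omega>))"
      unfolding m_def by (rule pathwise_doob) (simp add: y)
    ultimately show ?thesis by linarith
  qed
  show "integrable M (\<lambda>\<omega>. (Max ((\<lambda>k. y k \<omega>) ` {..n}))\<^sup>2)" using m_int[of n] by (simp add: m_def)
  have "(\<integral>\<omega>. (m n \<omega>)\<^sup>2 \<partial>M) \<le> (\<integral>\<omega>. 4 * (y n \<omega>)\<^sup>2 - 4 * (\<Sum>k<n. G k \<omega> * w k \<omega>) \<partial>M)"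
    by (intro integral_mono m_int bound Bochner_Integration.integrable_diff integrable_mult_right y2_int
        Bochner_Integration.integrable_sum Gw) auto
  also have "\<dots> = (\<integral>\<omega>. 4 * (y n \<omega>)\<^sup>2 \<partial>M) - (\<integral>\<omega>. 4 * (\<Sum>k<n. G k \<omega> * w k \<omega>) \<partial>M)"
    by (intro Bochner_Integration.integral_diff integrable_mult_right y2_int
        Bochner_Integration.integrable_sum Gw) auto
  also have "(\<integral>\<omega>. 4 * (\<Sum>k<n. G k \<omega> * w k \<omega>) \<partial>M) = 4 * (\<Sum>k<n. \<integral>\<omega>. G k \<omega> * w k \<omega> \<partial>M)"
    by (subst Bochner_Integration.integral_sum[symmetric]) (use Gw in auto)
  also have "\<dots> = 0" using Gw by simp
  also have "(\<integral>\<omega>. 4 * (y n \<omega>)\<^sup>2 \<partial>M) = 4 * (\<integral>\<omega>. exp (2 * e * (W T \<omega>)\<^sup>2) \<partial>M)"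
    using n by (simp add: y2 \<tau>_def)
  finally show "(\<integral>\<omega>. (Max ((\<lambda>k. y k \<omega>) ` {..n}))\<^sup>2 \<partial>M) \<le> 4 * (\<integral>\<omega>. exp (2 * e * (W T \<omega>)\<^sup>2) \<partial>M)"
    by (simp add: m_def)
qed

text \<open>Grid maxima converge to the supremum by continuity of the path, and Fatou's lemma
  carries the uniform bound over. The squared maximum of \<open>exp (W\<^sup>2 / (16 * T))\<close>
  yields the rate \<open>1 / (8 * T)\<close>.\<close>

lemma exists_gaussian_sup_bound:
  assumes T: "T > 0"
  obtains m where "m \<in> borel_measurable M" "\<And>\<omega> r. \<omega> \<in> space M \<Longrightarrow> r \<in> {0..T} \<Longrightarrow> \<bar>W r \<omega>\<bar> \<le> m \<omega>"
    "integrable M (\<lambda>\<omega>. exp ((m \<omega>)\<^sup>2 / (8 * T)))"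
proof -
  define m where "m \<omega> = (SUP r\<in>{0..T}. \<bar>W r \<omega>\<bar>)" for \<omega>
  have attained: "\<exists>r\<in>{0..T}. m \<omega> = \<bar>W r \<omega>\<bar> \<and> (\<forall>r'\<in>{0..T}. \<bar>W r' \<omega>\<bar> \<le> m \<omega>)" if \<omega>: "\<omega> \<in> space M" for \<omega>
  proof -
    obtain r where r: "r \<in> {0..T}" "\<And>r'. r' \<in> {0..T} \<Longrightarrow> \<bar>W r' \<omega>\<bar> \<le> \<bar>W r \<omega>\<bar>"
      using continuous_attains_sup[of "{0..T}" "\<lambda>r. \<bar>W r \<omega>\<bar>"] T W_continuous[OF \<omega>, of T]
      by (force intro!: continuous_intros)
    then have "m \<omega> = \<bar>W r \<omega>\<bar>" unfolding m_def by (intro cSup_eq_maximum) auto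
    then show ?thesis using r by auto
  qed
  define y where "y n k \<omega> = exp (1 / (16 * T) * (W (real k * T / real (Suc n)) \<omega>)\<^sup>2)" for n k \<omega>
  define g where "g n \<omega> = (Max ((\<lambda>k. y n k \<omega>) ` {..Suc n}))\<^sup>2" for n \<omega>
  note mom = grid_maximum_moment[OF T, of "Suc _", folded y_def g_def, OF zero_less_Suc]
  define K where "K = 4 * (\<integral>\<omega>. exp (2 * (1 / (16 * T)) * (W T \<omega>)\<^sup>2) \<partial>M)"
  have lim: "(\<lambda>n. g n \<omega>) \<longlonglongrightarrow> exp ((m \<omega>)\<^sup>2 / (8 * T))" if \<omega>: "\<omega> \<in> space M" for \<omega>
  proof -
    obtain r where r: "r \<in> {0..T}" "m \<omega> = \<bar>W r \<omega>\<bar>" "\<And>r'. r' \<in> {0..T} \<Longrightarrow> \<bar>W r' \<omega>\<bar> \<le> m \<omega>"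
      using attained[OF \<omega>] by blast
    \<comment> \<open>The last grid point not after the maximiser \<open>r\<close>; it is within
      \<open>T / Suc n\<close> of it.\<close>
    define k where "k n = nat \<lfloor>r * real (Suc n) / T\<rfloor>" for n
    define \<rho> where "\<rho> n = real (k n) * T / real (Suc n)" for n
    have kr: "real (k n) \<le> r * real (Suc n) / T" "r * real (Suc n) / T < real (k n) + 1" for n
    proof -
      have "r * real (Suc n) / T \<ge> 0" using r T by auto
      then show "real (k n) \<le> r * real (Suc n) / T" "r * real (Suc n) / T < real (k n) + 1"
        unfolding k_def by linarith+
    qed
    have \<rho>: "0 \<le> \<rho> n" "\<rho> n \<le> r" "r - T / real (Suc n) \<le> \<rho> n" for n
    proof -
      define N where "N = real (Suc n)"
      have N: "N > 0" by (simp add: N_def)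
      show "0 \<le> \<rho> n" using T by (simp add: \<rho>_def)
      have "real (k n) \<le> r * N / T" "r * N / T \<le> real (k n) + 1" using kr[of n] by (simp_all only: N_def)
      then have "real (k n) * T \<le> r * N" "r * N \<le> (real (k n) + 1) * T" using T by (simp_all add: field_simps)
      then have "real (k n) * T / N \<le> r" "r \<le> (real (k n) + 1) * T / N"
        using N by (simp_all add: divide_le_eq le_divide_eq)
      then show "\<rho> n \<le> r" "r - T / real (Suc n) \<le> \<rho> n"
        unfolding \<rho>_def N_def[symmetric] by (simp_all add: distrib_right add_divide_distrib)
    qed
    have k_le: "k n \<le> Suc n" for n
    proof -
      have "real (k n) \<le> r * real (Suc n) / T" by (rule kr)
      also have "\<dots> \<le> real (Suc n)" using r T by (simp add: divide_le_eq mult.commute mult_right_mono)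
      finally show ?thesis by simp
    qed
    have "(\<lambda>n. r - T / real (Suc n)) \<longlonglongrightarrow> r - 0"
      by (intro tendsto_intros LIMSEQ_Suc[OF lim_const_over_n])
    then have "\<rho> \<longlonglongrightarrow> r" using \<rho>
      by (intro tendsto_sandwich[of "\<lambda>n. r - T / real (Suc n)" \<rho> sequentially "\<lambda>_. r"]) auto
    then have "(\<lambda>n. W (\<rho> n) \<omega>) \<longlonglongrightarrow> W r \<omega>"
      using continuous_on_tendsto_compose[OF W_continuous[OF \<omega>, of T], of \<rho> r] r \<rho> order_trans[OF \<rho>(2)]
      by (auto intro!: always_eventually)
    then have low: "(\<lambda>n. (y n (k n) \<omega>)\<^sup>2) \<longlonglongrightarrow> (exp (1 / (16 * T) * (W r \<omega>)\<^sup>2))\<^sup>2"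
      unfolding y_def \<rho>_def[symmetric] by (intro tendsto_intros)
    have e: "(exp (1 / (16 * T) * z\<^sup>2))\<^sup>2 = exp (\<bar>z\<bar>\<^sup>2 / (8 * T))" for z
      by (simp add: exp_double[symmetric])
    have y0: "y n j \<omega> \<ge> 0" for n j by (simp add: y_def)
    have "(y n (k n) \<omega>)\<^sup>2 \<le> g n \<omega>" for n
      unfolding g_def using k_le y0 by (intro power_mono Max_ge) auto
    moreover have "g n \<omega> \<le> exp ((m \<omega>)\<^sup>2 / (8 * T))" for n
    proof -
      have "Max ((\<lambda>k. y n k \<omega>) ` {..Suc n}) \<in> (\<lambda>k. y n k \<omega>) ` {..Suc n}" by (rule Max_in) auto
      then obtain j where j: "j \<le> Suc n" "Max ((\<lambda>k. y n k \<omega>) ` {..Suc n}) = y n j \<omega>"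
        unfolding image_iff atMost_iff Bex_def by blast
      have "real j * T / real (Suc n) \<le> T" using j T by (simp add: divide_le_eq mult.commute mult_right_mono)
      then have "real j * T / real (Suc n) \<in> {0..T}" using T by simp
      then have "\<bar>W (real j * T / real (Suc n)) \<omega>\<bar>\<^sup>2 \<le> (m \<omega>)\<^sup>2" using r(3) by (intro power_mono) auto
      then show ?thesis unfolding g_def j(2) unfolding y_def e using T by (simp add: divide_right_mono)
    qed
    moreover have "(exp (1 / (16 * T) * (W r \<omega>)\<^sup>2))\<^sup>2 = exp ((m \<omega>)\<^sup>2 / (8 * T))" unfolding e r(2) ..
    ultimately show ?thesis
      using tendsto_sandwich[OF _ _ low, of "\<lambda>n. g n \<omega>" "\<lambda>_. exp ((m \<omega>)\<^sup>2 / (8 * T))"] by simp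
  qed
  have g_meas [measurable]: "g n \<in> borel_measurable M" for n using mom(1)[of n] by auto
  have m_meas: "m \<in> borel_measurable M"
  proof -
    \<comment> \<open>A supremum over uncountably many times; measurability comes from the grid
      limit, and \<open>m\<close> is recovered from it by \<open>ln\<close> and \<open>sqrt\<close>
      because it is nonnegative.\<close>
    have "(\<lambda>\<omega>. exp ((m \<omega>)\<^sup>2 / (8 * T))) \<in> borel_measurable M"
      by (rule borel_measurable_LIMSEQ_real[OF lim g_meas])
    then have "(\<lambda>\<omega>. sqrt (8 * T * ln (exp ((m \<omega>)\<^sup>2 / (8 * T))))) \<in> borel_measurable M" by measurable
    moreover have "sqrt (8 * T * ln (exp ((m \<omega>)\<^sup>2 / (8 * T)))) = m \<omega>" if "\<omega> \<in> space M" for \<omega>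
      using attained[OF that] T by auto
    ultimately show ?thesis by (subst measurable_cong[symmetric]) auto
  qed
  have "(\<integral>\<^sup>+\<omega>. ennreal (exp ((m \<omega>)\<^sup>2 / (8 * T))) \<partial>M) \<le> (\<integral>\<^sup>+\<omega>. liminf (\<lambda>n. ennreal (g n \<omega>)) \<partial>M)"
  proof (rule nn_integral_mono)
    fix \<omega> assume "\<omega> \<in> space M"
    then have "(\<lambda>n. ennreal (g n \<omega>)) \<longlonglongrightarrow> ennreal (exp ((m \<omega>)\<^sup>2 / (8 * T)))"
      using lim by (intro tendsto_ennrealI)
    then show "ennreal (exp ((m \<omega>)\<^sup>2 / (8 * T))) \<le> liminf (\<lambda>n. ennreal (g n \<omega>))"
      using lim_imp_Liminf[of sequentially "\<lambda>n. ennreal (g n \<omega>)"] by simp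
  qed
  also have "\<dots> \<le> liminf (\<lambda>n. \<integral>\<^sup>+\<omega>. ennreal (g n \<omega>) \<partial>M)" by (rule nn_integral_liminf) measurable
  also have "\<dots> \<le> liminf (\<lambda>n. ennreal K)"
  proof (intro Liminf_mono always_eventually allI)
    fix n
    have "(\<integral>\<^sup>+\<omega>. ennreal (g n \<omega>) \<partial>M) = ennreal (\<integral>\<omega>. g n \<omega> \<partial>M)"
      using mom(1)[of n] by (intro nn_integral_eq_integral) (auto simp: g_def)
    also have "\<dots> \<le> ennreal K" unfolding K_def by (rule ennreal_leI[OF mom(2)])
    finally show "(\<integral>\<^sup>+\<omega>. ennreal (g n \<omega>) \<partial>M) \<le> ennreal K" .
  qed
  also have "\<dots> < \<infinity>" by (simp add: Liminf_const)
  finally have "integrable M (\<lambda>\<omega>. exp ((m \<omega>)\<^sup>2 / (8 * T)))"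
    using m_meas by (intro integrableI_bounded) auto
  with m_meas attained show ?thesis by (intro that[of m]) blast+
qed

end

section \<open>The path functional and its derivatives in the initial value\<close>

text \<open>All that is kept of the power series: smoothness in space, growth below every Gaussian
  for each derivative, and the sign of the real part. The index counts space derivatives.\<close>

locale ou_coefficients =
  fixes a b c T :: real and U :: "nat \<Rightarrow> real \<Rightarrow> real \<Rightarrow> complex" and Q :: "nat \<Rightarrow> real \<Rightarrow> complex"
  assumes T_pos: "T > 0"
    and U_cont: "continuous_on ({0..T} \<times> UNIV) (\<lambda>(s, z). U n s z)"
    and U_deriv: "s \<in> {0..T} \<Longrightarrow> (U n s has_vector_derivative U (Suc n) s z) (at z)"
    and U_growth: "e > 0 \<Longrightarrow> \<exists>C\<ge>0. \<forall>s\<in>{0..T}. \<forall>z. norm (U n s z) \<le> C * exp (e * z\<^sup>2)"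
    and U_Re: "s \<in> {0..T} \<Longrightarrow> Re (U 0 s z) \<le> 0"
    and Q_deriv: "(Q n has_vector_derivative Q (Suc n) z) (at z)"
    and Q_growth: "e > 0 \<Longrightarrow> \<exists>C\<ge>0. \<forall>z. norm (Q n z) \<le> C * exp (e * z\<^sup>2)"
    and Q_Re: "Re (Q 0 z) \<le> 0"
begin

text \<open>The closed form from \<open>ou_solution_explicit\<close>, taken as a definition for any
  path and any pair of times, also for \<open>r\<close> before \<open>t\<close>. This frees the
  estimates from ordering conditions.\<close>

definition flow :: "(real \<Rightarrow> real) \<Rightarrow> real \<Rightarrow> real \<Rightarrow> real \<Rightarrow> real" where
  "flow w t y r = exp (b * (r - t)) * y + exp (b * r) * (ou_primitive a b c w r - ou_primitive a b c w t)"

text \<open>The flow is affine in the initial value with slope \<open>exp (b * (r - t))\<close>, so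
  the chain rule only multiplies the \<open>n\<close>-th derivative by the \<open>n\<close>-th power
  of the slope.\<close>

definition running :: "nat \<Rightarrow> (real \<Rightarrow> real) \<Rightarrow> real \<Rightarrow> real \<Rightarrow> real \<Rightarrow> complex" where
  "running n w t y r = exp (real n * b * (r - t)) *\<^sub>R U n r (flow w t y r)"

definition final :: "nat \<Rightarrow> (real \<Rightarrow> real) \<Rightarrow> real \<Rightarrow> real \<Rightarrow> complex" where
  "final n w t y = exp (real n * b * (T - t)) *\<^sub>R Q n (flow w t y T)"

definition H :: "nat \<Rightarrow> (real \<Rightarrow> real) \<Rightarrow> real \<Rightarrow> real \<Rightarrow> complex" where
  "H n w t y = integral {t..T} (running n w t y) + final n w t y"

text \<open>The \<open>n\<close>-th derivative of \<open>exp (H 0)\<close>, by Leibniz' rule applied to \<open>F' = F * H'\<close>.\<close>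

fun F :: "nat \<Rightarrow> (real \<Rightarrow> real) \<Rightarrow> real \<Rightarrow> real \<Rightarrow> complex" where
  "F 0 w t y = exp (H 0 w t y)"
| "F (Suc n) w t y = (\<Sum>k\<le>n. of_nat (n choose k) * (F (n - k) w t y * H (Suc k) w t y))"

lemma flow_start [simp]: "flow w t y t = y"
  by (simp add: flow_def)

lemma flow_flow: "flow w t (flow w s y t) r = flow w s y r"
proof -
  have "exp (b * (r - t)) * exp (b * (t - s)) = exp (b * (r - s))" "exp (b * (r - t)) * exp (b * t) = exp (b * r)"
    by (simp_all add: exp_add[symmetric] algebra_simps)
  then have "exp (b * (r - t)) * flow w s y t
      = exp (b * (r - s)) * y + exp (b * r) * (ou_primitive a b c w t - ou_primitive a b c w s)"
    unfolding flow_def by (simp add: distrib_left mult.assoc[symmetric])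
  then show ?thesis unfolding flow_def[of w t] by (simp add: flow_def[of w s] algebra_simps)
qed

lemma continuous_on_flow:
  assumes w: "continuous_on {0..T} w"
    and f: "continuous_on S f" "continuous_on S g" "continuous_on S h" "f ` S \<subseteq> {0..T}" "h ` S \<subseteq> {0..T}"
  shows "continuous_on S (\<lambda>z. flow w (f z) (g z) (h z))"
proof -
  note A = continuous_on_ou_primitive[OF w, of a b c]
  have "continuous_on S (\<lambda>z. ou_primitive a b c w (f z))" "continuous_on S (\<lambda>z. ou_primitive a b c w (h z))"
    by (rule continuous_on_compose2[OF A]; use f in simp)+
  then show ?thesis unfolding flow_def by (intro continuous_intros f)
qed

lemma continuous_on_U:
  assumes "continuous_on S f" "continuous_on S g" "f ` S \<subseteq> {0..T}"
  shows "continuous_on S (\<lambda>z. U n (f z) (g z))"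
proof -
  have "continuous_on S (\<lambda>z. (\<lambda>(s, z). U n s z) (f z, g z))"
    by (rule continuous_on_compose2[OF U_cont]) (use assms in \<open>auto intro!: continuous_intros\<close>)
  then show ?thesis by simp
qed

lemma continuous_on_Q:
  assumes "continuous_on S g" shows "continuous_on S (\<lambda>z. Q n (g z))"
proof -
  have "continuous_on UNIV (Q n)"
    using Q_deriv has_vector_derivative_continuous by (blast intro: continuous_at_imp_continuous_on)
  then show ?thesis by (rule continuous_on_compose2) (use assms in auto)
qed

lemma continuous_on_running:
  assumes w: "continuous_on {0..T} w"
    and f: "continuous_on S f" "continuous_on S g" "continuous_on S h" "f ` S \<subseteq> {0..T}" "h ` S \<subseteq> {0..T}"
  shows "continuous_on S (\<lambda>z. running n w (f z) (g z) (h z))"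
  unfolding running_def by (intro continuous_intros f continuous_on_U continuous_on_flow[OF w])

lemma continuous_on_running_path:
  assumes "continuous_on {0..T} w" "0 \<le> t" "{s..r} \<subseteq> {0..T}" "t \<le> T"
  shows "continuous_on {s..r} (running n w t y)"
  by (rule continuous_on_running[OF assms(1)]) (use assms in \<open>auto intro!: continuous_intros\<close>)

text \<open>The lower limit of the integral moves with \<open>t\<close>; rescaling to the unit
  interval turns this into a parameter of the integrand.\<close>

lemma continuous_on_H:
  assumes w: "continuous_on {0..T} w"
  shows "continuous_on ({0..T} \<times> UNIV) (\<lambda>(t, y). H n w t y)"
proof -
  have in_T: "t + (T - t) * r \<in> {0..T}" if "t \<in> {0..T}" "r \<in> {0..1}" for t r
  proof -
    have "(T - t) * r \<le> (T - t) * 1" using that by (intro mult_left_mono) auto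
    moreover have "0 \<le> (T - t) * r" using that by simp
    ultimately show ?thesis using that by auto
  qed
  have H: "H n w (fst z) (snd z) = (T - fst z) *\<^sub>R integral (cbox 0 1) (\<lambda>r. running n w (fst z) (snd z) (fst z + (T - fst z) * r))
      + final n w (fst z) (snd z)" if "z \<in> {0..T} \<times> UNIV" for z
  proof -
    have "integral {fst z..T} (running n w (fst z) (snd z))
        = (T - fst z) *\<^sub>R integral {0..1} (\<lambda>r. running n w (fst z) (snd z) (fst z + (T - fst z) * r))"
      by (rule integral_rescale_unit, rule continuous_on_running_path[OF w]) (use that in auto)
    then show ?thesis by (simp add: H_def)
  qed
  have "continuous_on ({0..T} \<times> UNIV) (\<lambda>z. (T - fst z) *\<^sub>R integral (cbox 0 1) (\<lambda>r. running n w (fst z) (snd z) (fst z + (T - fst z) * r))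
      + final n w (fst z) (snd z))"
  proof (intro continuous_intros integral_continuous_on_param)
    have "continuous_on (({0..T} \<times> UNIV) \<times> cbox 0 1)
        (\<lambda>z. running n w (fst (fst z)) (snd (fst z)) (fst (fst z) + (T - fst (fst z)) * snd z))"
      by (rule continuous_on_running[OF w]) (use in_T in \<open>auto intro!: continuous_intros\<close>)
    then show "continuous_on (({0..T} \<times> UNIV) \<times> cbox 0 1)
        (\<lambda>(z, r). running n w (fst z) (snd z) (fst z + (T - fst z) * r))" by (simp add: case_prod_unfold)
    show "continuous_on ({0..T} \<times> UNIV) (\<lambda>z. final n w (fst z) (snd z))"
      unfolding final_def
      by (intro continuous_intros continuous_on_Q continuous_on_flow[OF w]) (use T_pos in auto)
  qed
  then have "continuous_on ({0..T} \<times> UNIV) (\<lambda>z. H n w (fst z) (snd z))"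
    by (rule continuous_on_cong[THEN iffD1, OF refl, rotated]) (rule H[symmetric])
  then show ?thesis by (simp add: case_prod_unfold)
qed

lemma flow_deriv: "((\<lambda>y. flow w t y r) has_vector_derivative exp (b * (r - t))) (at y)"
  unfolding flow_def has_real_derivative_iff_has_vector_derivative[symmetric]
  by (auto intro!: derivative_eq_intros)

lemma H_deriv:
  assumes w: "continuous_on {0..T} w" and t: "t \<in> {0..T}"
  shows "(H n w t has_vector_derivative H (Suc n) w t y) (at y)"
proof -
  have e: "exp (real n * b * (r - t)) *\<^sub>R exp (b * (r - t)) *\<^sub>R z = exp (real (Suc n) * b * (r - t)) *\<^sub>R z" for r and z :: complex
    by (simp add: exp_add[symmetric] algebra_simps)
  have R: "((\<lambda>y. running n w t y r) has_vector_derivative running (Suc n) w t y r) (at y)" if "r \<in> {t..T}" for r y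
  proof -
    have "((U n r \<circ> (\<lambda>y. flow w t y r)) has_vector_derivative exp (b * (r - t)) *\<^sub>R U (Suc n) r (flow w t y r)) (at y)"
      by (rule vector_diff_chain_at[OF flow_deriv U_deriv]) (use that t in auto)
    from bounded_linear.has_vector_derivative[OF bounded_linear_scaleR_right this, of "exp (real n * b * (r - t))"]
    show ?thesis unfolding e running_def o_def .
  qed
  have "((\<lambda>y. integral (cbox t T) (running n w t y)) has_vector_derivative integral (cbox t T) (running (Suc n) w t y)) (at y within UNIV)"
  proof (rule leibniz_rule_vector_derivative)
    show "running n w t y integrable_on cbox t T" for y
      using continuous_on_running_path[OF w, of t t T n y] t by (auto intro: integrable_continuous_interval)
    have "continuous_on (UNIV \<times> cbox t T) (\<lambda>z. running (Suc n) w t (fst z) (snd z))"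
      by (rule continuous_on_running[OF w]) (use t in \<open>auto intro!: continuous_intros\<close>)
    then show "continuous_on (UNIV \<times> cbox t T) (\<lambda>(y, r). running (Suc n) w t y r)" by (simp add: case_prod_unfold)
  qed (use R in auto)
  moreover have "(final n w t has_vector_derivative final (Suc n) w t y) (at y)"
  proof -
    have "((Q n \<circ> (\<lambda>y. flow w t y T)) has_vector_derivative exp (b * (T - t)) *\<^sub>R Q (Suc n) (flow w t y T)) (at y)"
      by (rule vector_diff_chain_at[OF flow_deriv Q_deriv])
    from bounded_linear.has_vector_derivative[OF bounded_linear_scaleR_right this, of "exp (real n * b * (T - t))"]
    show ?thesis unfolding e final_def[abs_def] o_def .
  qed
  ultimately have "((\<lambda>y. integral (cbox t T) (running n w t y) + final n w t y) has_vector_derivative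
      integral (cbox t T) (running (Suc n) w t y) + final (Suc n) w t y) (at y)"
    by (intro has_vector_derivative_add) auto
  then show ?thesis by (simp add: H_def[abs_def])
qed

lemma continuous_on_F:
  assumes w: "continuous_on {0..T} w"
  shows "continuous_on ({0..T} \<times> UNIV) (\<lambda>(t, y). F n w t y)"
proof (induction n rule: less_induct)
  case (less n)
  note H = continuous_on_H[OF w, unfolded case_prod_unfold]
  show ?case
  proof (cases n)
    case 0 then show ?thesis using H by (auto simp: case_prod_unfold intro!: continuous_intros)
  next
    case (Suc m)
    have "continuous_on ({0..T} \<times> UNIV) (\<lambda>z. F (m - k) w (fst z) (snd z))" for k
      using less[of "m - k"] Suc by (simp add: case_prod_unfold)
    then show ?thesis using H unfolding Suc F.simps case_prod_unfold by (intro continuous_intros)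
  qed
qed

text \<open>Strong induction, because the recursion for \<open>F\<close> refers to all lower
  orders.\<close>

lemma F_deriv:
  assumes w: "continuous_on {0..T} w" and t: "t \<in> {0..T}"
  shows "(F n w t has_vector_derivative F (Suc n) w t y) (at y)"
proof (induction n arbitrary: y rule: less_induct)
  case (less n)
  show ?case
  proof (cases n)
    case 0
    have "((exp \<circ> H 0 w t) has_vector_derivative H 1 w t y * exp (H 0 w t y)) (at y)"
      by (rule field_vector_diff_chain_at) (use H_deriv[OF w t, of 0 y] in \<open>auto intro: DERIV_exp\<close>)
    then show ?thesis using 0 by (simp add: o_def mult.commute)
  next
    case (Suc m)
    let ?H = "\<lambda>k. H k w t y" and ?F = "\<lambda>k. F k w t y"
    have "((\<lambda>y. \<Sum>k\<le>m. of_nat (m choose k) * (F (m - k) w t y * H (Suc k) w t y)) has_vector_derivative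
       (\<Sum>k\<le>m. of_nat (m choose k) * (?F (m - k) * ?H (Suc (Suc k)) + ?F (Suc (m - k)) * ?H (Suc k)))) (at y)"
    proof (intro has_vector_derivative_sum has_vector_derivative_mult_right has_vector_derivative_mult H_deriv w t)
      fix k show "(F (m - k) w t has_vector_derivative ?F (Suc (m - k))) (at y)" using less[of "m - k"] Suc by simp
    qed
    moreover have "(\<Sum>k\<le>m. of_nat (m choose k) * (?F (m - k) * ?H (Suc (Suc k)) + ?F (Suc (m - k)) * ?H (Suc k)))
       = (\<Sum>k\<le>Suc m. of_nat (Suc m choose k) * (?F (Suc m - k) * ?H (Suc k)))"
    proof -
      \<comment> \<open>The products of the next order; the product rule yields
        \<open>x (Suc k) + x k\<close>, and Pascal's rule collects these into the coefficients of
        order \<open>Suc m\<close>.\<close>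
      define x where "x k = ?F (Suc m - k) * ?H (Suc k)" for k
      have x: "?F (m - k) * ?H (Suc (Suc k)) = x (Suc k)" "k \<le> m \<Longrightarrow> ?F (Suc (m - k)) * ?H (Suc k) = x k" for k
        by (simp_all add: x_def Suc_diff_le del: F.simps)
      have "(\<Sum>k\<le>Suc m. of_nat (Suc m choose k) * x k) = x 0 + (\<Sum>k\<le>m. of_nat (Suc m choose Suc k) * x (Suc k))"
        by (subst sum.atMost_Suc_shift) simp
      also have "\<dots> = (\<Sum>k\<le>m. of_nat (m choose k) * x (Suc k)) + (x 0 + (\<Sum>k\<le>m. of_nat (m choose Suc k) * x (Suc k)))"
        by (simp add: sum.distrib distrib_right)
      also have "x 0 + (\<Sum>k\<le>m. of_nat (m choose Suc k) * x (Suc k)) = (\<Sum>k\<le>Suc m. of_nat (m choose k) * x k)"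
        by (subst sum.atMost_Suc_shift) simp
      also have "\<dots> = (\<Sum>k\<le>m. of_nat (m choose k) * x k)" by (simp add: binomial_eq_0)
      finally have *: "(\<Sum>k\<le>Suc m. of_nat (Suc m choose k) * x k) = (\<Sum>k\<le>m. of_nat (m choose k) * (x (Suc k) + x k))"
        by (simp add: sum.distrib distrib_left)
      have "(\<Sum>k\<le>m. of_nat (m choose k) * (?F (m - k) * ?H (Suc (Suc k)) + ?F (Suc (m - k)) * ?H (Suc k)))
          = (\<Sum>k\<le>m. of_nat (m choose k) * (x (Suc k) + x k))"
        by (intro sum.cong refl) (simp add: x del: F.simps)
      then show ?thesis using * by (simp only: x_def)
    qed
    ultimately show ?thesis unfolding Suc F.simps by simp
  qed
qed

section \<open>Growth bounds uniform in the path\<close>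

text \<open>The bound \<open>m\<close> is a separate argument so that constants can be chosen before
  the path.\<close>

definition admissible :: "(real \<Rightarrow> real) \<Rightarrow> real \<Rightarrow> real \<Rightarrow> real \<Rightarrow> bool" where
  "admissible w m t r \<longleftrightarrow>
     continuous_on {0..T} w \<and> (\<forall>r\<in>{0..T}. \<bar>w r\<bar> \<le> m) \<and> t \<in> {0..T} \<and> r \<in> {0..T}"

lemma flow_bound:
  "\<exists>K>0. \<forall>w m t y r. admissible w m t r \<longrightarrow>
     \<bar>flow w t y r\<bar> \<le> K * (\<bar>y\<bar> + m + 1)"
proof -
  define E where "E = exp (\<bar>b\<bar> * T)"
  have E: "E \<ge> 1" using T_pos by (simp add: E_def)
  have expE: "exp (b * x) \<le> E" if "\<bar>x\<bar> \<le> T" for x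
  proof -
    have "b * x \<le> \<bar>b\<bar> * \<bar>x\<bar>" by (metis abs_ge_self abs_mult)
    also have "\<dots> \<le> \<bar>b\<bar> * T" using that by (intro mult_left_mono) auto
    finally show ?thesis by (simp add: E_def)
  qed
  define L where "L = E * \<bar>c\<bar> + E * (\<bar>a\<bar> + \<bar>b * c\<bar>) * T"
  have L: "L \<ge> 0" using E T_pos by (simp add: L_def)
  \<comment> \<open>\<open>E\<close> bounds every exponential weight and \<open>L * (m + 1)\<close>
    bounds \<open>ou_primitive\<close>, which enters the flow twice.\<close>
  define K where "K = E + E * (2 * L)"
  have "\<bar>flow w t y r\<bar> \<le> K * (\<bar>y\<bar> + m + 1)"
    if w: "continuous_on {0..T} w" "\<forall>r\<in>{0..T}. \<bar>w r\<bar> \<le> m" and tr: "t \<in> {0..T}" "r \<in> {0..T}" for w m t y r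
  proof -
    have m: "m \<ge> 0" using w(2) tr by (metis abs_ge_zero order_trans)
    have A: "\<bar>ou_primitive a b c w r\<bar> \<le> L * (m + 1)" if r: "r \<in> {0..T}" for r
    proof -
      have "norm (integral {0..r} (\<lambda>u. exp (- b * u) * (a + b * c * w u))) \<le> (E * ((\<bar>a\<bar> + \<bar>b * c\<bar>) * (m + 1))) * (r - 0)"
      proof (rule integral_bound)
        show "continuous_on {0..r} (\<lambda>u. exp (- b * u) * (a + b * c * w u))"
          by (intro continuous_intros continuous_on_subset[OF w(1)]) (use r in auto)
        fix u assume u: "u \<in> {0..r}"
        have "\<bar>a + b * c * w u\<bar> \<le> \<bar>a\<bar> + \<bar>b * c\<bar> * m"
          using w(2) u r mult_left_mono[of "\<bar>w u\<bar>" m "\<bar>b * c\<bar>"] abs_triangle_ineq[of a "b * c * w u"]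
          by (auto simp: abs_mult)
        also have "\<dots> \<le> (\<bar>a\<bar> + \<bar>b * c\<bar>) * (m + 1)" using m by (simp add: algebra_simps)
        finally have "\<bar>a + b * c * w u\<bar> \<le> (\<bar>a\<bar> + \<bar>b * c\<bar>) * (m + 1)" .
        moreover have "exp (- b * u) \<le> E" using expE[of "- u"] u r by simp
        ultimately show "norm (exp (- b * u) * (a + b * c * w u)) \<le> E * ((\<bar>a\<bar> + \<bar>b * c\<bar>) * (m + 1))"
          using E by (auto simp: abs_mult intro!: mult_mono)
      qed (use r in auto)
      also have "\<dots> \<le> (E * ((\<bar>a\<bar> + \<bar>b * c\<bar>) * (m + 1))) * T" using r E m by (intro mult_left_mono) auto
      finally have 1: "\<bar>integral {0..r} (\<lambda>u. exp (- b * u) * (a + b * c * w u))\<bar> \<le> (E * (\<bar>a\<bar> + \<bar>b * c\<bar>) * T) * (m + 1)"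
        by (simp add: ac_simps)
      have "\<bar>exp (- b * r) * c * w r\<bar> = (exp (- b * r) * \<bar>c\<bar>) * \<bar>w r\<bar>" by (simp add: abs_mult)
      also have "\<dots> \<le> (E * \<bar>c\<bar>) * (m + 1)"
        using expE[of "- r"] order_trans[OF bspec[OF w(2) r], of "m + 1"] r E by (intro mult_mono) auto
      finally show ?thesis using 1 unfolding ou_primitive_def L_def by (simp add: distrib_right)
    qed
    have "\<bar>flow w t y r\<bar> \<le> exp (b * (r - t)) * \<bar>y\<bar> + exp (b * r) * (\<bar>ou_primitive a b c w r\<bar> + \<bar>ou_primitive a b c w t\<bar>)"
      unfolding flow_def
      by (rule order_trans[OF abs_triangle_ineq]) (auto simp: abs_mult intro!: mult_left_mono)
    also have "\<dots> \<le> E * \<bar>y\<bar> + E * (L * (m + 1) + L * (m + 1))"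
      using expE[of "r - t"] expE[of r] tr A[OF tr(1)] A[OF tr(2)] E L m
      by (intro add_mono mult_mono) auto
    also have "\<dots> \<le> K * (\<bar>y\<bar> + m + 1)"
    proof -
      have "E * \<bar>y\<bar> \<le> E * (\<bar>y\<bar> + m + 1)" using E m by (intro mult_left_mono) auto
      moreover have "E * (2 * L) * (m + 1) \<le> E * (2 * L) * (\<bar>y\<bar> + m + 1)" using E L by (intro mult_left_mono) auto
      ultimately show ?thesis by (simp add: K_def algebra_simps)
    qed
    finally show ?thesis .
  qed
  moreover have "K > 0" using E L by (simp add: K_def add_pos_nonneg)
  ultimately show ?thesis unfolding admissible_def by blast
qed

text \<open>This class is closed under products, and its members are dominated by an integrable function once
  \<open>exp (e * m\<^sup>2)\<close> is integrable for a single \<open>e > 0\<close>. The argument \<open>r\<close> only serves integrands in time.\<close>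

definition moderate :: "((real \<Rightarrow> real) \<Rightarrow> real \<Rightarrow> real \<Rightarrow> real \<Rightarrow> complex) \<Rightarrow> bool" where
  "moderate Y \<longleftrightarrow> (\<forall>e>0. \<exists>C\<ge>0. \<forall>w m t y r. admissible w m t r \<longrightarrow> norm (Y w t y r) \<le> C * exp (e * (y\<^sup>2 + m\<^sup>2)))"

lemma moderateE:
  assumes "moderate Y" "e > 0"
  obtains C where "C \<ge> 0" "\<And>w m t y r. admissible w m t r \<Longrightarrow> norm (Y w t y r) \<le> C * exp (e * (y\<^sup>2 + m\<^sup>2))"
  using assms unfolding moderate_def by meson

lemma moderateI:
  assumes "\<And>e. e > 0 \<Longrightarrow> \<exists>C\<ge>0. \<forall>w m t y r. admissible w m t r \<longrightarrow> norm (Y w t y r) \<le> C * exp (e * (y\<^sup>2 + m\<^sup>2))"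
  shows "moderate Y"
  using assms unfolding moderate_def by blast

lemma moderate_add:
  assumes "moderate Y" "moderate Z" shows "moderate (\<lambda>w t y r. Y w t y r + Z w t y r)"
proof (rule moderateI)
  fix e :: real assume e: "e > 0"
  obtain C where C: "C \<ge> 0" "\<And>w m t y r. admissible w m t r \<Longrightarrow> norm (Y w t y r) \<le> C * exp (e * (y\<^sup>2 + m\<^sup>2))"
    using moderateE[OF assms(1) e] by metis
  obtain D where D: "D \<ge> 0" "\<And>w m t y r. admissible w m t r \<Longrightarrow> norm (Z w t y r) \<le> D * exp (e * (y\<^sup>2 + m\<^sup>2))"
    using moderateE[OF assms(2) e] by metis
  show "\<exists>C\<ge>0. \<forall>w m t y r. admissible w m t r \<longrightarrow> norm (Y w t y r + Z w t y r) \<le> C * exp (e * (y\<^sup>2 + m\<^sup>2))"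
  proof (intro exI[of _ "C + D"] conjI allI impI)
    fix w :: "real \<Rightarrow> real" and m t y r :: real
    assume "admissible w m t r"
    then have "norm (Y w t y r) \<le> C * exp (e * (y\<^sup>2 + m\<^sup>2))" "norm (Z w t y r) \<le> D * exp (e * (y\<^sup>2 + m\<^sup>2))"
      using C(2) D(2) by blast+
    then show "norm (Y w t y r + Z w t y r) \<le> (C + D) * exp (e * (y\<^sup>2 + m\<^sup>2))"
      using norm_triangle_ineq[of "Y w t y r" "Z w t y r"] by (simp add: distrib_right)
  qed (use C D in auto)
qed

text \<open>Gaussian rates add under multiplication, so each factor is taken at rate
  \<open>e / 2\<close>; this is why the class demands every positive rate.\<close>

lemma moderate_mult:
  assumes "moderate Y" "moderate Z" shows "moderate (\<lambda>w t y r. Y w t y r * Z w t y r)"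
proof (rule moderateI)
  fix e :: real assume "e > 0"
  then have e: "e / 2 > 0" by simp
  obtain C where C: "C \<ge> 0" "\<And>w m t y r. admissible w m t r \<Longrightarrow> norm (Y w t y r) \<le> C * exp (e / 2 * (y\<^sup>2 + m\<^sup>2))"
    using moderateE[OF assms(1) e] by metis
  obtain D where D: "D \<ge> 0" "\<And>w m t y r. admissible w m t r \<Longrightarrow> norm (Z w t y r) \<le> D * exp (e / 2 * (y\<^sup>2 + m\<^sup>2))"
    using moderateE[OF assms(2) e] by metis
  show "\<exists>C\<ge>0. \<forall>w m t y r. admissible w m t r \<longrightarrow> norm (Y w t y r * Z w t y r) \<le> C * exp (e * (y\<^sup>2 + m\<^sup>2))"
  proof (intro exI[of _ "C * D"] conjI allI impI)
    fix w :: "real \<Rightarrow> real" and m t y r :: real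
    assume "admissible w m t r"
    then have "norm (Y w t y r) \<le> C * exp (e / 2 * (y\<^sup>2 + m\<^sup>2))" "norm (Z w t y r) \<le> D * exp (e / 2 * (y\<^sup>2 + m\<^sup>2))"
      using C(2) D(2) by blast+
    then have "norm (Y w t y r * Z w t y r) \<le> (C * exp (e / 2 * (y\<^sup>2 + m\<^sup>2))) * (D * exp (e / 2 * (y\<^sup>2 + m\<^sup>2)))"
      using C D unfolding norm_mult by (intro mult_mono) auto
    also have "\<dots> = C * D * (exp (e / 2 * (y\<^sup>2 + m\<^sup>2)) * exp (e / 2 * (y\<^sup>2 + m\<^sup>2)))" by simp
    also have "exp (e / 2 * (y\<^sup>2 + m\<^sup>2)) * exp (e / 2 * (y\<^sup>2 + m\<^sup>2)) = exp (e * (y\<^sup>2 + m\<^sup>2))"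
      by (simp add: exp_add[symmetric] field_simps)
    finally show "norm (Y w t y r * Z w t y r) \<le> C * D * exp (e * (y\<^sup>2 + m\<^sup>2))" .
  qed (use C D in auto)
qed

lemma moderate_bounded:
  assumes C: "C \<ge> 0" and bound: "\<And>w t y r. continuous_on {0..T} w \<Longrightarrow> t \<in> {0..T} \<Longrightarrow> r \<in> {0..T} \<Longrightarrow> norm (Y w t y r) \<le> C"
  shows "moderate Y"
proof (rule moderateI, intro exI[of _ C] conjI allI impI)
  fix e :: real and w :: "real \<Rightarrow> real" and m t y r :: real
  assume "e > 0" "admissible w m t r"
  then have "norm (Y w t y r) \<le> C * 1" using bound by (simp add: admissible_def)
  also have "\<dots> \<le> C * exp (e * (y\<^sup>2 + m\<^sup>2))" using C \<open>e > 0\<close> by (intro mult_left_mono) auto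
  finally show "norm (Y w t y r) \<le> C * exp (e * (y\<^sup>2 + m\<^sup>2))" .
qed (rule C)

lemma moderate_sum:
  assumes "finite I" "\<And>i. i \<in> I \<Longrightarrow> moderate (Y i)" shows "moderate (\<lambda>w t y r. \<Sum>i\<in>I. Y i w t y r)"
  using assms
proof (induction I rule: finite_induct)
  case empty show ?case by (rule moderate_bounded[of 0]) auto
next
  case (insert x I) then show ?case by (simp add: moderate_add)
qed

text \<open>The flow grows linearly in \<open>\<bar>y\<bar> + m + 1\<close>, so a small enough rate
  in the coefficient gives the rate \<open>e\<close> in the data. The map \<open>\<tau>\<close>
  covers both the running time and the fixed final time.\<close>

lemma moderate_compose_flow:
  assumes g: "\<And>e. e > 0 \<Longrightarrow> \<exists>C\<ge>0. \<forall>s\<in>{0..T}. \<forall>z. norm (g s z) \<le> C * exp (e * z\<^sup>2)"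
    and s: "\<And>r. r \<in> {0..T} \<Longrightarrow> \<tau> r \<in> {0..T}"
  shows "moderate (\<lambda>w t y r. g (\<tau> r) (flow w t y (\<tau> r)))"
proof (rule moderateI)
  fix e :: real assume e: "e > 0"
  obtain K where K: "K > 0" "\<And>w m t y r. admissible w m t r \<Longrightarrow> \<bar>flow w t y r\<bar> \<le> K * (\<bar>y\<bar> + m + 1)"
    using flow_bound by blast
  \<comment> \<open>The 3 comes from \<open>(\<bar>y\<bar> + m + 1)\<^sup>2 \<le> 3 * (y\<^sup>2 +
    m\<^sup>2 + 1)\<close>.\<close>
  define d where "d = e / (3 * K\<^sup>2)"
  have d: "d > 0" "d * (3 * K\<^sup>2) = e" using e K by (auto simp: d_def)
  obtain C where C: "C \<ge> 0" "\<And>s z. s \<in> {0..T} \<Longrightarrow> norm (g s z) \<le> C * exp (d * z\<^sup>2)" using g[OF d(1)] by blast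
  show "\<exists>C\<ge>0. \<forall>w m t y r. admissible w m t r \<longrightarrow> norm (g (\<tau> r) (flow w t y (\<tau> r))) \<le> C * exp (e * (y\<^sup>2 + m\<^sup>2))"
  proof (intro exI[of _ "C * exp e"] conjI allI impI)
    fix w :: "real \<Rightarrow> real" and m t y r :: real
    assume adm: "admissible w m t r"
    then have adm': "admissible w m t (\<tau> r)" and r: "r \<in> {0..T}" using s by (auto simp: admissible_def)
    let ?z = "flow w t y (\<tau> r)"
    have "?z\<^sup>2 = \<bar>?z\<bar>\<^sup>2" by simp
    also have "\<dots> \<le> (K * (\<bar>y\<bar> + m + 1))\<^sup>2" using K(2)[OF adm'] by (intro power_mono) auto
    also have "\<dots> = K\<^sup>2 * (\<bar>y\<bar> + m + 1)\<^sup>2" by (simp add: power_mult_distrib)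
    also have "(\<bar>y\<bar> + m + 1)\<^sup>2 \<le> 3 * (y\<^sup>2 + m\<^sup>2 + 1)"
    proof -
      have "3 * (y\<^sup>2 + m\<^sup>2 + 1) - (\<bar>y\<bar> + m + 1)\<^sup>2 = (\<bar>y\<bar> - m)\<^sup>2 + (\<bar>y\<bar> - 1)\<^sup>2 + (m - 1)\<^sup>2"
        using power2_abs[of y] by (simp add: power2_eq_square algebra_simps)
      then show ?thesis using zero_le_power2[of "\<bar>y\<bar> - m"] zero_le_power2[of "\<bar>y\<bar> - 1"] zero_le_power2[of "m - 1"] by linarith
    qed
    finally have "?z\<^sup>2 \<le> K\<^sup>2 * (3 * (y\<^sup>2 + m\<^sup>2 + 1))" by (simp add: mult_left_mono)
    then have "d * ?z\<^sup>2 \<le> d * (K\<^sup>2 * (3 * (y\<^sup>2 + m\<^sup>2 + 1)))" using d by (intro mult_left_mono) auto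
    also have "\<dots> = (d * (3 * K\<^sup>2)) * (y\<^sup>2 + m\<^sup>2 + 1)" by (simp add: ac_simps)
    finally have dz: "d * ?z\<^sup>2 \<le> e * (y\<^sup>2 + m\<^sup>2) + e" unfolding d(2) by (simp add: distrib_left)
    have "norm (g (\<tau> r) ?z) \<le> C * exp (d * ?z\<^sup>2)" by (rule C(2)[OF s[OF r]])
    also have "\<dots> \<le> C * exp (e * (y\<^sup>2 + m\<^sup>2) + e)" using dz C by (intro mult_left_mono) auto
    finally show "norm (g (\<tau> r) ?z) \<le> C * exp e * exp (e * (y\<^sup>2 + m\<^sup>2))" by (simp add: exp_add ac_simps)
  qed (use C in auto)
qed

lemma moderate_weight: "0 \<le> l \<Longrightarrow> moderate (\<lambda>w t y r. of_real (exp (l * b * (r - t))))"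
  and moderate_weight_end: "0 \<le> l \<Longrightarrow> moderate (\<lambda>w t y r. of_real (exp (l * b * (T - t))))"
proof -
  assume l: "0 \<le> l"
  have "norm (of_real (exp (l * b * (r - t))) :: complex) \<le> exp (l * \<bar>b\<bar> * T)" if "t \<in> {0..T}" "r \<in> {0..T}" for t r
  proof -
    have "l * b * (r - t) \<le> \<bar>l * b * (r - t)\<bar>" by simp
    also have "\<dots> = l * \<bar>b\<bar> * \<bar>r - t\<bar>" using l by (simp add: abs_mult)
    also have "\<dots> \<le> l * \<bar>b\<bar> * T" using that l by (intro mult_left_mono) auto
    finally show ?thesis by simp
  qed
  note * = this
  show "moderate (\<lambda>w t y r. of_real (exp (l * b * (r - t))))"
    by (rule moderate_bounded[of "exp (l * \<bar>b\<bar> * T)"]) (use * in auto)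
  show "moderate (\<lambda>w t y r. of_real (exp (l * b * (T - t))))"
    by (rule moderate_bounded[of "exp (l * \<bar>b\<bar> * T)"]) (use *[of _ T] T_pos in auto)
qed

lemma moderate_running: "moderate (running n)"
proof -
  have "moderate (\<lambda>w t y r. of_real (exp (real n * b * (r - t))) * U n r (flow w t y r))"
    by (intro moderate_mult moderate_weight moderate_compose_flow[where \<tau> = "\<lambda>r. r" and g = "U n"] U_growth) auto
  then show ?thesis by (simp add: running_def[abs_def] scaleR_conv_of_real)
qed

lemma moderate_final: "moderate (\<lambda>w t y r. final n w t y)"
proof -
  have "moderate (\<lambda>w t y r. of_real (exp (real n * b * (T - t))) * Q n (flow w t y T))"
    by (intro moderate_mult moderate_weight_end moderate_compose_flow[where \<tau> = "\<lambda>r. T" and g = "\<lambda>_. Q n"])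
       (use Q_growth T_pos in \<open>simp; blast\<close>)+
  then show ?thesis by (simp add: final_def[abs_def] scaleR_conv_of_real)
qed

lemma moderate_H: "moderate (\<lambda>w t y r. H n w t y)"
  unfolding H_def
proof (intro moderate_add moderate_final)
  show "moderate (\<lambda>w t y r. integral {t..T} (running n w t y))"
  proof (rule moderateI)
    fix e :: real assume e: "e > 0"
    obtain C where C: "C \<ge> 0" "\<And>w m t y r. admissible w m t r \<Longrightarrow> norm (running n w t y r) \<le> C * exp (e * (y\<^sup>2 + m\<^sup>2))"
      using moderateE[OF moderate_running e] by metis
    show "\<exists>C\<ge>0. \<forall>w m t y r. admissible w m t r \<longrightarrow> norm (integral {t..T} (running n w t y)) \<le> C * exp (e * (y\<^sup>2 + m\<^sup>2))"
    proof (intro exI[of _ "C * T"] conjI allI impI)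
      fix w :: "real \<Rightarrow> real" and m t y r :: real
      assume "admissible w m t r"
      then have w: "continuous_on {0..T} w" and adm: "\<And>r. r \<in> {0..T} \<Longrightarrow> admissible w m t r" and t: "t \<in> {0..T}"
        by (auto simp: admissible_def)
      have "norm (integral {t..T} (running n w t y)) \<le> C * exp (e * (y\<^sup>2 + m\<^sup>2)) * (T - t)"
        by (rule integral_bound) (use t C(2)[OF adm] continuous_on_running_path[OF w] in auto)
      also have "\<dots> \<le> C * exp (e * (y\<^sup>2 + m\<^sup>2)) * T" using t C by (intro mult_left_mono) auto
      finally show "norm (integral {t..T} (running n w t y)) \<le> C * T * exp (e * (y\<^sup>2 + m\<^sup>2))" by (simp add: ac_simps)
    qed (use C T_pos in auto)
  qed
qed

lemma Re_integral_nonpos: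
  assumes w: "continuous_on {0..T} w" and t: "t \<in> {0..T}" and sr: "{s..r} \<subseteq> {0..T}"
  shows "Re (integral {s..r} (running 0 w t y)) \<le> 0"
proof -
  have i: "running 0 w t y integrable_on {s..r}"
    by (intro integrable_continuous_interval continuous_on_running_path[OF w]) (use t sr in auto)
  have "((\<lambda>r. Re (running 0 w t y r)) has_integral Re (integral {s..r} (running 0 w t y))) {s..r}"
    using has_integral_linear[OF integrable_integral[OF i] bounded_linear_Re] by (simp add: o_def)
  moreover have "((\<lambda>_. 0) has_integral 0) {s..r}" by (rule has_integral_0)
  ultimately show ?thesis
    by (rule has_integral_le) (use U_Re sr in \<open>auto simp: running_def\<close>)
qed

text \<open>The sign condition pays off here: a bound on the modulus of \<open>H\<close> alone would
  leave the exponential of a Gaussian.\<close>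

lemma norm_F0_le:
  assumes w: "continuous_on {0..T} w" and t: "t \<in> {0..T}"
  shows "norm (F 0 w t y) \<le> 1"
proof -
  have "Re (H 0 w t y) \<le> 0"
    using Re_integral_nonpos[OF w t, of t T y] t Q_Re[of "flow w t y T"] by (simp add: H_def final_def)
  then show ?thesis by simp
qed

text \<open>By the recursion each order is \<open>F 0\<close>, bounded by 1, times a polynomial in
  the moderate functions \<open>H\<close>.\<close>

lemma moderate_F: "moderate (\<lambda>w t y r. F n w t y)"
proof (induction n rule: less_induct)
  case (less n)
  show ?case
  proof (cases n)
    case 0 then show ?thesis using norm_F0_le by (intro moderate_bounded[of 1]) auto
  next
    case (Suc m)
    have *: "moderate (\<lambda>w t y r. F (m - k) w t y)" for k using less[of "m - k"] Suc by simp
    have "moderate (\<lambda>w t y r. \<Sum>k\<le>m. of_nat (m choose k) * (F (m - k) w t y * H (Suc k) w t y))"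
    proof (intro moderate_sum moderate_mult * moderate_H)
      fix k show "moderate (\<lambda>w t y r. of_nat (m choose k))"
        by (rule moderate_bounded[of "real (m choose k)"]) auto
    qed simp
    then show ?thesis by (simp add: Suc)
  qed
qed

lemma H0_split:
  assumes w: "continuous_on {0..T} w" and st: "0 \<le> s" "s \<le> t" "t \<le> T"
  shows "H 0 w s y = integral {s..t} (running 0 w s y) + H 0 w t (flow w s y t)"
proof -
  have "integral {s..T} (running 0 w s y) = integral {s..t} (running 0 w s y) + integral {t..T} (running 0 w s y)"
    by (rule Henstock_Kurzweil_Integration.integral_combine[symmetric])
       (use st in \<open>auto intro!: integrable_continuous_interval continuous_on_running_path[OF w]\<close>)
  moreover have "integral {t..T} (running 0 w s y) = integral {t..T} (running 0 w t (flow w s y t))"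
    by (rule integral_cong) (simp add: running_def flow_flow)
  ultimately show ?thesis by (simp add: H_def final_def flow_flow)
qed

end

section \<open>Differentiation under the expectation\<close>

text \<open>Dominated convergence speaks of sequences, so derivatives of expectations are reduced to
  difference quotients along sequences.\<close>

lemma has_vector_derivative_sequentiallyI:
  fixes f :: "real \<Rightarrow> 'b::real_normed_vector"
  assumes "\<And>X. (\<And>k. X k \<in> S) \<Longrightarrow> (\<And>k. X k \<noteq> x) \<Longrightarrow> X \<longlonglongrightarrow> x \<Longrightarrow>
     (\<lambda>k. (1 / (X k - x)) *\<^sub>R (f (X k) - f x)) \<longlonglongrightarrow> f'"
  shows "(f has_vector_derivative f') (at x within S)"
proof -
  have "((\<lambda>y. (1 / (y - x)) *\<^sub>R (f y - f x)) \<longlongrightarrow> f') (at x within S)"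
    unfolding tendsto_at_iff_sequentially o_def by (intro allI impI assms) simp_all
  then have "((\<lambda>y. (1 / (y - x)) *\<^sub>R (f y - f x) - f') \<longlongrightarrow> 0) (at x within S)"
    by (simp add: LIM_zero)
  then have "((\<lambda>y. norm ((1 / (y - x)) *\<^sub>R (f y - f x) - f')) \<longlongrightarrow> 0) (at x within S)"
    by (rule tendsto_norm_zero)
  moreover have "\<forall>\<^sub>F y in at x within S. norm ((1 / (y - x)) *\<^sub>R (f y - f x) - f')
     = norm ((1 / norm (y - x)) *\<^sub>R (f y - (f x + (y - x) *\<^sub>R f')))"
    unfolding eventually_at_filter
  proof (intro always_eventually allI impI)
    fix y assume y: "y \<noteq> x"
    have "(1 / (y - x)) *\<^sub>R (f y - f x) - f' = (1 / (y - x)) *\<^sub>R (f y - (f x + (y - x) *\<^sub>R f'))"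
      using y by (simp add: scaleR_diff_right scaleR_add_right)
    then show "norm ((1 / (y - x)) *\<^sub>R (f y - f x) - f') = norm ((1 / norm (y - x)) *\<^sub>R (f y - (f x + (y - x) *\<^sub>R f')))"
      by simp
  qed
  ultimately have "((\<lambda>y. norm ((1 / norm (y - x)) *\<^sub>R (f y - (f x + (y - x) *\<^sub>R f')))) \<longlongrightarrow> 0) (at x within S)"
    by (rule Lim_transform_eventually)
  then have "((\<lambda>y. (1 / norm (y - x)) *\<^sub>R (f y - (f x + (y - x) *\<^sub>R f'))) \<longlongrightarrow> 0) (at x within S)"
    by (rule tendsto_norm_zero_cancel)
  then show ?thesis
    unfolding has_vector_derivative_def has_derivative_within by (simp add: bounded_linear_scaleR_left)
qed

lemma has_vector_derivative_imp_quotients: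
  fixes f :: "real \<Rightarrow> 'b::real_normed_vector"
  assumes "(f has_vector_derivative f') (at x)" "\<And>k. X k \<noteq> x" "X \<longlonglongrightarrow> x"
  shows "(\<lambda>k. (1 / (X k - x)) *\<^sub>R (f (X k) - f x)) \<longlonglongrightarrow> f'"
proof -
  have "((\<lambda>y. (1 / norm (y - x)) *\<^sub>R (f y - (f x + (y - x) *\<^sub>R f'))) \<longlongrightarrow> 0) (at x)"
    using assms(1) unfolding has_vector_derivative_def has_derivative_within by simp
  then have "(\<lambda>k. (1 / norm (X k - x)) *\<^sub>R (f (X k) - (f x + (X k - x) *\<^sub>R f'))) \<longlonglongrightarrow> 0"
    using assms(2,3) unfolding tendsto_at_iff_sequentially o_def by simp
  then have "(\<lambda>k. norm ((1 / norm (X k - x)) *\<^sub>R (f (X k) - (f x + (X k - x) *\<^sub>R f')))) \<longlonglongrightarrow> 0"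
    by (rule tendsto_norm_zero)
  moreover have "norm ((1 / norm (X k - x)) *\<^sub>R (f (X k) - (f x + (X k - x) *\<^sub>R f')))
      = norm ((1 / (X k - x)) *\<^sub>R (f (X k) - f x) - f')" for k
  proof -
    have "(1 / (X k - x)) *\<^sub>R (f (X k) - f x) - f' = (1 / (X k - x)) *\<^sub>R (f (X k) - (f x + (X k - x) *\<^sub>R f'))"
      using assms(2)[of k] by (simp add: scaleR_diff_right scaleR_add_right)
    then show ?thesis by simp
  qed
  ultimately have "(\<lambda>k. norm ((1 / (X k - x)) *\<^sub>R (f (X k) - f x) - f')) \<longlonglongrightarrow> 0"
    by (simp only:)
  then show ?thesis by (rule LIM_zero_cancel[OF tendsto_norm_zero_cancel])
qed

text \<open>By the mean value inequality a bound on the derivative within distance 1 of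
  \<open>x\<close> dominates the difference quotients.\<close>

lemma has_vector_derivative_integral_dominated:
  fixes G G' :: "real \<Rightarrow> 'a \<Rightarrow> complex"
  assumes deriv: "\<And>\<omega> y. \<omega> \<in> space M \<Longrightarrow> ((\<lambda>y. G y \<omega>) has_vector_derivative G' y \<omega>) (at y)"
    and meas: "\<And>y. G y \<in> borel_measurable M" "\<And>y. G' y \<in> borel_measurable M"
    and int: "\<And>y. integrable M (G y)"
    and dom: "integrable M \<Phi>" "\<And>y \<omega>. \<omega> \<in> space M \<Longrightarrow> \<bar>y - x\<bar> \<le> 1 \<Longrightarrow> norm (G' y \<omega>) \<le> \<Phi> \<omega>"
  shows "((\<lambda>y. \<integral>\<omega>. G y \<omega> \<partial>M) has_vector_derivative (\<integral>\<omega>. G' x \<omega> \<partial>M)) (at x)"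
proof (rule has_vector_derivative_sequentiallyI)
  fix X :: "nat \<Rightarrow> real" assume X: "\<And>k. X k \<noteq> x" "X \<longlonglongrightarrow> x"
  \<comment> \<open>Finitely many terms may lie too far from \<open>x\<close>; they are moved to
    \<open>x + 1\<close>, so that the domination holds for every \<open>k\<close> while the limit is
    unchanged.\<close>
  define Y where "Y k = (if \<bar>X k - x\<bar> \<le> 1 then X k else x + 1)" for k
  have ev: "eventually (\<lambda>k. Y k = X k) sequentially"
    using tendstoD[OF X(2), of 1] by (auto simp: Y_def dist_real_def elim: eventually_mono)
  have Y: "Y k \<noteq> x" "\<bar>Y k - x\<bar> \<le> 1" for k using X(1) by (auto simp: Y_def)
  have Ylim: "Y \<longlonglongrightarrow> x" by (rule Lim_transform_eventually[OF X(2)]) (use ev in \<open>auto elim: eventually_mono\<close>)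
  have "(\<lambda>k. \<integral>\<omega>. (1 / (Y k - x)) *\<^sub>R (G (Y k) \<omega> - G x \<omega>) \<partial>M) \<longlonglongrightarrow> (\<integral>\<omega>. G' x \<omega> \<partial>M)"
  proof (rule integral_dominated_convergence[where w = \<Phi>])
    show "AE \<omega> in M. (\<lambda>k. (1 / (Y k - x)) *\<^sub>R (G (Y k) \<omega> - G x \<omega>)) \<longlonglongrightarrow> G' x \<omega>"
      by (intro AE_I2 has_vector_derivative_imp_quotients[OF deriv Y(1) Ylim])
    show "AE \<omega> in M. norm ((1 / (Y k - x)) *\<^sub>R (G (Y k) \<omega> - G x \<omega>)) \<le> \<Phi> \<omega>" for k
    proof (rule AE_I2)
      fix \<omega> assume \<omega>: "\<omega> \<in> space M"
      have "norm (G (Y k) \<omega> - G x \<omega>) \<le> \<Phi> \<omega> * norm (Y k - x)"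
      proof (rule differentiable_bound[where S = "cball x 1" and f' = "\<lambda>y h. h *\<^sub>R G' y \<omega>"])
        show "((\<lambda>y. G y \<omega>) has_derivative (\<lambda>h. h *\<^sub>R G' y \<omega>)) (at y within cball x 1)" for y
          using deriv[OF \<omega>, of y] unfolding has_vector_derivative_def by (rule has_derivative_at_withinI)
        fix y assume "y \<in> cball x 1"
        then have "norm (G' y \<omega>) \<le> \<Phi> \<omega>" using dom(2)[OF \<omega>] by (simp add: dist_real_def abs_minus_commute)
        then show "onorm (\<lambda>h. h *\<^sub>R G' y \<omega>) \<le> \<Phi> \<omega>"
          by (subst onorm_scaleR_left) (auto simp: onorm_id)
      qed (use Y(2) in \<open>auto simp: dist_real_def abs_minus_commute\<close>)
      then show "norm ((1 / (Y k - x)) *\<^sub>R (G (Y k) \<omega> - G x \<omega>)) \<le> \<Phi> \<omega>"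
        using Y(1)[of k] by (simp add: divide_le_eq mult.commute del: scaleR_diff_right)
    qed
    show "(\<lambda>\<omega>. (1 / (Y k - x)) *\<^sub>R (G (Y k) \<omega> - G x \<omega>)) \<in> borel_measurable M" for k
      using meas(1)[measurable] by measurable
  qed (use meas dom in auto)
  moreover have "(\<integral>\<omega>. (1 / (Y k - x)) *\<^sub>R (G (Y k) \<omega> - G x \<omega>) \<partial>M)
     = (1 / (Y k - x)) *\<^sub>R ((\<integral>\<omega>. G (Y k) \<omega> \<partial>M) - (\<integral>\<omega>. G x \<omega> \<partial>M))" for k
    using int by simp
  ultimately have "(\<lambda>k. (1 / (Y k - x)) *\<^sub>R ((\<integral>\<omega>. G (Y k) \<omega> \<partial>M) - (\<integral>\<omega>. G x \<omega> \<partial>M))) \<longlonglongrightarrow> (\<integral>\<omega>. G' x \<omega> \<partial>M)"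
    by (simp only:)
  then show "(\<lambda>k. (1 / (X k - x)) *\<^sub>R ((\<integral>\<omega>. G (X k) \<omega> \<partial>M) - (\<integral>\<omega>. G x \<omega> \<partial>M))) \<longlonglongrightarrow> (\<integral>\<omega>. G' x \<omega> \<partial>M)"
    by (rule Lim_transform_eventually) (use ev in \<open>auto elim: eventually_mono\<close>)
qed

section \<open>The expectation and its space derivatives\<close>

locale ou_model = brownian M W + ou_coefficients a b c T U Q
  for M :: "'a measure" and W a b c T U Q +
  fixes m :: "'a \<Rightarrow> real"
  assumes m_measurable [measurable]: "m \<in> borel_measurable M"
    and W_le_m: "\<omega> \<in> space M \<Longrightarrow> r \<in> {0..T} \<Longrightarrow> \<bar>W r \<omega>\<bar> \<le> m \<omega>"
    and integrable_gauss: "integrable M (\<lambda>\<omega>. exp ((m \<omega>)\<^sup>2 / (8 * T)))"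
begin

definition path :: "'a \<Rightarrow> real \<Rightarrow> real" where "path \<omega> r = W r \<omega>"

lemma path_continuous: "\<omega> \<in> space M \<Longrightarrow> continuous_on {0..T} (path \<omega>)"
  using W_continuous[of \<omega> T] by (simp add: path_def[abs_def])

lemma path_le_m: "\<omega> \<in> space M \<Longrightarrow> r \<in> {0..T} \<Longrightarrow> \<bar>path \<omega> r\<bar> \<le> m \<omega>"
  using W_le_m by (simp add: path_def)

lemma m_nonneg: "\<omega> \<in> space M \<Longrightarrow> 0 \<le> m \<omega>"
  using W_le_m[of \<omega> 0] T_pos by (auto intro: order_trans[OF abs_ge_zero])

lemma path_admissible:
  "\<omega> \<in> space M \<Longrightarrow> t \<in> {0..T} \<Longrightarrow> r \<in> {0..T} \<Longrightarrow> admissible (path \<omega>) (m \<omega>) t r"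
  unfolding admissible_def using path_continuous path_le_m by blast

lemma integrable_gauss_le:
  assumes "e \<le> 1 / (8 * T)" shows "integrable M (\<lambda>\<omega>. exp (e * (m \<omega>)\<^sup>2))"
proof (rule Bochner_Integration.integrable_bound[OF integrable_gauss])
  show "AE \<omega> in M. norm (exp (e * (m \<omega>)\<^sup>2)) \<le> norm (exp ((m \<omega>)\<^sup>2 / (8 * T)))"
    using mult_right_mono[OF assms, of "(m _)\<^sup>2"] by (intro AE_I2) simp
qed measurable

text \<open>The \<sigma>-algebra \<open>N\<close> is left open because both \<open>M\<close> and
  \<open>outside_algebra s t\<close> are needed. Through \<open>ou_primitive_diff\<close> the flow
  from \<open>t\<close> depends only on increments after \<open>t\<close>.\<close>

lemma flow_measurable:
  assumes N: "space N = space M" and t: "0 \<le> t" and r: "t \<le> r" "r \<le> T"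
    and meas: "\<And>r. r \<in> {t..T} \<Longrightarrow> (\<lambda>\<omega>. W r \<omega> - W t \<omega>) \<in> borel_measurable N"
  shows "(\<lambda>\<omega>. flow (path \<omega>) t y r) \<in> borel_measurable N"
proof -
  have [measurable]: "(\<lambda>\<omega>. W r \<omega> - W t \<omega>) \<in> borel_measurable N" using meas r by simp
  have "(\<lambda>\<omega>. integral {t..r} (\<lambda>u. exp (- b * u) * (a + b * c * (W u \<omega> - W t \<omega>)))) \<in> borel_measurable N"
  proof (rule borel_measurable_integral_continuous)
    fix u assume "u \<in> {t..r}"
    then have [measurable]: "(\<lambda>\<omega>. W u \<omega> - W t \<omega>) \<in> borel_measurable N" using meas r by simp
    show "(\<lambda>\<omega>. exp (- b * u) * (a + b * c * (W u \<omega> - W t \<omega>))) \<in> borel_measurable N" by measurable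
  next
    fix \<omega> assume "\<omega> \<in> space N"
    then show "continuous_on {t..r} (\<lambda>u. exp (- b * u) * (a + b * c * (W u \<omega> - W t \<omega>)))"
      unfolding N by (intro continuous_intros continuous_on_subset[OF W_continuous[of \<omega> T]]) (use t r in auto)
  qed
  then have "(\<lambda>\<omega>. exp (b * (r - t)) * y + exp (b * r) * (exp (- b * r) * c * (W r \<omega> - W t \<omega>)
      + integral {t..r} (\<lambda>u. exp (- b * u) * (a + b * c * (W u \<omega> - W t \<omega>))))) \<in> borel_measurable N"
    by measurable
  then show ?thesis
    by (rule measurable_cong[THEN iffD1, rotated])
       (simp add: N flow_def ou_primitive_diff[OF path_continuous t r] path_def)
qed

lemma integral_running_measurable:
  assumes N: "space N = space M" and t: "0 \<le> t" "s \<le> T"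
    and meas: "\<And>r. r \<in> {t..T} \<Longrightarrow> (\<lambda>\<omega>. W r \<omega> - W t \<omega>) \<in> borel_measurable N"
  shows "(\<lambda>\<omega>. integral {t..s} (running n (path \<omega>) t y)) \<in> borel_measurable N"
proof (rule borel_measurable_integral_continuous)
  fix r assume r: "r \<in> {t..s}"
  then have [measurable]: "(\<lambda>\<omega>. flow (path \<omega>) t y r) \<in> borel_measurable N"
    using flow_measurable[OF N _ _ _ meas] t by simp
  have [measurable]: "U n r \<in> borel_measurable borel"
    by (rule borel_measurable_continuous_onI, rule continuous_on_U)
       (use r t in \<open>auto intro!: continuous_intros\<close>)
  show "(\<lambda>\<omega>. running n (path \<omega>) t y r) \<in> borel_measurable N" unfolding running_def by measurable
next
  fix \<omega> assume "\<omega> \<in> space N"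
  then show "continuous_on {t..s} (running n (path \<omega>) t y)"
    using continuous_on_running_path[OF path_continuous, of \<omega> t t s n y] t N by (cases "t \<le> s") auto
qed

lemma H_measurable:
  assumes N: "space N = space M" and t: "t \<in> {0..T}"
    and meas: "\<And>r. r \<in> {t..T} \<Longrightarrow> (\<lambda>\<omega>. W r \<omega> - W t \<omega>) \<in> borel_measurable N"
  shows "(\<lambda>\<omega>. H n (path \<omega>) t y) \<in> borel_measurable N"
proof -
  have [measurable]: "Q n \<in> borel_measurable borel"
    by (rule borel_measurable_continuous_onI) (rule continuous_on_Q[OF continuous_on_id])
  have [measurable]: "(\<lambda>\<omega>. flow (path \<omega>) t y T) \<in> borel_measurable N"
    using flow_measurable[OF N _ _ _ meas] t by simp
  have [measurable]: "(\<lambda>\<omega>. integral {t..T} (running n (path \<omega>) t y)) \<in> borel_measurable N"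
    using integral_running_measurable[OF N _ _ meas, of T] t by simp
  show ?thesis unfolding H_def final_def by measurable
qed

lemma F_measurable:
  assumes N: "space N = space M" and t: "t \<in> {0..T}"
    and meas: "\<And>r. r \<in> {t..T} \<Longrightarrow> (\<lambda>\<omega>. W r \<omega> - W t \<omega>) \<in> borel_measurable N"
  shows "(\<lambda>\<omega>. F n (path \<omega>) t y) \<in> borel_measurable N"
proof (induction n rule: less_induct)
  case (less n)
  note [measurable] = H_measurable[OF assms]
  show ?case
  proof (cases n)
    case 0 then show ?thesis by simp
  next
    case (Suc k)
    have [measurable]: "(\<lambda>\<omega>. F (k - i) (path \<omega>) t y) \<in> borel_measurable N" for i using less[of "k - i"] Suc by simp
    show ?thesis unfolding Suc F.simps by measurable
  qed
qed

lemma F_measurable_M: "t \<in> {0..T} \<Longrightarrow> (\<lambda>\<omega>. F n (path \<omega>) t y) \<in> borel_measurable M"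
  by (rule F_measurable) auto

text \<open>The starting point is deterministic. The displaced point \<open>x + d\<close> depends on
  the increment over \<open>[s, t]\<close>, which is why an expansion around \<open>x\<close> is
  made before independence is used.\<close>

lemma F_measurable_outside:
  "0 \<le> s \<Longrightarrow> s < t \<Longrightarrow> t \<le> T \<Longrightarrow> (\<lambda>\<omega>. F n (path \<omega>) t y) \<in> borel_measurable (outside_algebra s t)"
  by (rule F_measurable) (auto intro: future_measurable)

lemma moderate_path_bound:
  assumes Y: "moderate Y" and e: "e > 0"
  obtains C where "C \<ge> 0" "\<And>\<omega> t y r. \<omega> \<in> space M \<Longrightarrow> t \<in> {0..T} \<Longrightarrow> r \<in> {0..T} \<Longrightarrow> \<bar>y\<bar> \<le> R \<Longrightarrow>
     norm (Y (path \<omega>) t y r) \<le> C * exp (e * (m \<omega>)\<^sup>2)"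
proof -
  obtain C where C: "C \<ge> 0" "\<And>w m t y r. admissible w m t r \<Longrightarrow> norm (Y w t y r) \<le> C * exp (e * (y\<^sup>2 + m\<^sup>2))"
    by (rule moderateE[OF Y e]) blast
  show ?thesis
  proof (rule that[of "C * exp (e * R\<^sup>2)"])
    fix \<omega> t y r assume \<omega>: "\<omega> \<in> space M" and t: "t \<in> {0..T}" and r: "r \<in> {0..T}" and y: "\<bar>y\<bar> \<le> R"
    have "norm (Y (path \<omega>) t y r) \<le> C * exp (e * (y\<^sup>2 + (m \<omega>)\<^sup>2))"
      using C(2) path_admissible[OF \<omega> t r] by blast
    also have "\<dots> \<le> C * exp (e * (R\<^sup>2 + (m \<omega>)\<^sup>2))"
    proof -
      have "y\<^sup>2 \<le> R\<^sup>2" using y by (simp add: abs_le_square_iff[symmetric])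
      then show ?thesis using C(1) e by (intro mult_left_mono) auto
    qed
    finally show "norm (Y (path \<omega>) t y r) \<le> C * exp (e * R\<^sup>2) * exp (e * (m \<omega>)\<^sup>2)"
      by (simp add: distrib_left exp_add)
  qed (use C in auto)
qed

lemma F_path_bound:
  assumes "e > 0"
  obtains C where "C \<ge> 0" "\<And>\<omega> t y. \<omega> \<in> space M \<Longrightarrow> t \<in> {0..T} \<Longrightarrow> \<bar>y\<bar> \<le> R \<Longrightarrow>
     norm (F n (path \<omega>) t y) \<le> C * exp (e * (m \<omega>)\<^sup>2)"
proof -
  obtain C where C: "C \<ge> 0" "\<And>\<omega> t y r. \<omega> \<in> space M \<Longrightarrow> t \<in> {0..T} \<Longrightarrow> r \<in> {0..T} \<Longrightarrow> \<bar>y\<bar> \<le> R \<Longrightarrow>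
     norm (F n (path \<omega>) t y) \<le> C * exp (e * (m \<omega>)\<^sup>2)"
    by (rule moderate_path_bound[OF moderate_F assms]) blast
  show ?thesis by (rule that[OF C(1)]) (use C(2)[of _ _ 0] T_pos in auto)
qed

lemma F_dominated:
  obtains \<Phi> where "integrable M \<Phi>" "\<And>\<omega> t y. \<omega> \<in> space M \<Longrightarrow> t \<in> {0..T} \<Longrightarrow> \<bar>y\<bar> \<le> R \<Longrightarrow>
     norm (F n (path \<omega>) t y) \<le> \<Phi> \<omega>"
proof -
  have e: "1 / (8 * T) > 0" using T_pos by simp
  obtain C where C: "C \<ge> 0" "\<And>\<omega> t y. \<omega> \<in> space M \<Longrightarrow> t \<in> {0..T} \<Longrightarrow> \<bar>y\<bar> \<le> R \<Longrightarrow>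
     norm (F n (path \<omega>) t y) \<le> C * exp (1 / (8 * T) * (m \<omega>)\<^sup>2)"
    by (rule F_path_bound[OF e]) blast
  show ?thesis
    by (rule that[of "\<lambda>\<omega>. C * exp (1 / (8 * T) * (m \<omega>)\<^sup>2)"])
       (use C integrable_gauss_le[of "1 / (8 * T)"] in auto)
qed

lemma F_integrable:
  assumes "t \<in> {0..T}" shows "integrable M (\<lambda>\<omega>. F n (path \<omega>) t y)"
proof -
  obtain \<Phi> where \<Phi>: "integrable M \<Phi>" "\<And>\<omega> t y'. \<omega> \<in> space M \<Longrightarrow> t \<in> {0..T} \<Longrightarrow> \<bar>y'\<bar> \<le> \<bar>y\<bar> \<Longrightarrow>
     norm (F n (path \<omega>) t y') \<le> \<Phi> \<omega>" by (rule F_dominated) blast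
  show ?thesis
    by (rule Bochner_Integration.integrable_bound[OF \<Phi>(1) F_measurable_M[OF assms]])
       (use \<Phi>(2)[OF _ assms, of _ y] in \<open>force intro!: AE_I2\<close>)
qed

definition D :: "nat \<Rightarrow> real \<Rightarrow> real \<Rightarrow> complex" where
  "D n t y = (\<integral>\<omega>. F n (path \<omega>) t y \<partial>M)"

lemma D_deriv:
  assumes t: "t \<in> {0..T}"
  shows "(D n t has_vector_derivative D (Suc n) t x) (at x)"
proof -
  obtain \<Phi> where \<Phi>: "integrable M \<Phi>" "\<And>\<omega> t y. \<omega> \<in> space M \<Longrightarrow> t \<in> {0..T} \<Longrightarrow> \<bar>y\<bar> \<le> \<bar>x\<bar> + 1 \<Longrightarrow>
     norm (F (Suc n) (path \<omega>) t y) \<le> \<Phi> \<omega>" by (rule F_dominated) blast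
  show ?thesis unfolding D_def[abs_def]
  proof (rule has_vector_derivative_integral_dominated[OF _ F_measurable_M[OF t] F_measurable_M[OF t] F_integrable[OF t] \<Phi>(1)])
    show "((\<lambda>y. F n (path \<omega>) t y) has_vector_derivative F (Suc n) (path \<omega>) t y) (at y)" if "\<omega> \<in> space M" for \<omega> y
      by (rule F_deriv[OF path_continuous[OF that] t])
  qed (use \<Phi>(2) t in auto)
qed

lemma F_path_tendsto:
  assumes \<omega>: "\<omega> \<in> space M" and t: "\<And>k. t k \<in> {0..T}" "t \<longlonglongrightarrow> t0" "t0 \<in> {0..T}" and y: "y \<longlonglongrightarrow> y0"
  shows "(\<lambda>k. F n (path \<omega>) (t k) (y k)) \<longlonglongrightarrow> F n (path \<omega>) t0 y0"
  using continuous_on_tendsto_compose[OF continuous_on_F[OF path_continuous[OF \<omega>], of n] tendsto_Pair[OF t(2) y]] t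
  by simp

lemma D_tendsto:
  assumes t: "\<And>k. t k \<in> {0..T}" "t \<longlonglongrightarrow> t0" "t0 \<in> {0..T}" and y: "y \<longlonglongrightarrow> y0"
  shows "(\<lambda>k. D n (t k) (y k)) \<longlonglongrightarrow> D n t0 y0"
proof -
  have "Bseq y" using y convergent_imp_Bseq convergentI by blast
  then obtain R where R: "\<And>k. \<bar>y k\<bar> \<le> R" by (auto simp: Bseq_def)
  obtain \<Phi> where \<Phi>: "integrable M \<Phi>" "\<And>\<omega> t y. \<omega> \<in> space M \<Longrightarrow> t \<in> {0..T} \<Longrightarrow> \<bar>y\<bar> \<le> R \<Longrightarrow>
     norm (F n (path \<omega>) t y) \<le> \<Phi> \<omega>" by (rule F_dominated) blast
  show ?thesis unfolding D_def
  proof (rule integral_dominated_convergence[where w = \<Phi>])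
    show "AE \<omega> in M. (\<lambda>k. F n (path \<omega>) (t k) (y k)) \<longlonglongrightarrow> F n (path \<omega>) t0 y0"
      by (intro AE_I2 F_path_tendsto t y)
    show "AE \<omega> in M. norm (F n (path \<omega>) (t k) (y k)) \<le> \<Phi> \<omega>" for k
      by (intro AE_I2 \<Phi>(2) t R)
  qed (intro F_measurable_M t \<Phi>)+
qed

lemma continuous_on_D: "continuous_on ({0..T} \<times> UNIV) (\<lambda>(t, y). D n t y)"
  unfolding continuous_on_sequentially
proof (intro ballI allI impI, elim conjE)
  fix z :: "real \<times> real" and x
  assume z: "z \<in> {0..T} \<times> UNIV" and x: "\<forall>k. x k \<in> {0..T} \<times> UNIV" "x \<longlonglongrightarrow> z"
  have "(\<lambda>k. D n (fst (x k)) (snd (x k))) \<longlonglongrightarrow> D n (fst z) (snd z)"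
    by (rule D_tendsto[OF _ tendsto_fst[OF x(2)] _ tendsto_snd[OF x(2)]]) (use z x(1) in \<open>auto simp: mem_Times_iff\<close>)
  then show "((\<lambda>(t, y). D n t y) \<circ> x) \<longlonglongrightarrow> (\<lambda>(t, y). D n t y) z" by (simp add: o_def case_prod_unfold)
qed

end

section \<open>The time derivative\<close>

text \<open>The left half-plane is convex and \<open>exp\<close>, its own derivative, has modulus at
  most 1 there.\<close>

lemma norm_exp_minus_one_le:
  fixes z :: complex assumes "Re z \<le> 0" shows "norm (exp z - 1) \<le> norm z"
proof -
  have "norm (exp z - exp 0) \<le> 1 * norm (z - 0)"
  proof (rule field_differentiable_bound[where S = "{z. Re z \<le> 0}" and f' = exp])
    show "convex {z. Re z \<le> 0}" by (rule convex_halfspace_Re_le)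
  qed (use assms in \<open>auto intro!: DERIV_exp[THEN has_field_derivative_at_within]\<close>)
  then show ?thesis by simp
qed

text \<open>The derivative \<open>exp y - 1\<close> of \<open>exp y - y\<close> is bounded by
  \<open>norm z\<close> on the half-disc of radius \<open>norm z\<close>.\<close>

lemma norm_exp_minus_one_minus_le:
  fixes z :: complex assumes "Re z \<le> 0" shows "norm (exp z - 1 - z) \<le> (norm z)\<^sup>2"
proof -
  have "norm ((exp z - z) - (exp 0 - 0)) \<le> norm z * norm (z - 0)"
  proof (rule field_differentiable_bound[where S = "{z. Re z \<le> 0} \<inter> cball 0 (norm z)" and f' = "\<lambda>z. exp z - 1"])
    show "convex ({z. Re z \<le> 0} \<inter> cball 0 (norm z))" by (intro convex_Int convex_halfspace_Re_le convex_cball)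
    fix y assume y: "y \<in> {z. Re z \<le> 0} \<inter> cball 0 (norm z)"
    show "((\<lambda>z. exp z - z) has_field_derivative exp y - 1) (at y within {z. Re z \<le> 0} \<inter> cball 0 (norm z))"
      by (auto intro!: derivative_eq_intros)
    show "norm (exp y - 1) \<le> norm z" using y norm_exp_minus_one_le[of y] by auto
  qed (use assms in auto)
  then show ?thesis by (simp add: power2_eq_square algebra_simps)
qed

lemma polynomial_le_gaussian:
  fixes e :: real assumes "e > 0"
  shows "\<exists>C\<ge>0. \<forall>x\<ge>0. (1 + x) ^ j \<le> C * exp (e * x\<^sup>2)"
  using assms
proof (induction j arbitrary: e)
  case 0 then show ?case by (intro exI[of _ 1]) auto
next
  case (Suc j)
  obtain C where C: "C \<ge> 0" "\<And>x. x \<ge> 0 \<Longrightarrow> (1 + x) ^ j \<le> C * exp (e / 2 * x\<^sup>2)"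
    using Suc.IH[of "e / 2"] Suc.prems by auto
  \<comment> \<open>From \<open>x \<le> 1 + x\<^sup>2\<close> and
    \<open>e / 2 * x\<^sup>2 \<le> exp (e / 2 * x\<^sup>2)\<close>.\<close>
  define B where "B = 2 + 2 / e"
  have B: "B \<ge> 0" using Suc.prems by (simp add: B_def)
  have one: "1 + x \<le> B * exp (e / 2 * x\<^sup>2)" for x
  proof -
    let ?E = "exp (e / 2 * x\<^sup>2)"
    have "1 \<le> ?E" using Suc.prems by simp
    have "x \<le> 1 + x\<^sup>2" using sum_squares_bound[of x 1] by (simp add: power2_eq_square) (smt (verit) zero_le_square)
    moreover have "e / 2 * x\<^sup>2 \<le> ?E" using exp_ge_add_one_self[of "e / 2 * x\<^sup>2"] by linarith
    then have "x\<^sup>2 \<le> 2 / e * ?E" using Suc.prems by (simp add: field_simps)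
    ultimately have "1 + x \<le> 2 + 2 / e * ?E" by linarith
    also have "\<dots> \<le> B * ?E" using \<open>1 \<le> ?E\<close> by (simp add: B_def distrib_right)
    finally show ?thesis .
  qed
  have "(1 + x) ^ Suc j \<le> (B * C) * exp (e * x\<^sup>2)" if "x \<ge> 0" for x
  proof -
    have "(1 + x) ^ Suc j \<le> (B * exp (e / 2 * x\<^sup>2)) * (C * exp (e / 2 * x\<^sup>2))"
      unfolding power_Suc using that B one C by (intro mult_mono) auto
    also have "\<dots> = (B * C) * (exp (e / 2 * x\<^sup>2) * exp (e / 2 * x\<^sup>2))" by simp
    also have "exp (e / 2 * x\<^sup>2) * exp (e / 2 * x\<^sup>2) = exp (e * x\<^sup>2)" by (simp add: exp_add[symmetric])
    finally show ?thesis .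
  qed
  then show ?case using B C by (intro exI[of _ "B * C"]) auto
qed

context ou_coefficients
begin

declare F.simps [simp del]

text \<open>Converse to \<open>ou_solution_explicit\<close>, by variation of constants. It splits
  the displacement over \<open>[s, t]\<close> into a noise part and a drift part proportional to the
  elapsed time.\<close>

lemma flow_solves:
  assumes w: "continuous_on {0..T} w" and st: "0 \<le> s" "s \<le> t" "t \<le> T"
  shows "flow w s x t = x + integral {s..t} (\<lambda>r. a + b * flow w s x r) + c * (w t - w s)"
proof -
  define J where "J r = integral {s..r} (\<lambda>u. exp (- b * u) * (a + b * c * (w u - w s)))" for r
  define \<phi> where "\<phi> r = exp (b * (r - s)) * x + exp (b * r) * J r" for r
  have ee: "exp (b * r) * exp (- b * r) = 1" for r by (simp add: exp_minus)
  have flow: "flow w s x r = \<phi> r + c * (w r - w s)" if "r \<in> {s..t}" for r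
  proof -
    have "exp (b * r) * (ou_primitive a b c w r - ou_primitive a b c w s)
        = (exp (b * r) * exp (- b * r)) * c * (w r - w s) + exp (b * r) * J r"
      using ou_primitive_diff[OF w st(1), of r a b c] that st by (simp only: J_def) (simp add: distrib_left mult.assoc)
    then show ?thesis unfolding ee by (simp add: flow_def \<phi>_def)
  qed
  have "((\<lambda>r. a + b * flow w s x r) has_integral \<phi> t - \<phi> s) {s..t}"
  proof (rule fundamental_theorem_of_calculus[OF st(2)])
    fix r assume r: "r \<in> {s..t}"
    have J: "(J has_real_derivative exp (- b * r) * (a + b * c * (w r - w s))) (at r within {s..t})"
      unfolding J_def
      by (rule integral_has_real_derivative)
         (use r st in \<open>auto intro!: continuous_intros continuous_on_subset[OF w]\<close>)
    have "(\<phi> has_real_derivative (exp (b * (r - s)) * b * x + (exp (b * r) * b * J r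
        + exp (- b * r) * (a + b * c * (w r - w s)) * exp (b * r)))) (at r within {s..t})"
      unfolding \<phi>_def by (auto intro!: derivative_eq_intros J)
    moreover have "exp (- b * r) * (a + b * c * (w r - w s)) * exp (b * r) = a + b * c * (w r - w s)"
      using ee[of r] by (simp add: ac_simps)
    moreover have "exp (b * (r - s)) * b * x + (exp (b * r) * b * J r + (a + b * c * (w r - w s))) = a + b * flow w s x r"
      unfolding flow[OF r] \<phi>_def by (simp add: algebra_simps)
    ultimately have "(\<phi> has_real_derivative a + b * flow w s x r) (at r within {s..t})"
      by (simp only:)
    then show "(\<phi> has_vector_derivative a + b * flow w s x r) (at r within {s..t})"
      by (simp add: has_real_derivative_iff_has_vector_derivative)
  qed
  moreover have "\<phi> s = x" by (simp add: \<phi>_def J_def)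
  ultimately show ?thesis using flow[of t] st by (simp add: integral_unique)
qed

end

section \<open>Decomposition over a short time interval\<close>

context ou_model
begin

definition incr :: "real \<Rightarrow> real \<Rightarrow> 'a \<Rightarrow> real" where
  "incr s t \<omega> = W t \<omega> - W s \<omega>"

text \<open>A time average, so that it has a limit as the interval shrinks.\<close>

definition drift :: "real \<Rightarrow> real \<Rightarrow> real \<Rightarrow> 'a \<Rightarrow> real" where
  "drift x s t \<omega> = (1 / (t - s)) * integral {s..t} (\<lambda>r. a + b * flow (path \<omega>) s x r)"

definition kill :: "real \<Rightarrow> real \<Rightarrow> real \<Rightarrow> 'a \<Rightarrow> complex" where
  "kill x s t \<omega> = integral {s..t} (running 0 (path \<omega>) s x)"

text \<open>Collects, divided by \<open>t - s\<close>, the killing term, the drift part of the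
  first-order term, and from \<open>d\<^sup>2 / 2\<close> the mixed term and the squared drift. The
  pure noise terms are left out since independence handles them.\<close>

definition bulk :: "real \<Rightarrow> real \<Rightarrow> real \<Rightarrow> 'a \<Rightarrow> complex" where
  "bulk x s t \<omega> = (1 / (t - s)) *\<^sub>R ((exp (kill x s t \<omega>) - 1) * F 0 (path \<omega>) t (flow (path \<omega>) s x t))
     + drift x s t \<omega> *\<^sub>R F 1 (path \<omega>) t x
     + (c * incr s t \<omega> * drift x s t \<omega>) *\<^sub>R F 2 (path \<omega>) t x
     + ((t - s) / 2 * (drift x s t \<omega>)\<^sup>2) *\<^sub>R F 2 (path \<omega>) t x"

definition rest :: "real \<Rightarrow> real \<Rightarrow> real \<Rightarrow> 'a \<Rightarrow> complex" where
  "rest x s t \<omega> = (let d = flow (path \<omega>) s x t - x in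
     F 0 (path \<omega>) t (x + d) - F 0 (path \<omega>) t x - d *\<^sub>R F 1 (path \<omega>) t x - (d\<^sup>2 / 2) *\<^sub>R F 2 (path \<omega>) t x)"

lemma flow_displacement:
  assumes "\<omega> \<in> space M" "0 \<le> s" "s < t" "t \<le> T"
  shows "flow (path \<omega>) s x t - x = c * incr s t \<omega> + (t - s) * drift x s t \<omega>"
  using flow_solves[OF path_continuous[OF assms(1)], of s t x] assms
  by (simp add: drift_def incr_def path_def)

lemma F0_flow:
  assumes "\<omega> \<in> space M" "0 \<le> s" "s \<le> t" "t \<le> T"
  shows "F 0 (path \<omega>) s x = exp (kill x s t \<omega>) * F 0 (path \<omega>) t (flow (path \<omega>) s x t)"
  using H0_split[OF path_continuous[OF assms(1)] assms(2-4), of x] by (simp add: F.simps kill_def exp_add)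

lemma increment_decomposition:
  assumes "\<omega> \<in> space M" "0 \<le> s" "s < t" "t \<le> T"
  shows "F 0 (path \<omega>) s x - F 0 (path \<omega>) t x
    = (c * incr s t \<omega>) *\<^sub>R F 1 (path \<omega>) t x + (c\<^sup>2 / 2 * (incr s t \<omega>)\<^sup>2) *\<^sub>R F 2 (path \<omega>) t x
      + (t - s) *\<^sub>R bulk x s t \<omega> + rest x s t \<omega>"
proof -
  define h where "h = t - s"
  have h: "h \<noteq> 0" using assms by (simp add: h_def)
  define d i w where "d = flow (path \<omega>) s x t - x" and "i = drift x s t \<omega>" and "w = incr s t \<omega>"
  have d: "d = c * w + h * i" using flow_displacement[OF assms] by (simp add: d_def h_def i_def w_def)
  have flow: "flow (path \<omega>) s x t = x + d" by (simp add: d_def)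
  have F0: "F 0 (path \<omega>) s x = exp (kill x s t \<omega>) * F 0 (path \<omega>) t (x + d)"
    using F0_flow[of \<omega> s t x] assms by (simp add: flow)
  \<comment> \<open>Substituting \<open>d = c * w + h * i\<close> splits the Taylor polynomial into
    pure noise \<open>P\<close> and terms \<open>Y\<close> carrying a factor
    \<open>h\<close>.\<close>
  define Y where "Y = h *\<^sub>R (i *\<^sub>R F 1 (path \<omega>) t x + (c * w * i) *\<^sub>R F 2 (path \<omega>) t x + (h / 2 * i\<^sup>2) *\<^sub>R F 2 (path \<omega>) t x)"
  define P where "P = (c * w) *\<^sub>R F 1 (path \<omega>) t x + (c\<^sup>2 / 2 * w\<^sup>2) *\<^sub>R F 2 (path \<omega>) t x"
  define A where "A = F 0 (path \<omega>) t (x + d)"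
  have "d *\<^sub>R F 1 (path \<omega>) t x + (d\<^sup>2 / 2) *\<^sub>R F 2 (path \<omega>) t x = P + Y"
    unfolding d P_def Y_def by (simp add: scaleR_conv_of_real power2_eq_square field_simps)
  moreover have "h *\<^sub>R bulk x s t \<omega> = (exp (kill x s t \<omega>) - 1) * A + Y"
    using h by (simp add: bulk_def A_def Y_def h_def[symmetric] i_def w_def flow scaleR_add_right)
  moreover have "rest x s t \<omega> = A - F 0 (path \<omega>) t x
       - (d *\<^sub>R F 1 (path \<omega>) t x + (d\<^sup>2 / 2) *\<^sub>R F 2 (path \<omega>) t x)"
    by (simp add: rest_def A_def d_def[symmetric] Let_def)
  ultimately show ?thesis
    unfolding F0 h_def[symmetric] w_def[symmetric] P_def[symmetric] A_def[symmetric] by (simp add: left_diff_distrib)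
qed

lemma drift_bound:
  obtains K where "K \<ge> 0" "\<And>\<omega> s t. \<omega> \<in> space M \<Longrightarrow> 0 \<le> s \<Longrightarrow> s < t \<Longrightarrow> t \<le> T \<Longrightarrow> \<bar>drift x s t \<omega>\<bar> \<le> K * (1 + m \<omega>)"
    "\<And>\<omega> s t. \<omega> \<in> space M \<Longrightarrow> 0 \<le> s \<Longrightarrow> s < t \<Longrightarrow> t \<le> T \<Longrightarrow> \<bar>x\<bar> + \<bar>flow (path \<omega>) s x t - x\<bar> \<le> K * (1 + m \<omega>)"
proof -
  obtain K where K: "K > 0" "\<And>w m t y r. admissible w m t r \<Longrightarrow> \<bar>flow w t y r\<bar> \<le> K * (\<bar>y\<bar> + m + 1)"
    using flow_bound by blast
  define L where "L = K * (\<bar>x\<bar> + 1)"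
  have L: "L \<ge> 0" using K by (simp add: L_def)
  have flow: "\<bar>flow (path \<omega>) s x r\<bar> \<le> L * (1 + m \<omega>)" if "\<omega> \<in> space M" "s \<in> {0..T}" "r \<in> {0..T}" for \<omega> s r
  proof -
    have "\<bar>flow (path \<omega>) s x r\<bar> \<le> K * (\<bar>x\<bar> + m \<omega> + 1)"
      using K(2) path_admissible[OF that] by blast
    also have "\<bar>x\<bar> + m \<omega> + 1 \<le> (\<bar>x\<bar> + 1) * (1 + m \<omega>)" using m_nonneg[OF that(1)] by (simp add: algebra_simps)
    finally show ?thesis using K(1) by (simp add: L_def mult.assoc)
  qed
  show ?thesis
  proof (rule that[of "\<bar>a\<bar> + \<bar>b\<bar> * L + 2 * \<bar>x\<bar> + L"])
    fix \<omega> s t assume \<omega>: "\<omega> \<in> space M" and st: "0 \<le> s" "s < t" "t \<le> T"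
    have m: "m \<omega> \<ge> 0" by (rule m_nonneg[OF \<omega>])
    have "norm (integral {s..t} (\<lambda>r. a + b * flow (path \<omega>) s x r)) \<le> ((\<bar>a\<bar> + \<bar>b\<bar> * L) * (1 + m \<omega>)) * (t - s)"
    proof (rule integral_bound)
      show "continuous_on {s..t} (\<lambda>r. a + b * flow (path \<omega>) s x r)"
        by (intro continuous_intros continuous_on_flow[OF path_continuous[OF \<omega>]]) (use st in auto)
      fix r assume r: "r \<in> {s..t}"
      have "\<bar>a + b * flow (path \<omega>) s x r\<bar> \<le> \<bar>a\<bar> + \<bar>b\<bar> * \<bar>flow (path \<omega>) s x r\<bar>"
        using abs_triangle_ineq[of a "b * flow (path \<omega>) s x r"] by (simp add: abs_mult)
      also have "\<dots> \<le> \<bar>a\<bar> * (1 + m \<omega>) + \<bar>b\<bar> * (L * (1 + m \<omega>))"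
        using flow[OF \<omega>, of s r] r st m mult_left_mono[of 1 "1 + m \<omega>" "\<bar>a\<bar>"] by (intro add_mono mult_left_mono) auto
      finally show "norm (a + b * flow (path \<omega>) s x r) \<le> (\<bar>a\<bar> + \<bar>b\<bar> * L) * (1 + m \<omega>)"
        by (simp add: distrib_right mult.assoc)
    qed (use st in auto)
    then have "\<bar>drift x s t \<omega>\<bar> \<le> (\<bar>a\<bar> + \<bar>b\<bar> * L) * (1 + m \<omega>)"
      using st by (simp add: drift_def abs_mult divide_le_eq)
    also have "\<dots> \<le> (\<bar>a\<bar> + \<bar>b\<bar> * L + 2 * \<bar>x\<bar> + L) * (1 + m \<omega>)" using L m by (intro mult_right_mono) auto
    finally show "\<bar>drift x s t \<omega>\<bar> \<le> (\<bar>a\<bar> + \<bar>b\<bar> * L + 2 * \<bar>x\<bar> + L) * (1 + m \<omega>)" .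
    have "\<bar>x\<bar> + \<bar>flow (path \<omega>) s x t - x\<bar> \<le> 2 * \<bar>x\<bar> * 1 + \<bar>flow (path \<omega>) s x t\<bar>" by simp
    also have "\<dots> \<le> 2 * \<bar>x\<bar> * (1 + m \<omega>) + L * (1 + m \<omega>)"
      using flow[OF \<omega>, of s t] st m by (intro add_mono mult_left_mono) auto
    also have "\<dots> = (2 * \<bar>x\<bar> + L) * (1 + m \<omega>)" by (simp add: distrib_right)
    also have "\<dots> \<le> (\<bar>a\<bar> + \<bar>b\<bar> * L + 2 * \<bar>x\<bar> + L) * (1 + m \<omega>)" using L m by (intro mult_right_mono) auto
    finally show "\<bar>x\<bar> + \<bar>flow (path \<omega>) s x t - x\<bar> \<le> (\<bar>a\<bar> + \<bar>b\<bar> * L + 2 * \<bar>x\<bar> + L) * (1 + m \<omega>)" .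
  qed (use L in auto)
qed

lemma kill_Re: "\<omega> \<in> space M \<Longrightarrow> 0 \<le> s \<Longrightarrow> s \<le> t \<Longrightarrow> t \<le> T \<Longrightarrow> Re (kill x s t \<omega>) \<le> 0"
  unfolding kill_def by (rule Re_integral_nonpos[OF path_continuous]) auto

text \<open>One dominating variable for all subintervals. The division by \<open>t - s\<close> is
  harmless because \<open>kill\<close> is itself an integral over \<open>[s, t]\<close> and
  \<open>exp\<close> is 1-Lipschitz on the left half-plane.\<close>

lemma bulk_dominated:
  obtains \<Phi> where "integrable M \<Phi>"
    "\<And>\<omega> s t. \<omega> \<in> space M \<Longrightarrow> 0 \<le> s \<Longrightarrow> s < t \<Longrightarrow> t \<le> T \<Longrightarrow> norm (bulk x s t \<omega>) \<le> \<Phi> \<omega>"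
proof -
  \<comment> \<open>Half of the available rate \<open>1 / (8 * T)\<close> for the coefficients, the
    other half for the polynomial \<open>(1 + m)\<^sup>2\<close>.\<close>
  define e where "e = 1 / (16 * T)"
  have e: "e > 0" "2 * e \<le> 1 / (8 * T)" using T_pos by (auto simp: e_def)
  obtain K where K: "K \<ge> 0" "\<And>\<omega> s t. \<omega> \<in> space M \<Longrightarrow> 0 \<le> s \<Longrightarrow> s < t \<Longrightarrow> t \<le> T \<Longrightarrow> \<bar>drift x s t \<omega>\<bar> \<le> K * (1 + m \<omega>)"
    by (rule drift_bound) blast
  obtain C0 where C0: "C0 \<ge> 0" "\<And>\<omega> t y r. \<omega> \<in> space M \<Longrightarrow> t \<in> {0..T} \<Longrightarrow> r \<in> {0..T} \<Longrightarrow> \<bar>y\<bar> \<le> \<bar>x\<bar> \<Longrightarrow>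
     norm (running 0 (path \<omega>) t y r) \<le> C0 * exp (e * (m \<omega>)\<^sup>2)" by (rule moderate_path_bound[OF moderate_running e(1)]) blast
  obtain C1 where C1: "C1 \<ge> 0" "\<And>\<omega> t y. \<omega> \<in> space M \<Longrightarrow> t \<in> {0..T} \<Longrightarrow> \<bar>y\<bar> \<le> \<bar>x\<bar> \<Longrightarrow>
     norm (F 1 (path \<omega>) t y) \<le> C1 * exp (e * (m \<omega>)\<^sup>2)" by (rule F_path_bound[OF e(1)]) blast
  obtain C2 where C2: "C2 \<ge> 0" "\<And>\<omega> t y. \<omega> \<in> space M \<Longrightarrow> t \<in> {0..T} \<Longrightarrow> \<bar>y\<bar> \<le> \<bar>x\<bar> \<Longrightarrow>
     norm (F 2 (path \<omega>) t y) \<le> C2 * exp (e * (m \<omega>)\<^sup>2)" by (rule F_path_bound[OF e(1)]) blast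
  obtain B where B: "B \<ge> 0" "\<And>x. x \<ge> 0 \<Longrightarrow> (1 + x) ^ 2 \<le> B * exp (e * x\<^sup>2)"
    using polynomial_le_gaussian[OF e(1), of 2] by blast
  define G where "G = C0 + K * C1 + \<bar>c\<bar> * 2 * K * C2 + T / 2 * K\<^sup>2 * C2"
  show ?thesis
  proof (rule that[of "\<lambda>\<omega>. G * B * exp (2 * e * (m \<omega>)\<^sup>2)"])
    show "integrable M (\<lambda>\<omega>. G * B * exp (2 * e * (m \<omega>)\<^sup>2))"
      by (intro integrable_mult_right integrable_gauss_le e)
    fix \<omega> s t assume \<omega>: "\<omega> \<in> space M" and st: "0 \<le> s" "s < t" "t \<le> T"
    have m: "m \<omega> \<ge> 0" by (rule m_nonneg[OF \<omega>])
    define p q where "p = (1 + m \<omega>)\<^sup>2" and "q = exp (e * (m \<omega>)\<^sup>2)"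
    have p: "p \<ge> 1" "1 + m \<omega> \<le> p" using m by (auto simp: p_def power2_eq_square algebra_simps)
    have q: "q \<ge> 0" by (simp add: q_def)
    have dr: "\<bar>drift x s t \<omega>\<bar> \<le> K * (1 + m \<omega>)" by (rule K(2)[OF \<omega> st])
    have dr1: "\<bar>drift x s t \<omega>\<bar> \<le> K * p" using dr p K mult_left_mono[of "1 + m \<omega>" p K] by linarith
    have dr2: "(drift x s t \<omega>)\<^sup>2 \<le> K\<^sup>2 * p"
    proof -
      have "\<bar>drift x s t \<omega>\<bar>\<^sup>2 \<le> (K * (1 + m \<omega>))\<^sup>2" using dr by (intro power_mono) auto
      then show ?thesis by (simp add: p_def power_mult_distrib)
    qed
    have inc: "\<bar>incr s t \<omega>\<bar> \<le> 2 * (1 + m \<omega>)"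
      using W_le_m[OF \<omega>, of s] W_le_m[OF \<omega>, of t] st by (auto simp: incr_def)
    have incdr: "\<bar>incr s t \<omega> * drift x s t \<omega>\<bar> \<le> 2 * K * p"
    proof -
      have "\<bar>incr s t \<omega>\<bar> * \<bar>drift x s t \<omega>\<bar> \<le> (2 * (1 + m \<omega>)) * (K * (1 + m \<omega>))"
        using inc dr m by (intro mult_mono) auto
      then show ?thesis by (simp add: abs_mult p_def power2_eq_square ac_simps)
    qed
    have t: "t \<in> {0..T}" using st by auto
    have b1: "norm ((1 / (t - s)) *\<^sub>R ((exp (kill x s t \<omega>) - 1) * F 0 (path \<omega>) t (flow (path \<omega>) s x t))) \<le> C0 * p * q"
    proof -
      have "norm (kill x s t \<omega>) \<le> (C0 * q) * (t - s)"
        unfolding kill_def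
        by (rule integral_bound)
           (use st \<omega> C0(2)[OF \<omega>, of s _ x] in \<open>auto simp: q_def intro!: continuous_on_running_path[OF path_continuous]\<close>)
      with norm_exp_minus_one_le[OF kill_Re[OF \<omega>, of s t x]] st
      have 1: "norm (exp (kill x s t \<omega>) - 1) \<le> (C0 * q) * (t - s)" by linarith
      have "norm ((exp (kill x s t \<omega>) - 1) * F 0 (path \<omega>) t (flow (path \<omega>) s x t)) \<le> (C0 * q) * (t - s) * 1"
        unfolding norm_mult using 1 norm_F0_le[OF path_continuous[OF \<omega>] t] C0 q st by (intro mult_mono) auto
      then have "norm ((1 / (t - s)) *\<^sub>R ((exp (kill x s t \<omega>) - 1) * F 0 (path \<omega>) t (flow (path \<omega>) s x t))) \<le> C0 * q"
        using st by (simp add: divide_le_eq)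
      also have "\<dots> \<le> C0 * p * q" using p q C0 mult_right_mono[of 1 p "C0 * q"] by (simp add: ac_simps)
      finally show ?thesis .
    qed
    have F1: "norm (F 1 (path \<omega>) t x) \<le> C1 * q" and F2: "norm (F 2 (path \<omega>) t x) \<le> C2 * q"
      using C1(2)[OF \<omega> t, of x] C2(2)[OF \<omega> t, of x] by (auto simp: q_def)
    have b2: "norm (drift x s t \<omega> *\<^sub>R F 1 (path \<omega>) t x) \<le> (K * p) * (C1 * q)"
      unfolding norm_scaleR using dr1 F1 K p by (intro mult_mono) auto
    have b3: "norm ((c * incr s t \<omega> * drift x s t \<omega>) *\<^sub>R F 2 (path \<omega>) t x) \<le> (\<bar>c\<bar> * (2 * K * p)) * (C2 * q)"
    proof -
      have "\<bar>c * incr s t \<omega> * drift x s t \<omega>\<bar> \<le> \<bar>c\<bar> * (2 * K * p)"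
        using mult_left_mono[OF incdr, of "\<bar>c\<bar>"] by (simp add: abs_mult mult.assoc)
      then show ?thesis unfolding norm_scaleR using F2 K p by (intro mult_mono) auto
    qed
    have b4: "norm (((t - s) / 2 * (drift x s t \<omega>)\<^sup>2) *\<^sub>R F 2 (path \<omega>) t x) \<le> (T / 2 * (K\<^sup>2 * p)) * (C2 * q)"
    proof -
      have "(t - s) / 2 * (drift x s t \<omega>)\<^sup>2 \<le> T / 2 * (K\<^sup>2 * p)" using dr2 st by (intro mult_mono) auto
      then have "\<bar>(t - s) / 2 * (drift x s t \<omega>)\<^sup>2\<bar> \<le> T / 2 * (K\<^sup>2 * p)" using st by simp
      then show ?thesis unfolding norm_scaleR using F2 K p T_pos by (intro mult_mono) auto
    qed
    have "norm (bulk x s t \<omega>) \<le> C0 * p * q + (K * p) * (C1 * q) + (\<bar>c\<bar> * (2 * K * p)) * (C2 * q) + (T / 2 * (K\<^sup>2 * p)) * (C2 * q)"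
      unfolding bulk_def by (intro norm_triangle_le add_mono b1 b2 b3 b4)
    also have "\<dots> = G * (p * q)" by (simp add: G_def algebra_simps)
    also have "\<dots> \<le> G * (B * q * q)"
      using B(2)[OF m] K C0 C1 C2 T_pos q by (intro mult_left_mono mult_right_mono) (auto simp: p_def q_def G_def)
    also have "q * q = exp (2 * e * (m \<omega>)\<^sup>2)" by (simp add: q_def exp_add[symmetric] algebra_simps)
    then have "G * (B * q * q) = G * B * exp (2 * e * (m \<omega>)\<^sup>2)" by (simp add: ac_simps)
    finally show "norm (bulk x s t \<omega>) \<le> G * B * exp (2 * e * (m \<omega>)\<^sup>2)" .
  qed
qed

text \<open>The Taylor segment has a random radius of order \<open>1 + m\<close>, so the moderate
  bound is applied with \<open>y\<close> itself growing in \<open>m\<close> instead of on a fixed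
  ball.\<close>

lemma rest_bound:
  obtains C where "C \<ge> 0" "\<And>\<omega> s t. \<omega> \<in> space M \<Longrightarrow> 0 \<le> s \<Longrightarrow> s < t \<Longrightarrow> t \<le> T \<Longrightarrow>
    norm (rest x s t \<omega>) \<le> C * exp ((m \<omega>)\<^sup>2 / (16 * T)) * (\<bar>incr s t \<omega>\<bar> ^ 3 + (t - s) ^ 3)"
proof -
  \<comment> \<open>Two factors at this rate give \<open>1 / (16 * T)\<close>, half of the
    integrable rate: the bound is squared later.\<close>
  define e where "e = 1 / (32 * T)"
  have e: "e > 0" using T_pos by (auto simp: e_def)
  obtain K where K: "K \<ge> 0" "\<And>\<omega> s t. \<omega> \<in> space M \<Longrightarrow> 0 \<le> s \<Longrightarrow> s < t \<Longrightarrow> t \<le> T \<Longrightarrow> \<bar>drift x s t \<omega>\<bar> \<le> K * (1 + m \<omega>)"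
    "\<And>\<omega> s t. \<omega> \<in> space M \<Longrightarrow> 0 \<le> s \<Longrightarrow> s < t \<Longrightarrow> t \<le> T \<Longrightarrow> \<bar>x\<bar> + \<bar>flow (path \<omega>) s x t - x\<bar> \<le> K * (1 + m \<omega>)"
    by (rule drift_bound) blast
  \<comment> \<open>Chosen so that \<open>y\<^sup>2 + m\<^sup>2 \<le> L * (1 + m\<^sup>2)\<close>
    whenever \<open>\<bar>y\<bar> \<le> K * (1 + m)\<close>.\<close>
  define L where "L = 2 * K\<^sup>2 + 1"
  have L: "L > 0" by (simp add: L_def add_nonneg_pos)
  obtain C where C: "C \<ge> 0" "\<And>w m t y r. admissible w m t r \<Longrightarrow> norm (F 3 w t y) \<le> C * exp (e / L * (y\<^sup>2 + m\<^sup>2))"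
    by (rule moderateE[OF moderate_F[of 3], of "e / L"]) (use e L in auto)
  obtain B where B: "B \<ge> 0" "\<And>x. x \<ge> 0 \<Longrightarrow> (1 + x) ^ 3 \<le> B * exp (e * x\<^sup>2)"
    using polynomial_le_gaussian[OF e(1), of 3] by blast
  define G where "G = C * exp e * 4 * (\<bar>c\<bar> ^ 3 + K ^ 3) * B"
  show ?thesis
  proof (rule that[of G])
    show "G \<ge> 0" using C B K by (simp add: G_def)
    fix \<omega> s t assume \<omega>: "\<omega> \<in> space M" and st: "0 \<le> s" "s < t" "t \<le> T"
    have m: "m \<omega> \<ge> 0" by (rule m_nonneg[OF \<omega>])
    define d where "d = flow (path \<omega>) s x t - x"
    have t: "t \<in> {0..T}" using st by auto
    define q where "q = exp (e * (m \<omega>)\<^sup>2)"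
    have q: "q \<ge> 0" by (simp add: q_def)
    have "norm (rest x s t \<omega>) \<le> (C * exp e * q) * \<bar>d\<bar> ^ 3"
      unfolding rest_def d_def[symmetric] Let_def
    proof (rule taylor_third_order_bound[where g = "\<lambda>n. F n (path \<omega>) t"])
      show "(F n (path \<omega>) t has_vector_derivative F (Suc n) (path \<omega>) t x) (at x)" for n x
        by (rule F_deriv[OF path_continuous[OF \<omega>] t])
      fix r :: real assume r: "0 \<le> r" "r \<le> 1"
      have "\<bar>x + r * d\<bar> \<le> \<bar>x\<bar> + \<bar>r\<bar> * \<bar>d\<bar>" using abs_triangle_ineq[of x "r * d"] by (simp add: abs_mult)
      also have "\<dots> \<le> \<bar>x\<bar> + \<bar>d\<bar>" using r by (simp add: mult_left_le_one_le)
      also have "\<dots> \<le> K * (1 + m \<omega>)" using K(3)[OF \<omega> st] by (simp add: d_def)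
      finally have "\<bar>x + r * d\<bar>\<^sup>2 \<le> (K * (1 + m \<omega>))\<^sup>2" by (intro power_mono) auto
      then have "(x + r * d)\<^sup>2 \<le> K\<^sup>2 * (1 + m \<omega>)\<^sup>2" by (simp add: power_mult_distrib)
      also have "\<dots> \<le> K\<^sup>2 * (2 * (1 + (m \<omega>)\<^sup>2))"
        using sum_squares_bound[of 1 "m \<omega>"] by (intro mult_left_mono) (auto simp: power2_eq_square algebra_simps)
      finally have "(x + r * d)\<^sup>2 + (m \<omega>)\<^sup>2 \<le> L * (1 + (m \<omega>)\<^sup>2)" by (simp add: L_def algebra_simps)
      then have "e / L * ((x + r * d)\<^sup>2 + (m \<omega>)\<^sup>2) \<le> e / L * (L * (1 + (m \<omega>)\<^sup>2))" using e L by (intro mult_left_mono) auto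
      also have "\<dots> = e + e * (m \<omega>)\<^sup>2" using L by (simp add: distrib_left)
      finally have le: "exp (e / L * ((x + r * d)\<^sup>2 + (m \<omega>)\<^sup>2)) \<le> exp (e + e * (m \<omega>)\<^sup>2)" by simp
      have "norm (F 3 (path \<omega>) t (x + r * d)) \<le> C * exp (e / L * ((x + r * d)\<^sup>2 + (m \<omega>)\<^sup>2))"
        using C(2) path_admissible[OF \<omega> t t] by blast
      also have "\<dots> \<le> C * exp (e + e * (m \<omega>)\<^sup>2)" using le C by (intro mult_left_mono) auto
      finally show "norm (F 3 (path \<omega>) t (x + r * d)) \<le> C * exp e * q" by (simp add: q_def exp_add mult.assoc)
    qed
    also have "\<bar>d\<bar> ^ 3 \<le> 4 * ((\<bar>c\<bar> ^ 3 + K ^ 3) * ((1 + m \<omega>) ^ 3 * (\<bar>incr s t \<omega>\<bar> ^ 3 + (t - s) ^ 3)))"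
    proof -
      define u v where "u = \<bar>c\<bar> * \<bar>incr s t \<omega>\<bar>" and "v = (t - s) * (K * (1 + m \<omega>))"
      have uv: "u \<ge> 0" "v \<ge> 0" using st m K by (auto simp: u_def v_def)
      have "\<bar>d\<bar> \<le> \<bar>c * incr s t \<omega>\<bar> + \<bar>(t - s) * drift x s t \<omega>\<bar>"
        using flow_displacement[OF \<omega> st, of x] abs_triangle_ineq by (simp add: d_def)
      also have "\<dots> \<le> u + v" using K(2)[OF \<omega> st] st by (auto simp: u_def v_def abs_mult intro!: mult_left_mono)
      finally have "\<bar>d\<bar> ^ 3 \<le> (u + v) ^ 3" by (intro power_mono) auto
      also have "\<dots> \<le> 4 * (u ^ 3 + v ^ 3)"
      proof -
        have "4 * (u ^ 3 + v ^ 3) - (u + v) ^ 3 = 3 * ((u + v) * (u - v)\<^sup>2)"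
          by (simp add: power2_eq_square power3_eq_cube algebra_simps)
        moreover have "0 \<le> (u + v) * (u - v)\<^sup>2" using uv by simp
        ultimately show ?thesis by linarith
      qed
      also have "u ^ 3 \<le> \<bar>c\<bar> ^ 3 * ((1 + m \<omega>) ^ 3 * \<bar>incr s t \<omega>\<bar> ^ 3)"
        using m mult_right_mono[of 1 "(1 + m \<omega>) ^ 3" "\<bar>incr s t \<omega>\<bar> ^ 3"]
        by (auto simp: u_def power_mult_distrib intro!: mult_left_mono)
      also have "v ^ 3 = K ^ 3 * ((1 + m \<omega>) ^ 3 * (t - s) ^ 3)" by (simp add: v_def power_mult_distrib)
      also have "\<bar>c\<bar> ^ 3 * ((1 + m \<omega>) ^ 3 * \<bar>incr s t \<omega>\<bar> ^ 3) + K ^ 3 * ((1 + m \<omega>) ^ 3 * (t - s) ^ 3)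
         \<le> (\<bar>c\<bar> ^ 3 + K ^ 3) * ((1 + m \<omega>) ^ 3 * (\<bar>incr s t \<omega>\<bar> ^ 3 + (t - s) ^ 3))"
        using K m st by (simp add: algebra_simps)
      finally show ?thesis by simp
    qed
    also have "(1 + m \<omega>) ^ 3 \<le> B * q" using B(2)[OF m] by (simp add: q_def)
    finally have "norm (rest x s t \<omega>) \<le> (C * exp e * q) * (4 * ((\<bar>c\<bar> ^ 3 + K ^ 3) * (B * q * (\<bar>incr s t \<omega>\<bar> ^ 3 + (t - s) ^ 3))))"
      using C q K st by (simp add: mult_left_mono mult_right_mono)
    also have "\<dots> = G * (q * q) * (\<bar>incr s t \<omega>\<bar> ^ 3 + (t - s) ^ 3)" by (simp add: G_def ac_simps)
    also have "q * q = exp ((m \<omega>)\<^sup>2 / (16 * T))" by (simp add: q_def e_def exp_add[symmetric] field_simps)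
    finally show "norm (rest x s t \<omega>) \<le> G * exp ((m \<omega>)\<^sup>2 / (16 * T)) * (\<bar>incr s t \<omega>\<bar> ^ 3 + (t - s) ^ 3)" .
  qed
qed

end

section \<open>Expectations of the terms of the decomposition\<close>

context ou_model
begin

lemma kill_measurable: "0 \<le> s \<Longrightarrow> t \<le> T \<Longrightarrow> kill x s t \<in> borel_measurable M"
  unfolding kill_def[abs_def] by (rule integral_running_measurable) auto

lemma drift_measurable:
  assumes st: "0 \<le> s" "s < t" "t \<le> T" shows "drift x s t \<in> borel_measurable M"
proof -
  have [measurable]: "(\<lambda>\<omega>. flow (path \<omega>) s x t) \<in> borel_measurable M"
    by (rule flow_measurable) (use st in auto)
  have "(\<lambda>\<omega>. (flow (path \<omega>) s x t - x - c * (W t \<omega> - W s \<omega>)) / (t - s)) \<in> borel_measurable M" by measurable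
  then show ?thesis
    by (rule measurable_cong[THEN iffD1, rotated]) (use st flow_displacement[OF _ st, of _ x] in \<open>simp add: incr_def\<close>)
qed

lemma bulk_measurable:
  assumes st: "0 \<le> s" "s < t" "t \<le> T" shows "bulk x s t \<in> borel_measurable M"
proof -
  note [measurable] = kill_measurable[OF st(1,3)] drift_measurable[OF st] F_measurable_M
  have s: "s \<in> {0..T}" "t \<in> {0..T}" using st by auto
  \<comment> \<open>The functional at the random point \<open>flow (path \<omega>) s x t\<close> is
    expressed through a deterministic starting point by inverting \<open>F0_flow\<close>.\<close>
  have "(\<lambda>\<omega>. F 0 (path \<omega>) s x * exp (- kill x s t \<omega>)) \<in> borel_measurable M" using s by measurable
  then have [measurable]: "(\<lambda>\<omega>. F 0 (path \<omega>) t (flow (path \<omega>) s x t)) \<in> borel_measurable M"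
    by (rule measurable_cong[THEN iffD1, rotated]) (use F0_flow[of _ s t x] st in \<open>simp add: exp_minus\<close>)
  show ?thesis unfolding bulk_def[abs_def] incr_def using s by measurable
qed

lemma bulk_integrable:
  assumes st: "0 \<le> s" "s < t" "t \<le> T" shows "integrable M (bulk x s t)"
proof -
  obtain \<Phi> where \<Phi>: "integrable M \<Phi>"
    "\<And>\<omega> s t. \<omega> \<in> space M \<Longrightarrow> 0 \<le> s \<Longrightarrow> s < t \<Longrightarrow> t \<le> T \<Longrightarrow> norm (bulk x s t \<omega>) \<le> \<Phi> \<omega>"
    by (rule bulk_dominated) blast
  show ?thesis
    by (rule Bochner_Integration.integrable_bound[OF \<Phi>(1) bulk_measurable[OF st]])
       (intro AE_I2 order_trans[OF \<Phi>(2)[OF _ st]], auto)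
qed

lemma
  assumes st: "0 \<le> s" "s < t" "t \<le> T"
  shows rest_integrable: "integrable M (rest x s t)"
    and D0_difference: "D 0 s x - D 0 t x
      = (c\<^sup>2 / 2 * (t - s)) *\<^sub>R D 2 t x + (t - s) *\<^sub>R (\<integral>\<omega>. bulk x s t \<omega> \<partial>M) + (\<integral>\<omega>. rest x s t \<omega> \<partial>M)"
proof -
  have s: "s \<in> {0..T}" and t: "t \<in> {0..T}" using st by auto
  have meas: "(\<lambda>y::real. of_real (y ^ k) :: complex) \<in> borel_measurable borel" for k by measurable
  have int: "integrable M (\<lambda>\<omega>. of_real ((W t \<omega> - W s \<omega>) ^ k) :: complex)" for k
    using integrable_increment_power[OF st(1,2), of k] by (rule integrable_of_real)
  note * = integrable_mult_increment[OF st(1,2) F_measurable_outside[OF st] F_integrable[OF t] meas int]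
    expectation_mult_increment[OF st(1,2) F_measurable_outside[OF st] F_integrable[OF t] meas int]
  have i1: "integrable M (\<lambda>\<omega>. incr s t \<omega> *\<^sub>R F 1 (path \<omega>) t x)"
    using *(1)[of 1 x 1] by (simp add: incr_def scaleR_conv_of_real mult.commute)
  have i2: "integrable M (\<lambda>\<omega>. (incr s t \<omega>)\<^sup>2 *\<^sub>R F 2 (path \<omega>) t x)"
    using *(1)[of 2 x 2] by (simp add: incr_def scaleR_conv_of_real mult.commute)
  have e1: "(\<integral>\<omega>. incr s t \<omega> *\<^sub>R F 1 (path \<omega>) t x \<partial>M) = 0"
    using *(2)[of 1 x 1] expectation_increment[OF st(1,2)]
    by (simp add: incr_def scaleR_conv_of_real mult.commute del: of_real_diff)
  have e2: "(\<integral>\<omega>. (incr s t \<omega>)\<^sup>2 *\<^sub>R F 2 (path \<omega>) t x \<partial>M) = (t - s) *\<^sub>R D 2 t x"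
    using *(2)[of 2 x 2] expectation_increment_even[OF st(1,2), of 1]
    by (simp add: incr_def scaleR_conv_of_real mult.commute D_def del: of_real_diff of_real_power)
  \<comment> \<open>The decomposition solved for \<open>rest\<close>: integrability and expectation
    of \<open>rest\<close> are inherited from the other terms.\<close>
  let ?f = "\<lambda>\<omega>. (F 0 (path \<omega>) s x - F 0 (path \<omega>) t x) - c *\<^sub>R (incr s t \<omega> *\<^sub>R F 1 (path \<omega>) t x)
     - (c\<^sup>2 / 2) *\<^sub>R ((incr s t \<omega>)\<^sup>2 *\<^sub>R F 2 (path \<omega>) t x) - (t - s) *\<^sub>R bulk x s t \<omega>"
  have f: "?f \<omega> = rest x s t \<omega>" if "\<omega> \<in> space M" for \<omega>
    using increment_decomposition[OF that st, of x] by simp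
  have "integrable M ?f"
    by (intro Bochner_Integration.integrable_diff integrable_scaleR_right i1 i2 F_integrable s t bulk_integrable st)
  then show "integrable M (rest x s t)"
    by (rule Bochner_Integration.integrable_cong[THEN iffD1, OF refl, rotated]) (rule f)
  have "(\<integral>\<omega>. rest x s t \<omega> \<partial>M) = (\<integral>\<omega>. ?f \<omega> \<partial>M)"
    by (rule Bochner_Integration.integral_cong[OF refl]) (rule f[symmetric])
  also have "\<dots> = (D 0 s x - D 0 t x) - c *\<^sub>R 0 - (c\<^sup>2 / 2) *\<^sub>R ((t - s) *\<^sub>R D 2 t x) - (t - s) *\<^sub>R (\<integral>\<omega>. bulk x s t \<omega> \<partial>M)"
    unfolding e1[symmetric] e2[symmetric] D_def[of 0]
    by (intro has_bochner_integral_integral_eq has_bochner_integral_diff has_bochner_integral_scaleR_right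
        has_bochner_integral_integrable i1 i2 F_integrable s t bulk_integrable st)
  finally show "D 0 s x - D 0 t x
      = (c\<^sup>2 / 2 * (t - s)) *\<^sub>R D 2 t x + (t - s) *\<^sub>R (\<integral>\<omega>. bulk x s t \<omega> \<partial>M) + (\<integral>\<omega>. rest x s t \<omega> \<partial>M)"
    by simp
qed

text \<open>The factor \<open>exp (m\<^sup>2 / (16 * T))\<close> is not independent of the
  increment, so the product is split by AM-GM into an integrable Gaussian and a sixth power of the
  increment. The resulting order 3/2 in \<open>t - s\<close> survives division by
  \<open>t - s\<close>.\<close>

lemma rest_expectation_bound:
  obtains C where "C \<ge> 0" "\<And>s t. 0 \<le> s \<Longrightarrow> s < t \<Longrightarrow> t \<le> T \<Longrightarrow>
    norm (\<integral>\<omega>. rest x s t \<omega> \<partial>M) \<le> C * (t - s) * (sqrt (t - s) + (t - s)\<^sup>2)"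
proof -
  obtain C where C: "C \<ge> 0" "\<And>\<omega> s t. \<omega> \<in> space M \<Longrightarrow> 0 \<le> s \<Longrightarrow> s < t \<Longrightarrow> t \<le> T \<Longrightarrow>
    norm (rest x s t \<omega>) \<le> C * exp ((m \<omega>)\<^sup>2 / (16 * T)) * (\<bar>incr s t \<omega>\<bar> ^ 3 + (t - s) ^ 3)"
    by (rule rest_bound) blast
  define \<Phi> where "\<Phi> \<omega> = exp ((m \<omega>)\<^sup>2 / (8 * T))" for \<omega>
  have \<Phi>: "integrable M \<Phi>" using integrable_gauss by (simp add: \<Phi>_def[abs_def])
  define E where "E = (\<integral>\<omega>. \<Phi> \<omega> \<partial>M)"
  have E: "E \<ge> 0" unfolding E_def by (rule integral_nonneg_AE) (simp add: \<Phi>_def)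
  show ?thesis
  proof (rule that[of "C * (E + 15)"])
    fix s t assume st: "0 \<le> s" "s < t" "t \<le> T"
    define g where "g = sqrt (t - s)"
    have g: "g > 0" "t - s = g\<^sup>2" using st by (auto simp: g_def)
    have i6: "integrable M (\<lambda>\<omega>. (incr s t \<omega>) ^ 6)" using integrable_increment_power[OF st(1,2), of 6] by (simp add: incr_def)
    have e6: "(\<integral>\<omega>. (incr s t \<omega>) ^ 6 \<partial>M) = 15 * g ^ 6"
      using expectation_increment_even[OF st(1,2), of 3] g by (simp add: incr_def fact_numeral flip: power_mult)
    have pointwise: "norm (rest x s t \<omega>) \<le> C * (g ^ 3 * \<Phi> \<omega> + (incr s t \<omega>) ^ 6 / g ^ 3 + g ^ 6 * \<Phi> \<omega>)"
      if \<omega>: "\<omega> \<in> space M" for \<omega>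
    proof -
      define A B where "A = exp ((m \<omega>)\<^sup>2 / (16 * T))" and "B = \<bar>incr s t \<omega>\<bar> ^ 3"
      have A: "A \<ge> 1" "A\<^sup>2 = \<Phi> \<omega>"
        using T_pos by (simp_all add: A_def \<Phi>_def power2_eq_square exp_add[symmetric] field_simps)
      \<comment> \<open>the weight \<open>g ^ 3\<close> balances both terms, since the sixth moment of the increment is \<open>15 * g ^ 6\<close>\<close>
      have AB: "A * B \<le> g ^ 3 * A\<^sup>2 + B\<^sup>2 / g ^ 3"
      proof -
        define z where "z = g ^ 3"
        have z: "z > 0" using g by (simp add: z_def)
        have "0 \<le> (z * A - B)\<^sup>2 + z * A * B" using z A by (intro add_nonneg_nonneg) (auto simp: B_def)
        then have "z * (A * B) \<le> z * (z * A\<^sup>2) + B\<^sup>2" by (simp add: power2_eq_square algebra_simps)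
        then have "A * B \<le> (z * (z * A\<^sup>2) + B\<^sup>2) / z" using z by (simp add: le_divide_eq mult.commute)
        also have "\<dots> = z * A\<^sup>2 + B\<^sup>2 / z" using z by (simp add: add_divide_distrib)
        finally show ?thesis by (simp add: z_def)
      qed
      have B2: "B\<^sup>2 = (incr s t \<omega>) ^ 6" by (simp add: B_def flip: power_mult)
      have "A \<le> A\<^sup>2" using A(1) by (simp add: power2_eq_square)
      then have "A * (g\<^sup>2) ^ 3 \<le> g ^ 6 * A\<^sup>2"
        using mult_right_mono[of A "A\<^sup>2" "g ^ 6"] by (simp add: mult.commute flip: power_mult)
      with AB have "A * (B + (g\<^sup>2) ^ 3) \<le> g ^ 3 * \<Phi> \<omega> + (incr s t \<omega>) ^ 6 / g ^ 3 + g ^ 6 * \<Phi> \<omega>"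
        unfolding A(2) B2 by (simp add: distrib_left)
      with C(2)[OF \<omega> st] C(1) show ?thesis
        unfolding A_def[symmetric] B_def[symmetric] g(2)
        by (auto simp: mult.assoc intro: order_trans mult_left_mono)
    qed
    have int: "integrable M (\<lambda>\<omega>. C * (g ^ 3 * \<Phi> \<omega> + (incr s t \<omega>) ^ 6 / g ^ 3 + g ^ 6 * \<Phi> \<omega>))"
      by (intro integrable_mult_right Bochner_Integration.integrable_add integrable_divide \<Phi> i6)
    have "norm (\<integral>\<omega>. rest x s t \<omega> \<partial>M) \<le> (\<integral>\<omega>. norm (rest x s t \<omega>) \<partial>M)" by (rule integral_norm_bound)
    also have "\<dots> \<le> (\<integral>\<omega>. C * (g ^ 3 * \<Phi> \<omega> + (incr s t \<omega>) ^ 6 / g ^ 3 + g ^ 6 * \<Phi> \<omega>) \<partial>M)"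
      by (rule integral_mono[OF integrable_norm[OF rest_integrable[OF st]] int pointwise])
    also have "\<dots> = C * (g ^ 3 * E + 15 * g ^ 6 / g ^ 3 + g ^ 6 * E)"
      using \<Phi> i6 by (simp add: E_def e6)
    also have "15 * g ^ 6 / g ^ 3 = 15 * g ^ 3" using g by (simp add: field_simps flip: power_add)
    also have "C * (g ^ 3 * E + 15 * g ^ 3 + g ^ 6 * E) \<le> C * ((E + 15) * (g ^ 3 + g ^ 6))"
      using C(1) g by (intro mult_left_mono) (auto simp: algebra_simps)
    also have "\<dots> = C * (E + 15) * (t - s) * (sqrt (t - s) + (t - s)\<^sup>2)"
      using g(1) unfolding g_def[symmetric] g(2) by (simp add: algebra_simps eval_nat_numeral)
    finally show "norm (\<integral>\<omega>. rest x s t \<omega> \<partial>M) \<le> C * (E + 15) * (t - s) * (sqrt (t - s) + (t - s)\<^sup>2)" .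
  qed (use C E in auto)
qed

section \<open>Limits along shrinking intervals\<close>

context
  fixes s t :: "nat \<Rightarrow> real" and t0 :: real
  assumes st: "\<And>k. 0 \<le> s k" "\<And>k. s k < t k" "\<And>k. t k \<le> T"
    and lim: "s \<longlonglongrightarrow> t0" "t \<longlonglongrightarrow> t0" and t0: "t0 \<in> {0..T}"
begin

text \<open>The mixed term vanishes by continuity of the Brownian path and the squared drift by its
  factor \<open>t - s\<close>; killing and drift survive as averages of continuous
  functions.\<close>

lemma bulk_tendsto:
  assumes \<omega>: "\<omega> \<in> space M"
  shows "(\<lambda>k. bulk x (s k) (t k) \<omega>) \<longlonglongrightarrow> U 0 t0 x * F 0 (path \<omega>) t0 x + (a + b * x) *\<^sub>R F 1 (path \<omega>) t0 x"
proof -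
  note w = path_continuous[OF \<omega>]
  have mem: "s k \<in> {0..T}" "t k \<in> {0..T}" for k using st[of k] by auto
  have h0: "(\<lambda>k. t k - s k) \<longlonglongrightarrow> 0" using tendsto_diff[OF lim(2,1)] by simp
  have drift: "(\<lambda>k. drift x (s k) (t k) \<omega>) \<longlonglongrightarrow> a + b * x"
  proof -
    have "continuous_on ({0..T} \<times> {0..T}) (\<lambda>z. a + b * flow (path \<omega>) (fst z) x (snd z))"
      by (intro continuous_intros continuous_on_flow[OF w]) auto
    then have "continuous_on ({0..T} \<times> {0..T}) (\<lambda>(s, r). a + b * flow (path \<omega>) s x r)" by (simp add: case_prod_unfold)
    from average_tendsto[OF this st lim] show ?thesis by (simp add: drift_def)
  qed
  have kill: "(\<lambda>k. (1 / (t k - s k)) *\<^sub>R kill x (s k) (t k) \<omega>) \<longlonglongrightarrow> U 0 t0 x"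
  proof -
    have "continuous_on ({0..T} \<times> {0..T}) (\<lambda>z. running 0 (path \<omega>) (fst z) x (snd z))"
      by (intro continuous_on_running[OF w] continuous_intros) auto
    then have "continuous_on ({0..T} \<times> {0..T}) (\<lambda>(s, r). running 0 (path \<omega>) s x r)" by (simp add: case_prod_unfold)
    from average_tendsto[OF this st lim] show ?thesis by (simp add: kill_def running_def[of 0 _ t0 x t0])
  qed
  have exp_kill: "(\<lambda>k. (1 / (t k - s k)) *\<^sub>R (exp (kill x (s k) (t k) \<omega>) - 1)) \<longlonglongrightarrow> U 0 t0 x"
  proof -
    let ?q = "\<lambda>k. (1 / (t k - s k)) *\<^sub>R kill x (s k) (t k) \<omega>"
    have "(\<lambda>k. (t k - s k) * (norm (?q k))\<^sup>2) \<longlonglongrightarrow> 0 * (norm (U 0 t0 x))\<^sup>2"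
      by (intro tendsto_mult h0 tendsto_power tendsto_norm kill)
    then have z: "(\<lambda>k. (t k - s k) * (norm (?q k))\<^sup>2) \<longlonglongrightarrow> 0" by simp
    \<comment> \<open>Linearising the exponential costs
      \<open>(norm kill)\<^sup>2 / (t - s)\<close>, which is \<open>t - s\<close> times a convergent
      quantity.\<close>
    have "(\<lambda>k. (1 / (t k - s k)) *\<^sub>R (exp (kill x (s k) (t k) \<omega>) - 1 - kill x (s k) (t k) \<omega>)) \<longlonglongrightarrow> 0"
    proof (rule Lim_null_comparison[OF always_eventually z], rule allI)
      fix k
      have h: "t k - s k > 0" using st[of k] by simp
      have "norm (exp (kill x (s k) (t k) \<omega>) - 1 - kill x (s k) (t k) \<omega>) \<le> (norm (kill x (s k) (t k) \<omega>))\<^sup>2"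
        by (rule norm_exp_minus_one_minus_le[OF kill_Re[OF \<omega>]]) (use st[of k] in auto)
      then have "norm (exp (kill x (s k) (t k) \<omega>) - 1 - kill x (s k) (t k) \<omega>) / (t k - s k) \<le> (norm (kill x (s k) (t k) \<omega>))\<^sup>2 / (t k - s k)"
        using h by (intro divide_right_mono) auto
      moreover have "(t k - s k) * (norm (?q k))\<^sup>2 = (norm (kill x (s k) (t k) \<omega>))\<^sup>2 / (t k - s k)"
        using h by (simp add: power_divide power2_eq_square)
      ultimately show "norm ((1 / (t k - s k)) *\<^sub>R (exp (kill x (s k) (t k) \<omega>) - 1 - kill x (s k) (t k) \<omega>)) \<le> (t k - s k) * (norm (?q k))\<^sup>2"
        using h by simp
    qed
    from tendsto_add[OF this kill] show ?thesis by (simp add: scaleR_diff_right)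
  qed
  have flow: "(\<lambda>k. flow (path \<omega>) (s k) x (t k)) \<longlonglongrightarrow> x"
  proof -
    have "continuous_on ({0..T} \<times> {0..T}) (\<lambda>z. flow (path \<omega>) (fst z) x (snd z))"
      by (intro continuous_intros continuous_on_flow[OF w]) auto
    from continuous_on_tendsto_compose[OF this tendsto_Pair[OF lim]] t0 mem show ?thesis by simp
  qed
  have incr: "(\<lambda>k. incr (s k) (t k) \<omega>) \<longlonglongrightarrow> 0"
    using tendsto_diff[OF continuous_on_tendsto_compose[OF w lim(2)] continuous_on_tendsto_compose[OF w lim(1)]] t0 mem
    by (simp add: incr_def path_def)
  note F = F_path_tendsto[OF \<omega> mem(2) lim(2) t0]
  have "(\<lambda>k. ((1 / (t k - s k)) *\<^sub>R (exp (kill x (s k) (t k) \<omega>) - 1)) * F 0 (path \<omega>) (t k) (flow (path \<omega>) (s k) x (t k))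
      + drift x (s k) (t k) \<omega> *\<^sub>R F 1 (path \<omega>) (t k) x
      + (c * incr (s k) (t k) \<omega> * drift x (s k) (t k) \<omega>) *\<^sub>R F 2 (path \<omega>) (t k) x
      + ((t k - s k) / 2 * (drift x (s k) (t k) \<omega>)\<^sup>2) *\<^sub>R F 2 (path \<omega>) (t k) x)
    \<longlonglongrightarrow> U 0 t0 x * F 0 (path \<omega>) t0 x + (a + b * x) *\<^sub>R F 1 (path \<omega>) t0 x
      + (c * 0 * (a + b * x)) *\<^sub>R F 2 (path \<omega>) t0 x + (0 / 2 * (a + b * x)\<^sup>2) *\<^sub>R F 2 (path \<omega>) t0 x"
    by (intro tendsto_intros exp_kill F flow drift incr h0) simp_all
  then show ?thesis by (simp add: bulk_def)
qed

text \<open>Coefficients are evaluated at the moving right endpoint, so joint continuity of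
  \<open>D 2\<close> is needed. Letting both endpoints move treats left and right difference
  quotients at once.\<close>

lemma D0_quotient_tendsto:
  "(\<lambda>k. (1 / (t k - s k)) *\<^sub>R (D 0 (s k) x - D 0 (t k) x)) \<longlonglongrightarrow>
     (c\<^sup>2 / 2) *\<^sub>R D 2 t0 x + (U 0 t0 x * D 0 t0 x + (a + b * x) *\<^sub>R D 1 t0 x)"
proof -
  have mem: "t k \<in> {0..T}" for k using st(1)[of k] st(2)[of k] st(3)[of k] by auto
  have h0: "(\<lambda>k. t k - s k) \<longlonglongrightarrow> 0" using tendsto_diff[OF lim(2,1)] by simp
  obtain \<Phi> where \<Phi>: "integrable M \<Phi>"
    "\<And>\<omega> s t. \<omega> \<in> space M \<Longrightarrow> 0 \<le> s \<Longrightarrow> s < t \<Longrightarrow> t \<le> T \<Longrightarrow> norm (bulk x s t \<omega>) \<le> \<Phi> \<omega>"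
    by (rule bulk_dominated) blast
  have "(\<lambda>k. \<integral>\<omega>. bulk x (s k) (t k) \<omega> \<partial>M) \<longlonglongrightarrow> (\<integral>\<omega>. U 0 t0 x * F 0 (path \<omega>) t0 x + (a + b * x) *\<^sub>R F 1 (path \<omega>) t0 x \<partial>M)"
  proof (rule integral_dominated_convergence[where w = \<Phi>])
    show "(\<lambda>\<omega>. U 0 t0 x * F 0 (path \<omega>) t0 x + (a + b * x) *\<^sub>R F 1 (path \<omega>) t0 x) \<in> borel_measurable M"
      using F_measurable_M[OF t0, measurable] by measurable
    show "AE \<omega> in M. (\<lambda>k. bulk x (s k) (t k) \<omega>) \<longlonglongrightarrow> U 0 t0 x * F 0 (path \<omega>) t0 x + (a + b * x) *\<^sub>R F 1 (path \<omega>) t0 x"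
      by (intro AE_I2 bulk_tendsto)
    show "AE \<omega> in M. norm (bulk x (s k) (t k) \<omega>) \<le> \<Phi> \<omega>" for k by (intro AE_I2 \<Phi>(2) st)
  qed (intro bulk_measurable st \<Phi>)+
  also have "(\<integral>\<omega>. U 0 t0 x * F 0 (path \<omega>) t0 x + (a + b * x) *\<^sub>R F 1 (path \<omega>) t0 x \<partial>M)
      = U 0 t0 x * D 0 t0 x + (a + b * x) *\<^sub>R D 1 t0 x"
    using F_integrable[OF t0] by (simp add: D_def)
  finally have bulk: "(\<lambda>k. \<integral>\<omega>. bulk x (s k) (t k) \<omega> \<partial>M) \<longlonglongrightarrow> U 0 t0 x * D 0 t0 x + (a + b * x) *\<^sub>R D 1 t0 x" .
  obtain C where C: "C \<ge> 0" "\<And>s t. 0 \<le> s \<Longrightarrow> s < t \<Longrightarrow> t \<le> T \<Longrightarrow>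
    norm (\<integral>\<omega>. rest x s t \<omega> \<partial>M) \<le> C * (t - s) * (sqrt (t - s) + (t - s)\<^sup>2)"
    by (rule rest_expectation_bound) blast
  have "(\<lambda>k. C * (sqrt (t k - s k) + (t k - s k)\<^sup>2)) \<longlonglongrightarrow> C * (sqrt 0 + 0\<^sup>2)"
    by (intro tendsto_intros h0)
  then have z: "(\<lambda>k. C * (sqrt (t k - s k) + (t k - s k)\<^sup>2)) \<longlonglongrightarrow> 0" by simp
  have rest: "(\<lambda>k. (1 / (t k - s k)) *\<^sub>R (\<integral>\<omega>. rest x (s k) (t k) \<omega> \<partial>M)) \<longlonglongrightarrow> 0"
  proof (rule Lim_null_comparison[OF always_eventually z], rule allI)
    fix k
    show "norm ((1 / (t k - s k)) *\<^sub>R (\<integral>\<omega>. rest x (s k) (t k) \<omega> \<partial>M)) \<le> C * (sqrt (t k - s k) + (t k - s k)\<^sup>2)"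
      using C(2)[OF st, of k] st(2)[of k] by (simp add: divide_le_eq ac_simps)
  qed
  have D2: "(\<lambda>k. D 2 (t k) x) \<longlonglongrightarrow> D 2 t0 x" by (rule D_tendsto[OF mem lim(2) t0 tendsto_const])
  have "(\<lambda>k. (c\<^sup>2 / 2) *\<^sub>R D 2 (t k) x + (\<integral>\<omega>. bulk x (s k) (t k) \<omega> \<partial>M) + (1 / (t k - s k)) *\<^sub>R (\<integral>\<omega>. rest x (s k) (t k) \<omega> \<partial>M))
     \<longlonglongrightarrow> (c\<^sup>2 / 2) *\<^sub>R D 2 t0 x + (U 0 t0 x * D 0 t0 x + (a + b * x) *\<^sub>R D 1 t0 x) + 0"
    by (intro tendsto_add tendsto_scaleR tendsto_const D2 bulk rest)
  moreover have "(c\<^sup>2 / 2) *\<^sub>R D 2 (t k) x + (\<integral>\<omega>. bulk x (s k) (t k) \<omega> \<partial>M) + (1 / (t k - s k)) *\<^sub>R (\<integral>\<omega>. rest x (s k) (t k) \<omega> \<partial>M)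
     = (1 / (t k - s k)) *\<^sub>R (D 0 (s k) x - D 0 (t k) x)" for k
    unfolding D0_difference[OF st] using st(2)[of k] by (simp add: scaleR_add_right)
  ultimately show ?thesis by simp
qed

end

text \<open>The equation solved for the time derivative, so that the equation and joint continuity
  are immediate. The minus sign reflects that the quotients subtract the later time from the earlier
  one.\<close>

definition Dt :: "real \<Rightarrow> real \<Rightarrow> complex" where
  "Dt t x = - ((c\<^sup>2 / 2) *\<^sub>R D 2 t x + (U 0 t x * D 0 t x + (a + b * x) *\<^sub>R D 1 t x))"

lemma D0_time_deriv:
  assumes t0: "t0 \<in> {0..T}"
  shows "((\<lambda>t. D 0 t x) has_vector_derivative Dt t0 x) (at t0 within {0..T})"
proof (rule has_vector_derivative_sequentiallyI)
  fix X :: "nat \<Rightarrow> real" assume X: "\<And>k. X k \<in> {0..T}" "\<And>k. X k \<noteq> t0" "X \<longlonglongrightarrow> t0"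
  \<comment> \<open>Orders each pair of times; one of the two is always \<open>t0\<close>
    itself.\<close>
  define s t where "s k = min (X k) t0" and "t k = max (X k) t0" for k
  have st: "0 \<le> s k" "s k < t k" "t k \<le> T" for k
    using X(1,2)[of k] t0 by (auto simp: s_def t_def min_def max_def)
  have lim: "s \<longlonglongrightarrow> t0" "t \<longlonglongrightarrow> t0"
    using tendsto_min[OF X(3) tendsto_const[of t0]] tendsto_max[OF X(3) tendsto_const[of t0]]
    by (simp_all add: s_def[abs_def] t_def[abs_def])
  have "(\<lambda>k. - ((1 / (t k - s k)) *\<^sub>R (D 0 (s k) x - D 0 (t k) x))) \<longlonglongrightarrow> Dt t0 x"
    unfolding Dt_def by (intro tendsto_minus D0_quotient_tendsto st lim t0)
  moreover have "- ((1 / (t k - s k)) *\<^sub>R (D 0 (s k) x - D 0 (t k) x)) = (1 / (X k - t0)) *\<^sub>R (D 0 (X k) x - D 0 t0 x)" for k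
  proof (cases "X k < t0")
    case True
    have "1 / (t0 - X k) = - (1 / (X k - t0))" by (metis minus_diff_eq minus_divide_right)
    then show ?thesis using True by (simp add: s_def t_def)
  next
    case False
    then show ?thesis using X(2)[of k] by (simp add: s_def t_def min_def max_def flip: scaleR_minus_right)
  qed
  ultimately show "(\<lambda>k. (1 / (X k - t0)) *\<^sub>R (D 0 (X k) x - D 0 t0 x)) \<longlonglongrightarrow> Dt t0 x" by simp
qed

lemma continuous_on_Dt: "continuous_on ({0..T} \<times> UNIV) (\<lambda>(t, x). Dt t x)"
proof -
  note D = continuous_on_D[unfolded case_prod_unfold]
  have "continuous_on ({0..T} \<times> UNIV) (\<lambda>z. U 0 (fst z) (snd z) :: complex)"
    by (rule continuous_on_U) (auto intro!: continuous_intros)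
  then show ?thesis unfolding case_prod_unfold Dt_def by (intro continuous_intros D)
qed

end

section \<open>The Feynman-Kac equation\<close>

lemma powser_diffs_has_vector_derivative:
  assumes "tame p"
  shows "((\<lambda>x. u * complex_of_real (powser ((diffs ^^ n) p) x)) has_vector_derivative
     u * complex_of_real (powser ((diffs ^^ Suc n) p) x)) (at x)"
proof -
  have "(powser ((diffs ^^ n) p) has_vector_derivative powser ((diffs ^^ Suc n) p) x) (at x)"
    using powser_has_derivative[OF tame_diffs_power[OF assms, of n], of x]
    by (simp add: has_real_derivative_iff_has_vector_derivative)
  from bounded_linear.has_vector_derivative[OF bounded_linear_of_real this]
  show ?thesis by (rule has_vector_derivative_mult_right)
qed

lemma powser_diffs_growth:
  fixes u :: "real \<Rightarrow> complex"
  assumes p: "tame p" and u: "continuous_on {0..T} u" and e: "e > 0"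
  shows "\<exists>C\<ge>0. \<forall>s\<in>{0..T}. \<forall>x. norm (u s * complex_of_real (powser ((diffs ^^ n) p) x)) \<le> C * exp (e * x\<^sup>2)"
proof -
  have "compact (u ` {0..T})" by (rule compact_continuous_image[OF u]) auto
  then obtain B where B: "\<And>s. s \<in> {0..T} \<Longrightarrow> norm (u s) \<le> B"
    using compact_imp_bounded bounded_iff by (metis imageI)
  obtain C where C: "C \<ge> 0" "\<And>x. \<bar>powser ((diffs ^^ n) p) x\<bar> \<le> C * exp (e * x\<^sup>2)"
    using tame_powser_growth[OF tame_diffs_power[OF p, of n] e] by blast
  have "norm (u s * complex_of_real (powser ((diffs ^^ n) p) x)) \<le> (max B 0 * C) * exp (e * x\<^sup>2)" if "s \<in> {0..T}" for s x
  proof -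
    have "norm (u s) * \<bar>powser ((diffs ^^ n) p) x\<bar> \<le> max B 0 * (C * exp (e * x\<^sup>2))"
      using B[OF that] C by (intro mult_mono) auto
    then show ?thesis by (simp add: norm_mult mult.assoc)
  qed
  then show ?thesis using C by (intro exI[of _ "max B 0 * C"]) auto
qed

lemma powser_diffs_continuous:
  assumes p: "tame p" and u: "continuous_on {0..T} u"
  shows "continuous_on ({0..T} \<times> UNIV) (\<lambda>z. u (fst z) * complex_of_real (powser ((diffs ^^ n) p) (snd z)))"
proof -
  have "continuous_on UNIV (powser ((diffs ^^ n) p))"
    using powser_has_derivative[OF tame_diffs_power[OF p]] DERIV_isCont continuous_at_imp_continuous_on by blast
  then have "continuous_on ({0..T} \<times> UNIV) (\<lambda>z. powser ((diffs ^^ n) p) (snd z))"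
    by (rule continuous_on_compose2) (auto intro!: continuous_intros)
  moreover have "continuous_on ({0..T} \<times> UNIV) (\<lambda>z. u (fst z))"
    by (rule continuous_on_compose2[OF u]) (auto intro!: continuous_intros)
  ultimately show ?thesis by (intro continuous_intros)
qed

text \<open>Conditioning on \<open>X_t = x\<close> is expressed by starting the solution at
  \<open>(t, x)\<close>. The time derivative is taken within \<open>{0..T}\<close>, hence one-sided
  at the two ends.\<close>

theorem theorem6p11:
  fixes M :: "'a measure" and W :: "real \<Rightarrow> 'a \<Rightarrow> real"
    and a b c T :: real
    and u1 u2 u3 v :: "real \<Rightarrow> complex"
    and p p1 p2 p3 q :: "nat \<Rightarrow> real"
    and X :: "real \<Rightarrow> real \<Rightarrow> real \<Rightarrow> 'a \<Rightarrow> real"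
  assumes BM: "brownian_motion M W"
    and c_nz: "c \<noteq> 0" and T_pos: "T > 0"
    and cont_u1: "continuous_on {0..T} u1" and cont_u2: "continuous_on {0..T} u2"
    and cont_u3: "continuous_on {0..T} u3" and cont_v: "continuous_on {0..T} v"
    and Re_u1: "\<forall>s\<in>{0..T}. Re (u1 s) \<le> 0"
    and Re_u2: "\<forall>s\<in>{0..T}. Re (u2 s) = 0"
    and Re_u3: "\<forall>s\<in>{0..T}. Re (u3 s) = 0"
    and Re_v: "\<forall>s\<in>{0..T}. Re (v s) = 0"
    and p_negl: "negligible_dfact p"
    and p1_eq: "p1 = cauchy_prod p p"
    and p2_negl: "negligible_dfact p2" and p3_negl: "negligible_dfact p3"
    and q_negl: "negligible_dfact q"
    \<comment> \<open>X t x is the (pathwise) solution of dX = (a + bX) dt + c dW on [t,T] with X_t = x\<close>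
    and X_sol: "\<forall>t\<in>{0..T}. \<forall>x. \<forall>\<omega>\<in>space M.
        continuous_on {t..T} (\<lambda>s. X t x s \<omega>) \<and>
        (\<forall>s\<in>{t..T}. X t x s \<omega> =
           x + integral {t..s} (\<lambda>r. a + b * X t x r \<omega>) + c * (W s \<omega> - W t \<omega>))"
  defines "f \<equiv> \<lambda>t x. integral\<^sup>L M (\<lambda>\<omega>. exp (
        integral {t..T} (\<lambda>s. u1 s * complex_of_real (powser p1 (X t x s \<omega>))
                            + u2 s * complex_of_real (powser p2 (X t x s \<omega>))
                            + u3 s * complex_of_real (powser p3 (X t x s \<omega>)))
        + v T * complex_of_real (powser q (X t x T \<omega>))))"
  shows "\<exists>(D :: nat \<Rightarrow> real \<Rightarrow> real \<Rightarrow> complex) (Ft :: real \<Rightarrow> real \<Rightarrow> complex).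
     (\<forall>t\<in>{0..T}. \<forall>x. D 0 t x = f t x) \<and>
     (\<forall>n. \<forall>t\<in>{0..T}. \<forall>x. ((\<lambda>y. D n t y) has_vector_derivative D (Suc n) t x) (at x)) \<and>
     (\<forall>n. continuous_on ({0..T} \<times> UNIV) (\<lambda>(t, x). D n t x)) \<and>
     (\<forall>t\<in>{0..T}. \<forall>x. ((\<lambda>s. f s x) has_vector_derivative Ft t x) (at t within {0..T})) \<and>
     continuous_on ({0..T} \<times> UNIV) (\<lambda>(t, x). Ft t x) \<and>
     (\<forall>t\<in>{0..T}. \<forall>x.
        Ft t x + D 1 t x * complex_of_real (a + b * x)
        + complex_of_real (c ^ 2 / 2) * D 2 t x
        + f t x * (u1 t * complex_of_real (powser p1 x) + u2 t * complex_of_real (powser p2 x)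
                   + u3 t * complex_of_real (powser p3 x)) = 0) \<and>
     (\<forall>x. f T x = exp (v T * complex_of_real (powser q x)))"
proof -
  have tame_p: "tame p" and tame2: "tame p2" and tame3: "tame p3" and tame_q: "tame q"
    using p_negl p2_negl p3_negl q_negl by (auto intro: tame_if_negligible_dfact)
  have tame1: "tame p1" unfolding p1_eq by (rule tame_cauchy_prod[OF tame_p tame_p])
  define U where "U n s z = u1 s * complex_of_real (powser ((diffs ^^ n) p1) z)
      + u2 s * complex_of_real (powser ((diffs ^^ n) p2) z)
      + u3 s * complex_of_real (powser ((diffs ^^ n) p3) z)" for n s z
  define Q where "Q n z = v T * complex_of_real (powser ((diffs ^^ n) q) z)" for n z
  interpret brownian M W by unfold_locales (rule BM)
  obtain m where m: "m \<in> borel_measurable M" "\<And>\<omega> r. \<omega> \<in> space M \<Longrightarrow> r \<in> {0..T} \<Longrightarrow> \<bar>W r \<omega>\<bar> \<le> m \<omega>"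
    "integrable M (\<lambda>\<omega>. exp ((m \<omega>)\<^sup>2 / (8 * T)))"
    by (rule exists_gaussian_sup_bound[OF T_pos]) blast
  interpret ou_model M W a b c T U Q m
  proof
    show "T > 0" by (rule T_pos)
    show "continuous_on ({0..T} \<times> UNIV) (\<lambda>(s, z). U n s z)" for n
      unfolding U_def case_prod_unfold
      by (intro continuous_on_add powser_diffs_continuous tame1 tame2 tame3 cont_u1 cont_u2 cont_u3)
    show "(U n s has_vector_derivative U (Suc n) s z) (at z)" for n s z
      unfolding U_def[abs_def]
      by (intro has_vector_derivative_add powser_diffs_has_vector_derivative tame1 tame2 tame3)
    show "\<exists>C\<ge>0. \<forall>s\<in>{0..T}. \<forall>z. norm (U n s z) \<le> C * exp (e * z\<^sup>2)" if e: "e > 0" for e n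
    proof -
      obtain C1 C2 C3 where C: "C1 \<ge> 0" "C2 \<ge> 0" "C3 \<ge> 0"
        "\<And>s z. s \<in> {0..T} \<Longrightarrow> norm (u1 s * complex_of_real (powser ((diffs ^^ n) p1) z)) \<le> C1 * exp (e * z\<^sup>2)"
        "\<And>s z. s \<in> {0..T} \<Longrightarrow> norm (u2 s * complex_of_real (powser ((diffs ^^ n) p2) z)) \<le> C2 * exp (e * z\<^sup>2)"
        "\<And>s z. s \<in> {0..T} \<Longrightarrow> norm (u3 s * complex_of_real (powser ((diffs ^^ n) p3) z)) \<le> C3 * exp (e * z\<^sup>2)"
        using powser_diffs_growth[OF tame1 cont_u1 e, of n] powser_diffs_growth[OF tame2 cont_u2 e, of n]
          powser_diffs_growth[OF tame3 cont_u3 e, of n] by blast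
      have "norm (U n s z) \<le> (C1 + C2 + C3) * exp (e * z\<^sup>2)" if "s \<in> {0..T}" for s z
        unfolding U_def distrib_right by (intro norm_triangle_le add_mono C that)
      then show ?thesis using C by (intro exI[of _ "C1 + C2 + C3"]) auto
    qed
    show "Re (U 0 s z) \<le> 0" if s: "s \<in> {0..T}" for s z
    proof -
      \<comment> \<open>The square structure of \<open>p1\<close> meets the sign of
        \<open>Re u1\<close>; the other coefficients are purely imaginary.\<close>
      have "powser p1 z \<ge> 0" unfolding p1_eq powser_cauchy_prod[OF tame_p tame_p] by simp
      then have "Re (u1 s) * powser p1 z \<le> 0" using Re_u1 s by (auto intro: mult_nonpos_nonneg)
      then show ?thesis using Re_u2 Re_u3 s by (simp add: U_def)
    qed
    show "(Q n has_vector_derivative Q (Suc n) z) (at z)" for n z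
      unfolding Q_def[abs_def] by (rule powser_diffs_has_vector_derivative[OF tame_q])
    show "\<exists>C\<ge>0. \<forall>z. norm (Q n z) \<le> C * exp (e * z\<^sup>2)" if e: "e > 0" for e n
      using powser_diffs_growth[OF tame_q continuous_on_const[of "{0..T}" "v T"] e, of n] T_pos
      unfolding Q_def by (meson atLeastAtMost_iff less_eq_real_def order_refl)
    show "Re (Q 0 z) \<le> 0" for z using Re_v T_pos by (simp add: Q_def)
  qed (use m in auto)
  \<comment> \<open>Pathwise uniqueness: the given solution is known only through its integral
    equation.\<close>
  have X: "X t x r \<omega> = flow (path \<omega>) t x r" if "t \<in> {0..T}" "r \<in> {t..T}" "\<omega> \<in> space M" for t x r \<omega>
    unfolding flow_def path_def[abs_def]
    by (rule ou_solution_explicit[where x = "\<lambda>s. X t x s \<omega>" and w = "\<lambda>r. W r \<omega>" and T = T])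
       (use X_sol that W_continuous in auto)
  have f_eq: "f t x = D 0 t x" if t: "t \<in> {0..T}" for t x
    unfolding f_def D_def
  proof (rule Bochner_Integration.integral_cong[OF refl])
    fix \<omega> assume \<omega>: "\<omega> \<in> space M"
    have "integral {t..T} (\<lambda>s. u1 s * complex_of_real (powser p1 (X t x s \<omega>))
          + u2 s * complex_of_real (powser p2 (X t x s \<omega>)) + u3 s * complex_of_real (powser p3 (X t x s \<omega>)))
        = integral {t..T} (running 0 (path \<omega>) t x)"
      by (rule integral_cong) (simp add: running_def U_def X[OF t _ \<omega>])
    moreover have "v T * complex_of_real (powser q (X t x T \<omega>)) = final 0 (path \<omega>) t x"
      using t by (simp add: final_def Q_def X[OF t _ \<omega>])
    ultimately show "exp (integral {t..T} (\<lambda>s. u1 s * complex_of_real (powser p1 (X t x s \<omega>))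
          + u2 s * complex_of_real (powser p2 (X t x s \<omega>)) + u3 s * complex_of_real (powser p3 (X t x s \<omega>)))
        + v T * complex_of_real (powser q (X t x T \<omega>))) = F 0 (path \<omega>) t x"
      by (simp add: F.simps H_def)
  qed
  have f_deriv: "((\<lambda>s. f s x) has_vector_derivative Dt t x) (at t within {0..T})" if t: "t \<in> {0..T}" for t x
    by (rule has_vector_derivative_transform[OF t f_eq D0_time_deriv[OF t]])
  have pde: "Dt t x + D 1 t x * complex_of_real (a + b * x) + complex_of_real (c ^ 2 / 2) * D 2 t x
      + f t x * (u1 t * complex_of_real (powser p1 x) + u2 t * complex_of_real (powser p2 x)
                   + u3 t * complex_of_real (powser p3 x)) = 0" if t: "t \<in> {0..T}" for t x
  proof -
    have "u1 t * complex_of_real (powser p1 x) + u2 t * complex_of_real (powser p2 x)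
        + u3 t * complex_of_real (powser p3 x) = U 0 t x" by (simp add: U_def)
    then show ?thesis unfolding f_eq[OF t] Dt_def scaleR_conv_of_real by (simp only:) (simp add: mult.commute)
  qed
  have final: "f T x = exp (v T * complex_of_real (powser q x))" for x
  proof -
    have T: "T \<in> {0..T}" using T_pos by simp
    have "F 0 (path \<omega>) T x = exp (v T * complex_of_real (powser q x))" for \<omega>
      by (simp add: F.simps H_def final_def Q_def)
    then show ?thesis unfolding f_eq[OF T] D_def by (simp add: prob_space)
  qed
  show ?thesis
    by (intro exI[of _ D] exI[of _ Dt] conjI ballI allI f_eq[symmetric] D_deriv continuous_on_D f_deriv
        continuous_on_Dt pde final)
qed

end
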